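(* Let $A$ be a unital $C^*$-algebra, $\alpha:A\to A$ an endomorphism, and $\mathcal L$ a transfer operator for $(A,\alpha)$ such that all the elements $\mathcal L^n(1)$, $n=1,2,\dots$, are projections. Let $\dot S$ and $\dot A=\{\dot a:a\in A\}$ be the canonical images of $S$ and $A$ in Exel's crossed product $A\times_{\alpha,\mathcal L}\mathbb N$, and let $\dot{\mathcal A}\subset A\times_{\alpha,\mathcal L}\mathbb N$ be the $C^*$-algebra generated by $\dot A$ and $\dot S^k\dot S^{*k}$, $k=1,2,\dots$. Let $\delta:\dot{\mathcal A}\to\dot{\mathcal A}$ be given by $\delta(\cdot)=\dot S(\cdot)\dot S^*$ and $\delta_*:\dot{\mathcal A}\to\dot{\mathcal A}$ by $\delta_*(\cdot)=\dot S^*(\cdot)\dot S$. Then the map $$\gamma:\dot{\mathcal A}\times_\delta\mathbb Z\to A\times_{\alpha,\mathcal L}\mathbb N$$ such that $\gamma(\hat U)=\dot S$ and $\gamma(\hat a)=\dot a$ for all $a\in A$ (where $\hat a$ is the canonical image of $\dot a\in\dot{\mathcal A}$ and $\hat U$ that of the universal partial isometry in $\dot{\mathcal A}\times_\delta\mathbb Z$) establishes a $*$-isomorphism.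
   Context: Endomorphisms of $C^*$-algebras are $*$-endomorphisms and need not be unital. Transfer operators: for a unital $C^*$-algebra $B$ and an endomorphism $\beta$ of $B$, a transfer operator for $(B,\beta)$ is a continuous positive linear map $\beta_*:B\to B$ with $\beta_*(\beta(a)b)=a\beta_*(b)$ for all $a,b\in B$. It is complete if $\beta\beta_*(a)=\beta(1)a\beta(1)$ for all $a\in B$. A complete transfer operator, if it exists, is unique. Crossed product $B\times_\beta\mathbb Z$: if a complete transfer operator $\beta_*$ for $(B,\beta)$ exists, $B\times_\beta\mathbb Z$ is the universal unital $C^*$-algebra generated by a copy of $B$ and a partial isometry $U$ subject to $\beta(b)=UbU^*$, $\beta_*(b)=U^*bU$ for $b\in B$; the canonical images of $b$ and $U$ are written $\hat b$, $\hat U$. Part of the assertion is that for $B=\dot{\mathcal A}$ and $\beta=\delta$ the map $\delta_*$ is the complete transfer operator, so that the crossed product is defined. Exel's crossed product: $\mathcal T(A,\alpha,\mathcal L)$ is the universal $C^*$-algebra generated by a copy of $A$ and an element $S$ subject to $Sa=\alpha(a)S$ and $S^*aS=\mathcal L(a)$ for all $a\in A$. A redundancy is a pair $(a,k)\in\overline{A\alpha(A)A}\times\overline{ASS^*A}$ (closed linear spans) such that $abS=kbS$ for all $b\in A$. $A\times_{\alpha,\mathcal L}\mathbb N$ is the quotient of $\mathcal T(A,\alpha,\mathcal L)$ by the closed two-sided ideal generated by the differences $a-k$ for all redundancies $(a,k)$. *)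

theory Defs
  imports "HOL-Analysis.Analysis" "HOL-Algebra.Module" "HOL-Algebra.Ideal"
begin

section \<open>Unital C*-algebras\<close>

definition complex_ring :: "complex ring"
  where "complex_ring = \<lparr>carrier = UNIV, mult = times, one = 1, zero = 0, add = plus\<rparr>"

record 'a cstar = "(complex, 'a) module" +
  adj :: "'a \<Rightarrow> 'a"  (\<open>_\<^sup>\<star>\<index>\<close> [1000] 999)
  cnorm :: "'a \<Rightarrow> real"

text \<open>The value off the carrier is irrelevant; the library locale \<^locale>\<open>Metric_space\<close> asks for
  a nonnegative symmetric function on the whole type.\<close>

definition cdist :: "'a cstar \<Rightarrow> 'a \<Rightarrow> 'a \<Rightarrow> real"
  where "cdist B x y =
    (if x \<in> carrier B \<and> y \<in> carrier B then cnorm B (x \<ominus>\<^bsub>B\<^esub> y) else 0)"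

definition ctopology :: "'a cstar \<Rightarrow> 'a topology"
  where "ctopology B = Metric_space.mtopology (carrier B) (cdist B)"

text \<open>The zero algebra is admitted: a crossed product of a nonzero algebra may vanish.\<close>

locale unital_cstar_algebra = alg?: ring B + vs?: Module.module complex_ring B
  for B :: "'a cstar" (structure) +
  assumes smult_mult_left:
      "\<lbrakk>x \<in> carrier B; y \<in> carrier B\<rbrakk> \<Longrightarrow> (c \<odot> x) \<otimes> y = c \<odot> (x \<otimes> y)"
    and smult_mult_right:
      "\<lbrakk>x \<in> carrier B; y \<in> carrier B\<rbrakk> \<Longrightarrow> x \<otimes> (c \<odot> y) = c \<odot> (x \<otimes> y)"
    and adj_closed [simp, intro]: "x \<in> carrier B \<Longrightarrow> x\<^sup>\<star> \<in> carrier B"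
    and adj_adj [simp]: "x \<in> carrier B \<Longrightarrow> (x\<^sup>\<star>)\<^sup>\<star> = x"
    and adj_add: "\<lbrakk>x \<in> carrier B; y \<in> carrier B\<rbrakk> \<Longrightarrow> (x \<oplus> y)\<^sup>\<star> = x\<^sup>\<star> \<oplus> y\<^sup>\<star>"
    and adj_smult: "x \<in> carrier B \<Longrightarrow> (c \<odot> x)\<^sup>\<star> = cnj c \<odot> x\<^sup>\<star>"
    and adj_mult: "\<lbrakk>x \<in> carrier B; y \<in> carrier B\<rbrakk> \<Longrightarrow> (x \<otimes> y)\<^sup>\<star> = y\<^sup>\<star> \<otimes> x\<^sup>\<star>"
    and cnorm_nonneg: "x \<in> carrier B \<Longrightarrow> 0 \<le> cnorm B x"
    and cnorm_eq_0: "x \<in> carrier B \<Longrightarrow> cnorm B x = 0 \<longleftrightarrow> x = \<zero>"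
    and cnorm_add: "\<lbrakk>x \<in> carrier B; y \<in> carrier B\<rbrakk> \<Longrightarrow> cnorm B (x \<oplus> y) \<le> cnorm B x + cnorm B y"
    and cnorm_smult: "x \<in> carrier B \<Longrightarrow> cnorm B (c \<odot> x) = cmod c * cnorm B x"
    and cnorm_mult: "\<lbrakk>x \<in> carrier B; y \<in> carrier B\<rbrakk> \<Longrightarrow> cnorm B (x \<otimes> y) \<le> cnorm B x * cnorm B y"
    and cnorm_cstar: "x \<in> carrier B \<Longrightarrow> cnorm B (x\<^sup>\<star> \<otimes> x) = (cnorm B x)\<^sup>2"
    and complete: "Metric_space.mcomplete (carrier B) (cdist B)"

definition cstar_hom :: "'a cstar \<Rightarrow> 'b cstar \<Rightarrow> ('a \<Rightarrow> 'b) \<Rightarrow> bool"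
  where "cstar_hom B D \<phi> \<longleftrightarrow>
    \<phi> \<in> carrier B \<rightarrow> carrier D \<and>
    (\<forall>x\<in>carrier B. \<forall>y\<in>carrier B. \<phi> (x \<oplus>\<^bsub>B\<^esub> y) = \<phi> x \<oplus>\<^bsub>D\<^esub> \<phi> y) \<and>
    (\<forall>x\<in>carrier B. \<forall>y\<in>carrier B. \<phi> (x \<otimes>\<^bsub>B\<^esub> y) = \<phi> x \<otimes>\<^bsub>D\<^esub> \<phi> y) \<and>
    (\<forall>c. \<forall>x\<in>carrier B. \<phi> (c \<odot>\<^bsub>B\<^esub> x) = c \<odot>\<^bsub>D\<^esub> \<phi> x) \<and>
    (\<forall>x\<in>carrier B. \<phi> (x\<^sup>\<star>\<^bsub>B\<^esub>) = (\<phi> x)\<^sup>\<star>\<^bsub>D\<^esub>)"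

definition cstar_unital_hom :: "'a cstar \<Rightarrow> 'b cstar \<Rightarrow> ('a \<Rightarrow> 'b) \<Rightarrow> bool"
  where "cstar_unital_hom B D \<phi> \<longleftrightarrow> cstar_hom B D \<phi> \<and> \<phi> \<one>\<^bsub>B\<^esub> = \<one>\<^bsub>D\<^esub>"

definition cstar_iso :: "'a cstar \<Rightarrow> 'b cstar \<Rightarrow> ('a \<Rightarrow> 'b) \<Rightarrow> bool"
  where "cstar_iso B D \<phi> \<longleftrightarrow> cstar_hom B D \<phi> \<and> bij_betw \<phi> (carrier B) (carrier D)"

definition cstar_endomorphism :: "'a cstar \<Rightarrow> ('a \<Rightarrow> 'a) \<Rightarrow> bool"
  where "cstar_endomorphism B \<beta> \<longleftrightarrow> cstar_hom B B \<beta>"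

definition projection :: "'a cstar \<Rightarrow> 'a \<Rightarrow> bool"
  where "projection B p \<longleftrightarrow> p \<in> carrier B \<and> p\<^sup>\<star>\<^bsub>B\<^esub> = p \<and> p \<otimes>\<^bsub>B\<^esub> p = p"

definition spectrum :: "'a cstar \<Rightarrow> 'a \<Rightarrow> complex set"
  where "spectrum B a = {z. z \<odot>\<^bsub>B\<^esub> \<one>\<^bsub>B\<^esub> \<ominus>\<^bsub>B\<^esub> a \<notin> Units B}"

definition positive_element :: "'a cstar \<Rightarrow> 'a \<Rightarrow> bool"
  where "positive_element B a \<longleftrightarrow>
    a \<in> carrier B \<and> a\<^sup>\<star>\<^bsub>B\<^esub> = a \<and> spectrum B a \<subseteq> \<real>\<^sub>\<ge>\<^sub>0"

definition closed_star_subalgebra :: "'a cstar \<Rightarrow> 'a set \<Rightarrow> bool"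
  where "closed_star_subalgebra B H \<longleftrightarrow>
    submodule H complex_ring B \<and>
    (\<forall>x\<in>H. \<forall>y\<in>H. x \<otimes>\<^bsub>B\<^esub> y \<in> H) \<and> (\<forall>x\<in>H. x\<^sup>\<star>\<^bsub>B\<^esub> \<in> H) \<and>
    closedin (ctopology B) H"

definition cstar_generated :: "'a cstar \<Rightarrow> 'a set \<Rightarrow> 'a set"
  where "cstar_generated B X = \<Inter>{H. X \<subseteq> H \<and> closed_star_subalgebra B H}"

definition closed_span :: "'a cstar \<Rightarrow> 'a set \<Rightarrow> 'a set"
  where "closed_span B X =
    \<Inter>{H. X \<subseteq> H \<and> submodule H complex_ring B \<and> closedin (ctopology B) H}"

definition closed_ideal :: "'a cstar \<Rightarrow> 'a set \<Rightarrow> 'a set"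
  where "closed_ideal B X = \<Inter>{I. X \<subseteq> I \<and> ideal I B \<and> closedin (ctopology B) I}"

text \<open>\<^term>\<open>E\<close> together with \<^term>\<open>q\<close> is the quotient of \<^term>\<open>T\<close> by \<^term>\<open>I\<close>, up to isomorphism.\<close>

definition cstar_quotient :: "'a cstar \<Rightarrow> 'a set \<Rightarrow> 'b cstar \<Rightarrow> ('a \<Rightarrow> 'b) \<Rightarrow> bool"
  where "cstar_quotient T I E q \<longleftrightarrow>
    unital_cstar_algebra E \<and> cstar_hom T E q \<and> q ` carrier T = carrier E \<and>
    {x \<in> carrier T. q x = \<zero>\<^bsub>E\<^esub>} = I"


section \<open>Transfer operators\<close>

definition transfer_operator :: "'a cstar \<Rightarrow> ('a \<Rightarrow> 'a) \<Rightarrow> ('a \<Rightarrow> 'a) \<Rightarrow> bool"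
  where "transfer_operator B \<beta> L \<longleftrightarrow>
    L \<in> carrier B \<rightarrow> carrier B \<and>
    (\<forall>x\<in>carrier B. \<forall>y\<in>carrier B. L (x \<oplus>\<^bsub>B\<^esub> y) = L x \<oplus>\<^bsub>B\<^esub> L y) \<and>
    (\<forall>c. \<forall>x\<in>carrier B. L (c \<odot>\<^bsub>B\<^esub> x) = c \<odot>\<^bsub>B\<^esub> L x) \<and>
    continuous_map (ctopology B) (ctopology B) L \<and>
    (\<forall>x. positive_element B x \<longrightarrow> positive_element B (L x)) \<and>
    (\<forall>a\<in>carrier B. \<forall>b\<in>carrier B. L (\<beta> a \<otimes>\<^bsub>B\<^esub> b) = a \<otimes>\<^bsub>B\<^esub> L b)"

definition complete_transfer_operator :: "'a cstar \<Rightarrow> ('a \<Rightarrow> 'a) \<Rightarrow> ('a \<Rightarrow> 'a) \<Rightarrow> bool"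
  where "complete_transfer_operator B \<beta> L \<longleftrightarrow>
    transfer_operator B \<beta> L \<and>
    (\<forall>a\<in>carrier B. \<beta> (L a) = \<beta> \<one>\<^bsub>B\<^esub> \<otimes>\<^bsub>B\<^esub> a \<otimes>\<^bsub>B\<^esub> \<beta> \<one>\<^bsub>B\<^esub>)"


section \<open>Universal C*-algebras\<close>

text \<open>
  A universal property quantifies over all C*-algebras, hence over all carrier types, which cannot
  be written inside a definition. The competitors below are therefore C*-algebras whose carrier
  is a set of sequences of *-polynomials in one variable with coefficients in the base algebra.
  Nothing is lost: an algebra generated by the image of the base algebra and one further element
  embeds, as a set, into these sequences, since each of its elements is the limit of a sequence of
  *-polynomials. The facts \<open>toeplitz_algebra_universal\<close> and \<open>crossed_product_universal\<close>
  below give the universal property for competitors of every type.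

  In both constructions the unit of the base algebra is the unit of the algebra generated;
  without this the generator would be unconstrained on the complement of that unit and the Toeplitz
  algebra would not exist. The canonical map is only required to be a homomorphism, because
  the relations make sense for every homomorphic image of the base algebra.
\<close>

datatype 'b star_poly =
    Coeff 'b
  | Var
  | Plus "'b star_poly" "'b star_poly"
  | Times "'b star_poly" "'b star_poly"
  | Scale complex "'b star_poly"
  | Adj "'b star_poly"

type_synonym 'b competitor = "(nat \<Rightarrow> 'b star_poly) cstar"

subsection \<open>Crossed product by an endomorphism with a complete transfer operator\<close>

definition covariant_rep ::
    "'b cstar \<Rightarrow> ('b \<Rightarrow> 'b) \<Rightarrow> ('b \<Rightarrow> 'b) \<Rightarrow> 'd cstar \<Rightarrow> ('b \<Rightarrow> 'd) \<Rightarrow> 'd \<Rightarrow> bool"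
  where "covariant_rep B \<beta> L D j u \<longleftrightarrow>
    unital_cstar_algebra D \<and> cstar_unital_hom B D j \<and>
    u \<in> carrier D \<and> u \<otimes>\<^bsub>D\<^esub> u\<^sup>\<star>\<^bsub>D\<^esub> \<otimes>\<^bsub>D\<^esub> u = u \<and>
    (\<forall>b\<in>carrier B. j (\<beta> b) = u \<otimes>\<^bsub>D\<^esub> j b \<otimes>\<^bsub>D\<^esub> u\<^sup>\<star>\<^bsub>D\<^esub>) \<and>
    (\<forall>b\<in>carrier B. j (L b) = u\<^sup>\<star>\<^bsub>D\<^esub> \<otimes>\<^bsub>D\<^esub> j b \<otimes>\<^bsub>D\<^esub> u)"

definition crossed_product ::
    "'b cstar \<Rightarrow> ('b \<Rightarrow> 'b) \<Rightarrow> ('b \<Rightarrow> 'b) \<Rightarrow> 'f cstar \<Rightarrow> ('b \<Rightarrow> 'f) \<Rightarrow> 'f \<Rightarrow> bool"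
  where "crossed_product B \<beta> L F j u \<longleftrightarrow>
    complete_transfer_operator B \<beta> L \<and>
    covariant_rep B \<beta> L F j u \<and>
    cstar_generated F (insert u (j ` carrier B)) = carrier F \<and>
    (\<forall>(D :: 'b competitor) j' u'. covariant_rep B \<beta> L D j' u' \<longrightarrow>
      (\<exists>\<phi>. cstar_unital_hom F D \<phi> \<and> (\<forall>b\<in>carrier B. \<phi> (j b) = j' b) \<and> \<phi> u = u'))"

subsection \<open>Exel's crossed product\<close>

definition toeplitz_rep ::
    "'a cstar \<Rightarrow> ('a \<Rightarrow> 'a) \<Rightarrow> ('a \<Rightarrow> 'a) \<Rightarrow> 'd cstar \<Rightarrow> ('a \<Rightarrow> 'd) \<Rightarrow> 'd \<Rightarrow> bool"
  where "toeplitz_rep A \<alpha> L D j s \<longleftrightarrow>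
    unital_cstar_algebra D \<and> cstar_unital_hom A D j \<and>
    s \<in> carrier D \<and>
    (\<forall>a\<in>carrier A. s \<otimes>\<^bsub>D\<^esub> j a = j (\<alpha> a) \<otimes>\<^bsub>D\<^esub> s) \<and>
    (\<forall>a\<in>carrier A. s\<^sup>\<star>\<^bsub>D\<^esub> \<otimes>\<^bsub>D\<^esub> j a \<otimes>\<^bsub>D\<^esub> s = j (L a))"

definition toeplitz_algebra ::
    "'a cstar \<Rightarrow> ('a \<Rightarrow> 'a) \<Rightarrow> ('a \<Rightarrow> 'a) \<Rightarrow> 't cstar \<Rightarrow> ('a \<Rightarrow> 't) \<Rightarrow> 't \<Rightarrow> bool"
  where "toeplitz_algebra A \<alpha> L T \<iota> S \<longleftrightarrow>
    toeplitz_rep A \<alpha> L T \<iota> S \<and>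
    cstar_generated T (insert S (\<iota> ` carrier A)) = carrier T \<and>
    (\<forall>(D :: 'a competitor) j s. toeplitz_rep A \<alpha> L D j s \<longrightarrow>
      (\<exists>\<phi>. cstar_unital_hom T D \<phi> \<and> (\<forall>a\<in>carrier A. \<phi> (\<iota> a) = j a) \<and> \<phi> S = s))"

text \<open>The first entry of a redundancy is taken in \<^term>\<open>A\<close> itself rather than in its copy inside
  \<^term>\<open>T\<close>.\<close>

definition redundancy ::
    "'a cstar \<Rightarrow> ('a \<Rightarrow> 'a) \<Rightarrow> 't cstar \<Rightarrow> ('a \<Rightarrow> 't) \<Rightarrow> 't \<Rightarrow> 'a \<Rightarrow> 't \<Rightarrow> bool"
  where "redundancy A \<alpha> T \<iota> S a k \<longleftrightarrow>
    a \<in> closed_span A {x \<otimes>\<^bsub>A\<^esub> \<alpha> y \<otimes>\<^bsub>A\<^esub> z | x y z.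
      x \<in> carrier A \<and> y \<in> carrier A \<and> z \<in> carrier A} \<and>
    k \<in> closed_span T {\<iota> x \<otimes>\<^bsub>T\<^esub> S \<otimes>\<^bsub>T\<^esub> S\<^sup>\<star>\<^bsub>T\<^esub> \<otimes>\<^bsub>T\<^esub> \<iota> y | x y.
      x \<in> carrier A \<and> y \<in> carrier A} \<and>
    (\<forall>b\<in>carrier A. \<iota> a \<otimes>\<^bsub>T\<^esub> \<iota> b \<otimes>\<^bsub>T\<^esub> S = k \<otimes>\<^bsub>T\<^esub> \<iota> b \<otimes>\<^bsub>T\<^esub> S)"

definition exel_crossed_product ::
    "'a cstar \<Rightarrow> ('a \<Rightarrow> 'a) \<Rightarrow> ('a \<Rightarrow> 'a) \<Rightarrow>
     't cstar \<Rightarrow> ('a \<Rightarrow> 't) \<Rightarrow> 't \<Rightarrow> 'e cstar \<Rightarrow> ('t \<Rightarrow> 'e) \<Rightarrow> bool"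
  where "exel_crossed_product A \<alpha> L T \<iota> S E q \<longleftrightarrow>
    toeplitz_algebra A \<alpha> L T \<iota> S \<and>
    cstar_quotient T (closed_ideal T {\<iota> a \<ominus>\<^bsub>T\<^esub> k | a k. redundancy A \<alpha> T \<iota> S a k}) E q"


subsection \<open>The universal properties for competitors of every type\<close>

lemma complex_ring_simps [simp]:
  "carrier complex_ring = UNIV" "\<one>\<^bsub>complex_ring\<^esub> = 1" "\<zero>\<^bsub>complex_ring\<^esub> = 0"
  "x \<oplus>\<^bsub>complex_ring\<^esub> y = x + y" "x \<otimes>\<^bsub>complex_ring\<^esub> y = x * y"
  by (simp_all add: complex_ring_def)

context unital_cstar_algebra
begin

lemma smult_minus_one: "x \<in> carrier B \<Longrightarrow> (-1) \<odot> x = \<ominus> x"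
proof -
  assume x: "x \<in> carrier B"
  have "(-1) \<odot> x \<oplus> x = (-1) \<odot> x \<oplus> 1 \<odot> x"
    using x vs.smult_one by simp
  also have "\<dots> = (-1 + 1) \<odot> x"
    using vs.smult_l_distr[of "-1" 1 x] x by simp
  also have "\<dots> = \<zero>"
    using vs.smult_l_null[OF x] by simp
  finally show ?thesis
    using alg.minus_equality[of "(-1) \<odot> x" x] x vs.smult_closed[of "-1" x] by simp
qed

lemma cnorm_minus: "x \<in> carrier B \<Longrightarrow> cnorm B (\<ominus> x) = cnorm B x"
  using cnorm_smult[of x "-1"] by (simp add: smult_minus_one)

lemma metric: "Metric_space (carrier B) (cdist B)"
proof
  fix x y z
  show "0 \<le> cdist B x y" by (simp add: cdist_def cnorm_nonneg)
  have "y \<ominus> x = \<ominus> (x \<ominus> y)" if "x \<in> carrier B" "y \<in> carrier B"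
    using that alg.a_comm[of y "\<ominus> x"] by (simp add: alg.minus_eq alg.minus_add)
  then show "cdist B x y = cdist B y x"
    by (auto simp: cdist_def cnorm_minus)
  show "x \<in> carrier B \<Longrightarrow> y \<in> carrier B \<Longrightarrow> cdist B x y = 0 \<longleftrightarrow> x = y"
    using alg.minus_equality[of x "\<ominus> y"] alg.r_neg[of y]
    by (auto simp: cdist_def cnorm_eq_0 alg.minus_eq)
  assume c: "x \<in> carrier B" "y \<in> carrier B" "z \<in> carrier B"
  then have "x \<ominus> z = (x \<ominus> y) \<oplus> (y \<ominus> z)"
    by (simp add: alg.minus_eq alg.a_assoc alg.r_neg2 alg.r_neg1)
  then show "cdist B x z \<le> cdist B x y + cdist B y z"
    using c cnorm_add[of "x \<ominus> y" "y \<ominus> z"] by (simp add: cdist_def)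
qed

lemma cnorm_adj_le: "x \<in> carrier B \<Longrightarrow> cnorm B x \<le> cnorm B (x\<^sup>\<star>)"
  using cnorm_cstar[of x] cnorm_mult[of "x\<^sup>\<star>" x] cnorm_nonneg[of x] cnorm_nonneg[of "x\<^sup>\<star>"]
  by (smt (verit, best) adj_closed mult_right_cancel mult_strict_right_mono power2_eq_square)

lemma cnorm_adj: "x \<in> carrier B \<Longrightarrow> cnorm B (x\<^sup>\<star>) = cnorm B x"
  using cnorm_adj_le[of x] cnorm_adj_le[of "x\<^sup>\<star>"] by simp

lemma adj_one: "\<one>\<^sup>\<star> = \<one>"
  by (metis alg.l_one alg.one_closed alg.r_one adj_adj adj_closed adj_mult)

lemma submodule_closed:
  assumes "submodule H complex_ring B"
  shows "H \<subseteq> carrier B" "\<zero> \<in> H" "x \<in> H \<Longrightarrow> \<ominus> x \<in> H"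
    "x \<in> H \<Longrightarrow> y \<in> H \<Longrightarrow> x \<oplus> y \<in> H" "x \<in> H \<Longrightarrow> c \<odot> x \<in> H"
  using vs.submoduleE[OF assms] subgroup.one_closed[OF submodule.axioms(1)[OF assms]] by auto

lemma closed_star_subalgebra_carrier: "closed_star_subalgebra B (carrier B)"
  using vs.carrier_is_submodule Metric_space.closedin_mspace[OF metric]
  by (auto simp: closed_star_subalgebra_def ctopology_def)

lemma closed_star_subalgebra_generated: "closed_star_subalgebra B (cstar_generated B X)"
  if "X \<subseteq> carrier B"
proof -
  let ?F = "{H. X \<subseteq> H \<and> closed_star_subalgebra B H}"
  have ne: "carrier B \<in> ?F"
    using that closed_star_subalgebra_carrier by auto
  have sub: "submodule H complex_ring B" if "H \<in> ?F" for H
    using that by (simp add: closed_star_subalgebra_def)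
  have "submodule (\<Inter>?F) complex_ring B"
  proof (rule vs.submoduleI)
    show "\<Inter>?F \<subseteq> carrier B" using ne by blast
    show "\<zero> \<in> \<Inter>?F" using submodule_closed(2)[OF sub] by blast
    show "\<ominus> x \<in> \<Inter>?F" if "x \<in> \<Inter>?F" for x
      using submodule_closed(3)[OF sub] that by blast
    show "x \<oplus> y \<in> \<Inter>?F" if "x \<in> \<Inter>?F" "y \<in> \<Inter>?F" for x y
      using submodule_closed(4)[OF sub] that by blast
    show "c \<odot> x \<in> \<Inter>?F" if "x \<in> \<Inter>?F" for c x
      using submodule_closed(5)[OF sub] that by blast
  qed
  moreover have "closedin (ctopology B) (\<Inter>?F)"
    using ne by (intro closedin_Inter) (auto simp: closed_star_subalgebra_def)
  ultimately show ?thesis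
    by (auto simp: cstar_generated_def closed_star_subalgebra_def)
qed

lemma cstar_generated_minimal:
  "X \<subseteq> H \<Longrightarrow> closed_star_subalgebra B H \<Longrightarrow> cstar_generated B X \<subseteq> H"
  by (auto simp: cstar_generated_def)

end

text \<open>Transport of structure along an injection onto a closed unital *-subalgebra.\<close>

definition pullback :: "'d cstar \<Rightarrow> 'c set \<Rightarrow> ('c \<Rightarrow> 'd) \<Rightarrow> 'c cstar"
  where "pullback D X f =
    (let g = inv_into X f in
     \<lparr>carrier = X, mult = (\<lambda>x y. g (f x \<otimes>\<^bsub>D\<^esub> f y)), one = g \<one>\<^bsub>D\<^esub>, zero = g \<zero>\<^bsub>D\<^esub>,
      add = (\<lambda>x y. g (f x \<oplus>\<^bsub>D\<^esub> f y)), smult = (\<lambda>c x. g (c \<odot>\<^bsub>D\<^esub> f x)),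
      adj = (\<lambda>x. g ((f x)\<^sup>\<star>\<^bsub>D\<^esub>)), cnorm = (\<lambda>x. cnorm D (f x))\<rparr>)"

lemma pullback_cstar:
  fixes D :: "'d cstar" and f :: "'c \<Rightarrow> 'd"
  assumes D: "unital_cstar_algebra D" and inj: "inj_on f X"
    and H: "closed_star_subalgebra D (f ` X)" and one: "\<one>\<^bsub>D\<^esub> \<in> f ` X"
  shows "unital_cstar_algebra (pullback D X f)"
    and "cstar_unital_hom (pullback D X f) D f"
proof -
  interpret D: unital_cstar_algebra D by fact
  let ?P = "pullback D X f"
  define g where "g = inv_into X f"
  define H where "H = f ` X"
  have gX: "g h \<in> X" if "h \<in> H" for h
    using that by (simp add: g_def H_def inv_into_into)
  have fg [simp]: "f (g h) = h" if "h \<in> H" for h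
    using that by (simp add: g_def H_def f_inv_into_f)
  have gf [simp]: "g (f x) = x" if "x \<in> X" for x
    using that inj by (simp add: g_def)
  have fH [simp]: "f x \<in> H" if "x \<in> X" for x
    using that by (simp add: H_def)
  have cH: "closed_star_subalgebra D H" using H by (simp add: H_def)
  then have sm: "submodule H complex_ring D" by (simp add: closed_star_subalgebra_def)
  note subm = D.submodule_closed[OF sm]
  have HD [simp]: "h \<in> carrier D" if "h \<in> H" for h using that subm(1) by blast
  have Hm [simp]: "h \<otimes>\<^bsub>D\<^esub> k \<in> H" if "h \<in> H" "k \<in> H" for h k
    using cH that by (auto simp: closed_star_subalgebra_def)
  have Ha [simp]: "h\<^sup>\<star>\<^bsub>D\<^esub> \<in> H" if "h \<in> H" for h
    using cH that by (auto simp: closed_star_subalgebra_def)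
  have H1 [simp]: "\<one>\<^bsub>D\<^esub> \<in> H" using one by (simp add: H_def)
  note [simp] = subm(2-5) gX
  have P [simp]: "carrier ?P = X" "\<one>\<^bsub>?P\<^esub> = g \<one>\<^bsub>D\<^esub>" "\<zero>\<^bsub>?P\<^esub> = g \<zero>\<^bsub>D\<^esub>"
      "cnorm ?P x = cnorm D (f x)"
      "x \<otimes>\<^bsub>?P\<^esub> y = g (f x \<otimes>\<^bsub>D\<^esub> f y)" "x \<oplus>\<^bsub>?P\<^esub> y = g (f x \<oplus>\<^bsub>D\<^esub> f y)"
      "c \<odot>\<^bsub>?P\<^esub> x = g (c \<odot>\<^bsub>D\<^esub> f x)" "x\<^sup>\<star>\<^bsub>?P\<^esub> = g ((f x)\<^sup>\<star>\<^bsub>D\<^esub>)" for x y c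
    by (simp_all add: pullback_def Let_def g_def)
  have ag: "abelian_group ?P"
  proof (rule abelian_groupI)
    fix x assume x: "x \<in> carrier ?P"
    show "\<exists>y\<in>carrier ?P. y \<oplus>\<^bsub>?P\<^esub> x = \<zero>\<^bsub>?P\<^esub>"
      using x D.alg.l_neg[of "f x"] by (intro bexI[of _ "g (\<ominus>\<^bsub>D\<^esub> f x)"]) simp_all
  qed (simp_all add: D.alg.add.m_ac)
  have mon: "Group.monoid ?P"
    by (rule Group.monoidI) (simp_all add: D.alg.m_assoc)
  have rg: "ring ?P"
    by (rule ringI[OF ag mon]) (simp_all add: D.alg.l_distr D.alg.r_distr)
  have cr: "cring complex_ring"
    using D.vs.R.is_cring by simp
  have md: "Module.module complex_ring ?P"
    using D.vs.smult_l_distr D.vs.smult_r_distr D.vs.smult_assoc1 D.vs.smult_one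
    by (intro moduleI[OF cr ag]) simp_all
  interpret P: ring ?P by (rule rg)
  have neg: "f (\<ominus>\<^bsub>?P\<^esub> y) = \<ominus>\<^bsub>D\<^esub> f y" if "y \<in> X" for y
  proof -
    have "\<ominus>\<^bsub>?P\<^esub> y = g (\<ominus>\<^bsub>D\<^esub> f y)"
      using that by (intro P.minus_equality) (simp_all add: D.alg.l_neg)
    then show ?thesis using that by simp
  qed
  have sub: "f (x \<ominus>\<^bsub>?P\<^esub> y) = f x \<ominus>\<^bsub>D\<^esub> f y" if "x \<in> X" "y \<in> X" for x y
    using that P.a_inv_closed[of y] by (simp add: a_minus_def neg)
  have dist: "cdist ?P x y = cdist D (f x) (f y)" if "x \<in> X" "y \<in> X" for x y
    using that by (simp add: cdist_def sub)
  interpret DM: Metric_space "carrier D" "cdist D" by (rule D.metric)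
  have PM: "Metric_space X (cdist ?P)"
  proof
    fix x y z
    show "0 \<le> cdist ?P x y" by (simp add: cdist_def sub D.cnorm_nonneg)
    show "cdist ?P x y = cdist ?P y x"
    proof (cases "x \<in> X \<and> y \<in> X")
      case True
      then show ?thesis using dist[of x y] dist[of y x] DM.commute[of "f x" "f y"] by simp
    next
      case False
      then show ?thesis by (auto simp: cdist_def)
    qed
    show "x \<in> X \<Longrightarrow> y \<in> X \<Longrightarrow> cdist ?P x y = 0 \<longleftrightarrow> x = y"
      using inj by (simp add: dist inj_on_eq_iff)
    show "x \<in> X \<Longrightarrow> y \<in> X \<Longrightarrow> z \<in> X \<Longrightarrow> cdist ?P x z \<le> cdist ?P x y + cdist ?P y z"
      by (simp add: dist DM.triangle)
  qed
  interpret PM: Metric_space X "cdist ?P" by (rule PM)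
  have comp: "PM.mcomplete"
    unfolding PM.mcomplete_def
  proof (intro allI impI)
    fix \<sigma> assume s: "PM.MCauchy \<sigma>"
    then have r: "\<sigma> n \<in> X" for n by (auto simp: PM.MCauchy_def)
    have "DM.MCauchy (\<lambda>n. f (\<sigma> n))"
      using s r by (auto simp: PM.MCauchy_def DM.MCauchy_def dist)
    then obtain l where l: "limitin DM.mtopology (\<lambda>n. f (\<sigma> n)) l sequentially"
      using D.complete DM.mcomplete_def by blast
    have "l \<in> H"
      using cH l r DM.metric_closedin_iff_sequentially_closed[of H]
      unfolding closed_star_subalgebra_def ctopology_def by (metis fH image_subsetI)
    then have "limitin PM.mtopology \<sigma> (g l) sequentially"
      using l r by (simp add: DM.limit_metric_sequentially PM.limit_metric_sequentially dist)
    then show "\<exists>x. limitin PM.mtopology \<sigma> x sequentially" by blast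
  qed
  show "unital_cstar_algebra ?P"
  proof (rule unital_cstar_algebra.intro[OF rg md], unfold_locales)
    fix x y c
    assume x: "x \<in> carrier ?P"
    have "f x = \<zero>\<^bsub>D\<^esub> \<longleftrightarrow> x = g \<zero>\<^bsub>D\<^esub>"
      using x by (metis P(1) fg gf subm(2))
    then show "cnorm ?P x = 0 \<longleftrightarrow> x = \<zero>\<^bsub>?P\<^esub>"
      using x by (simp add: D.cnorm_eq_0)
    show "cnorm ?P (c \<odot>\<^bsub>?P\<^esub> x) = cmod c * cnorm ?P x"
      using x by (simp add: D.cnorm_smult)
  next
    show "Metric_space.mcomplete (carrier ?P) (cdist ?P)" using comp by simp
  qed (simp_all add: D.smult_mult_left D.smult_mult_right D.adj_add D.adj_smult D.adj_mult
      D.cnorm_nonneg D.cnorm_add D.cnorm_mult D.cnorm_cstar)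
  show "cstar_unital_hom ?P D f"
    by (simp add: cstar_unital_hom_def cstar_hom_def)
qed

primrec star_poly_eval :: "'d cstar \<Rightarrow> ('b \<Rightarrow> 'd) \<Rightarrow> 'd \<Rightarrow> 'b star_poly \<Rightarrow> 'd"
  where
    "star_poly_eval D j u (Coeff b) = j b"
  | "star_poly_eval D j u Var = u"
  | "star_poly_eval D j u (Plus p r) = star_poly_eval D j u p \<oplus>\<^bsub>D\<^esub> star_poly_eval D j u r"
  | "star_poly_eval D j u (Times p r) = star_poly_eval D j u p \<otimes>\<^bsub>D\<^esub> star_poly_eval D j u r"
  | "star_poly_eval D j u (Scale c p) = c \<odot>\<^bsub>D\<^esub> star_poly_eval D j u p"
  | "star_poly_eval D j u (Adj p) = (star_poly_eval D j u p)\<^sup>\<star>\<^bsub>D\<^esub>"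

lemma (in unital_cstar_algebra) cdist_le:
  assumes c: "x \<in> carrier B" "y \<in> carrier B" "p \<in> carrier B" "r \<in> carrier B"
  shows "cdist B (x \<oplus> y) (p \<oplus> r) \<le> cdist B x p + cdist B y r"
    and "cdist B (x \<otimes> y) (p \<otimes> r) \<le> cnorm B x * cdist B y r + cdist B x p * cnorm B r"
    and "cdist B (c \<odot> x) (c \<odot> p) = cmod c * cdist B x p"
    and "cdist B (x\<^sup>\<star>) (p\<^sup>\<star>) = cdist B x p"
proof -
  have "(x \<oplus> y) \<ominus> (p \<oplus> r) = (x \<ominus> p) \<oplus> (y \<ominus> r)"
    using c by (simp add: alg.minus_eq alg.minus_add alg.add.m_ac)
  then show "cdist B (x \<oplus> y) (p \<oplus> r) \<le> cdist B x p + cdist B y r"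
    using c cnorm_add[of "x \<ominus> p" "y \<ominus> r"] by (simp add: cdist_def)
  have "(x \<otimes> y) \<ominus> (p \<otimes> r) = x \<otimes> (y \<ominus> r) \<oplus> (x \<ominus> p) \<otimes> r"
    using c by (simp add: alg.minus_eq alg.l_distr alg.r_distr alg.l_minus alg.r_minus alg.a_assoc alg.r_neg1 alg.r_neg2)
  then have "cnorm B ((x \<otimes> y) \<ominus> (p \<otimes> r)) \<le> cnorm B (x \<otimes> (y \<ominus> r)) + cnorm B ((x \<ominus> p) \<otimes> r)"
    using c cnorm_add[of "x \<otimes> (y \<ominus> r)" "(x \<ominus> p) \<otimes> r"] by simp
  also have "\<dots> \<le> cnorm B x * cnorm B (y \<ominus> r) + cnorm B (x \<ominus> p) * cnorm B r"
    using c by (intro add_mono cnorm_mult) simp_all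
  finally show "cdist B (x \<otimes> y) (p \<otimes> r) \<le> cnorm B x * cdist B y r + cdist B x p * cnorm B r"
    using c by (simp add: cdist_def)
  have m: "\<ominus> (c \<odot> p) = c \<odot> (\<ominus> p)"
    using vs.smult_r_minus[of c p] c by simp
  have cl: "c \<odot> z \<in> carrier B" if "z \<in> carrier B" for z
    using vs.smult_closed that by simp
  have "(c \<odot> x) \<ominus> (c \<odot> p) = c \<odot> (x \<ominus> p)"
    using c vs.smult_r_distr[of c x "\<ominus> p"] by (simp add: alg.minus_eq m)
  then show "cdist B (c \<odot> x) (c \<odot> p) = cmod c * cdist B x p"
    using c cl by (simp add: cdist_def cnorm_smult)
  have "\<ominus> (p\<^sup>\<star>) = (\<ominus> p)\<^sup>\<star>"
    using c adj_smult[of p "-1"] by (simp add: smult_minus_one)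
  then have "(x\<^sup>\<star>) \<ominus> (p\<^sup>\<star>) = (x \<ominus> p)\<^sup>\<star>"
    using c by (simp add: alg.minus_eq adj_add)
  then show "cdist B (x\<^sup>\<star>) (p\<^sup>\<star>) = cdist B x p"
    using c by (simp add: cdist_def cnorm_adj)
qed

lemma cstar_generated_inj_star_poly:
  fixes D :: "'d cstar" and j :: "'b \<Rightarrow> 'd"
  assumes D: "unital_cstar_algebra D" and jD: "\<And>b. j b \<in> carrier D" and u: "u \<in> carrier D"
  obtains \<theta> :: "'d \<Rightarrow> nat \<Rightarrow> 'b star_poly"
  where "inj_on \<theta> (cstar_generated D (insert u (range j)))"
proof -
  interpret D: unital_cstar_algebra D by fact
  interpret DM: Metric_space "carrier D" "cdist D" by (rule D.metric)
  define ev where "ev = star_poly_eval D j u"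
  have ev_D [simp]: "ev p \<in> carrier D" for p
    unfolding ev_def by (induction p) (use jD u D.vs.smult_closed in simp_all)
  define K where "K = {x \<in> carrier D. \<forall>e>0. \<exists>p. cdist D x (ev p) < e}"
  have evK: "ev p \<in> K" for p
    unfolding K_def using DM.mdist_zero[OF ev_D, of p] by (auto intro!: exI[of _ p])
  have K: "x \<in> carrier D" "e > 0 \<Longrightarrow> \<exists>p. cdist D x (ev p) < e" if "x \<in> K" for x e
    using that by (auto simp: K_def)
  have KI: "x \<in> K" if h: "x \<in> carrier D" "\<And>e. e > 0 \<Longrightarrow> \<exists>y\<in>K. cdist D x y < e" for x
    unfolding K_def
  proof (intro CollectI conjI allI impI)
    fix e :: real assume "e > 0"
    then obtain y where y: "y \<in> K" "cdist D x y < e/2" using h(2)[of "e/2"] by auto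
    then obtain p where p: "cdist D y (ev p) < e/2" using K(2)[of y "e/2"] \<open>e > 0\<close> by auto
    have "cdist D x (ev p) < e"
      using y p DM.triangle[of x y "ev p"] h(1) K(1) by force
    then show "\<exists>p. cdist D x (ev p) < e" by blast
  qed (fact h(1))
  have KI': "x \<in> K" if h: "x \<in> carrier D" "0 \<le> C" "\<And>e. e > 0 \<Longrightarrow> e \<le> 1 \<Longrightarrow> \<exists>p. cdist D x (ev p) \<le> C * e" for x C
  proof (rule KI[OF h(1)])
    fix e :: real assume "e > 0"
    define d where "d = min 1 (e / (2 * (C + 1)))"
    have d: "d > 0" "d \<le> 1" using \<open>e > 0\<close> h(2) by (auto simp: d_def)
    have "C * d \<le> C * (e / (2 * (C + 1)))" using h(2) by (intro mult_left_mono) (auto simp: d_def)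
    also have "\<dots> \<le> (C + 1) * (e / (2 * (C + 1)))"
      using h(2) \<open>e > 0\<close> by (intro mult_right_mono) auto
    also have "\<dots> = e / 2" using h(2) by (simp add: field_simps)
    also have "\<dots> < e" using \<open>e > 0\<close> by simp
    finally have "C * d < e" .
    then show "\<exists>y\<in>K. cdist D x y < e"
      using h(3)[OF d] evK by (meson le_less_trans)
  qed
  have Kadd: "x \<oplus>\<^bsub>D\<^esub> y \<in> K" if h: "x \<in> K" "y \<in> K" for x y
  proof (rule KI'[of _ 2])
    fix e :: real assume "e > 0"
    then obtain p r where p: "cdist D x (ev p) < e" "cdist D y (ev r) < e"
      using K(2) h by metis
    show "\<exists>p. cdist D (x \<oplus>\<^bsub>D\<^esub> y) (ev p) \<le> 2 * e"
      using D.cdist_le(1)[of x y "ev p" "ev r"] p h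
      by (intro exI[of _ "Plus p r"]) (simp add: ev_def K(1) ev_D[unfolded ev_def])
  qed (use h K(1) in simp_all)
  have Kmult: "x \<otimes>\<^bsub>D\<^esub> y \<in> K" if h: "x \<in> K" "y \<in> K" for x y
  proof (rule KI'[of _ "cnorm D x + (cnorm D y + 1)"])
    fix e :: real assume e: "e > 0" "e \<le> 1"
    then obtain p r where p: "cdist D x (ev p) < e" "cdist D y (ev r) < e"
      using K(2) h by metis
    have c: "x \<in> carrier D" "y \<in> carrier D" using h K(1) by auto
    have "cnorm D (ev r) \<le> cnorm D y + cdist D y (ev r)"
      using DM.triangle[of "ev r" y "\<zero>\<^bsub>D\<^esub>"] c DM.commute[of y "ev r"]
      by (simp add: cdist_def a_minus_def)
    then have r: "cnorm D (ev r) \<le> cnorm D y + 1" using p e by simp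
    have "cnorm D x * cdist D y (ev r) + cdist D x (ev p) * cnorm D (ev r)
        \<le> cnorm D x * e + e * (cnorm D y + 1)"
      using p r e c D.cnorm_nonneg by (intro add_mono mult_mono) auto
    then show "\<exists>p. cdist D (x \<otimes>\<^bsub>D\<^esub> y) (ev p) \<le> (cnorm D x + (cnorm D y + 1)) * e"
      using D.cdist_le(2)[of x y "ev p" "ev r"] c ev_D
      by (intro exI[of _ "Times p r"]) (simp add: ev_def algebra_simps)
  qed (use h K(1) D.cnorm_nonneg in simp_all)
  have Ksm: "c \<odot>\<^bsub>D\<^esub> x \<in> K" if h: "x \<in> K" for x c
  proof (rule KI'[of _ "cmod c"])
    fix e :: real assume "e > 0"
    then obtain p where p: "cdist D x (ev p) < e" using K(2) h by metis
    show "\<exists>p. cdist D (c \<odot>\<^bsub>D\<^esub> x) (ev p) \<le> cmod c * e"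
      using D.cdist_le(3)[of x x "ev p" "ev p" c] p h K(1) ev_D
      by (intro exI[of _ "Scale c p"]) (simp add: ev_def mult_left_mono)
  qed (use h K(1) D.vs.smult_closed in simp_all)
  have Kadj: "x\<^sup>\<star>\<^bsub>D\<^esub> \<in> K" if h: "x \<in> K" for x
  proof (rule KI'[of _ 1])
    fix e :: real assume "e > 0"
    then obtain p where p: "cdist D x (ev p) < e" using K(2) h by metis
    show "\<exists>p. cdist D (x\<^sup>\<star>\<^bsub>D\<^esub>) (ev p) \<le> 1 * e"
      using D.cdist_le(4)[of x x "ev p" "ev p"] p h K(1) ev_D
      by (intro exI[of _ "Adj p"]) (simp add: ev_def)
  qed (use h K(1) in simp_all)
  have Kzero: "\<zero>\<^bsub>D\<^esub> \<in> K"
    using Ksm[OF evK, of 0 Var] D.vs.smult_l_null[of "ev Var"] by simp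
  have Kneg: "\<ominus>\<^bsub>D\<^esub> x \<in> K" if "x \<in> K" for x
    using Ksm[OF that, of "-1"] D.smult_minus_one[of x] K(1)[OF that] by simp
  have subm: "submodule K complex_ring D"
  proof (rule D.vs.submoduleI)
    show "K \<subseteq> carrier D" by (auto simp: K_def)
  qed (use Kzero Kneg Kadd Ksm in auto)
  have "closedin (ctopology D) K"
    unfolding ctopology_def DM.metric_closedin_iff_sequentially_closed
  proof (intro conjI allI impI)
    fix \<sigma> l assume s: "range \<sigma> \<subseteq> K \<and> limitin DM.mtopology \<sigma> l sequentially"
    show "l \<in> K"
    proof (rule KI)
      show "l \<in> carrier D" using s DM.limitin_mspace by blast
      fix e :: real assume "e > 0"
      then obtain n where "cdist D (\<sigma> n) l < e"
        using s unfolding DM.limit_metric_sequentially by blast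
      then show "\<exists>y\<in>K. cdist D l y < e"
        using s DM.commute by (metis range_subsetD)
    qed
  qed (auto simp: K_def)
  with subm Kmult Kadj have "closed_star_subalgebra D K"
    by (simp add: closed_star_subalgebra_def)
  moreover have "insert u (range j) \<subseteq> K"
    using evK[of Var] evK[of "Coeff _"] by (auto simp: ev_def)
  ultimately have GK: "cstar_generated D (insert u (range j)) \<subseteq> K"
    by (rule D.cstar_generated_minimal[rotated])
  define \<theta> where "\<theta> = (\<lambda>x n. SOME p. cdist D x (ev p) < inverse (real (Suc n)))"
  have th: "cdist D x (ev (\<theta> x n)) < inverse (real (Suc n))" if "x \<in> K" for x n
    unfolding \<theta>_def by (rule someI_ex) (use K(2)[OF that] in simp)
  have "inj_on \<theta> K"
  proof (rule inj_onI)
    fix x y assume xy: "x \<in> K" "y \<in> K" "\<theta> x = \<theta> y"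
    have "cdist D x y \<le> 0"
    proof (rule field_le_epsilon)
      fix e :: real assume "e > 0"
      then obtain n where n: "inverse (real (Suc n)) < e/2" using reals_Archimedean[of "e/2"] by auto
      have "cdist D x y \<le> cdist D x (ev (\<theta> x n)) + cdist D y (ev (\<theta> x n))"
        using DM.triangle'[of x "ev (\<theta> x n)" y] K(1) xy by simp
      then show "cdist D x y \<le> 0 + e" using n th[OF xy(1), of n] th[OF xy(2), of n] xy(3) by simp
    qed
    then show "x = y" using DM.zero[of x y] DM.nonneg[of x y] K(1) xy by simp
  qed
  then show thesis using that GK inj_on_subset by blast
qed

text \<open>Every unital algebra receiving \<^term>\<open>B\<close> and a further element contains a unital
  *-subalgebra through which these factor and which is isomorphic to a competitor.\<close>

lemma competitor_exists:
  fixes D :: "'d cstar" and j :: "'b \<Rightarrow> 'd"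
  assumes D: "unital_cstar_algebra D" and j: "cstar_unital_hom B D j" and one: "\<one>\<^bsub>B\<^esub> \<in> carrier B"
    and u: "u \<in> carrier D"
  obtains D' :: "'b competitor" and j' u' f
  where "unital_cstar_algebra D'" "cstar_unital_hom D' D f" "inj_on f (carrier D')"
    "\<And>b. b \<in> carrier B \<Longrightarrow> j' b \<in> carrier D'" "\<And>b. b \<in> carrier B \<Longrightarrow> f (j' b) = j b"
    "u' \<in> carrier D'" "f u' = u"
proof -
  interpret D: unital_cstar_algebra D by fact
  define k where "k b = (if b \<in> carrier B then j b else j \<one>\<^bsub>B\<^esub>)" for b
  have kD: "k b \<in> carrier D" for b
    using j one by (auto simp: k_def cstar_unital_hom_def cstar_hom_def)
  let ?H = "cstar_generated D (insert u (range k))"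
  have gen: "insert u (range k) \<subseteq> ?H" by (auto simp: cstar_generated_def)
  have cH: "closed_star_subalgebra D ?H"
    using kD u by (intro D.closed_star_subalgebra_generated) auto
  obtain \<theta> :: "'d \<Rightarrow> nat \<Rightarrow> 'b star_poly" where \<theta>: "inj_on \<theta> ?H"
    by (rule cstar_generated_inj_star_poly[OF D kD u])
  define f where "f = inv_into ?H \<theta>"
  have inj: "inj_on f (\<theta> ` ?H)" by (simp add: f_def inj_on_inv_into)
  have f\<theta>: "f (\<theta> x) = x" if "x \<in> ?H" for x using that \<theta> by (simp add: f_def)
  have "(\<lambda>x. f (\<theta> x)) ` ?H = (\<lambda>x. x) ` ?H"
    by (rule image_cong[OF refl f\<theta>])
  then have fH: "f ` (\<theta> ` ?H) = ?H"
    unfolding image_image by simp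
  have oneH: "\<one>\<^bsub>D\<^esub> \<in> ?H"
    using gen j one by (auto simp: k_def cstar_unital_hom_def)
  let ?D' = "pullback D (\<theta> ` ?H) f"
  have car: "carrier ?D' = \<theta> ` ?H" by (simp add: pullback_def Let_def)
  show thesis
  proof (rule that[of ?D' f "\<lambda>b. \<theta> (j b)" "\<theta> u"])
    show "unital_cstar_algebra ?D'" "cstar_unital_hom ?D' D f"
      using pullback_cstar[OF D inj] cH oneH by (simp_all add: fH)
    have jH: "j b \<in> ?H" if "b \<in> carrier B" for b
      using gen that by (auto simp: k_def)
    show "b \<in> carrier B \<Longrightarrow> \<theta> (j b) \<in> carrier ?D'" "b \<in> carrier B \<Longrightarrow> f (\<theta> (j b)) = j b" for b
      using jH f\<theta> by (auto simp: car)
    show "\<theta> u \<in> carrier ?D'" "f (\<theta> u) = u" using gen f\<theta> by (auto simp: car)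
    show "inj_on f (carrier ?D')" using inj by (simp add: car)
  qed
qed

lemma cstar_unital_hom_comp:
  "cstar_unital_hom B C \<phi> \<Longrightarrow> cstar_unital_hom C D \<psi> \<Longrightarrow> cstar_unital_hom B D (\<lambda>x. \<psi> (\<phi> x))"
  by (auto simp: cstar_unital_hom_def cstar_hom_def Pi_iff)

lemma cstar_unital_hom_factor:
  assumes C: "unital_cstar_algebra C" and f: "cstar_unital_hom C D f" and inj: "inj_on f (carrier C)"
    and B: "unital_cstar_algebra B" and j: "cstar_unital_hom B D j"
    and j': "\<And>b. b \<in> carrier B \<Longrightarrow> j' b \<in> carrier C" "\<And>b. b \<in> carrier B \<Longrightarrow> f (j' b) = j b"
  shows "cstar_unital_hom B C j'"
proof -
  interpret C: unital_cstar_algebra C by fact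
  interpret B: unital_cstar_algebra B by fact
  have eq: "x = y" if "f x = f y" "x \<in> carrier C" "y \<in> carrier C" for x y
    using inj that by (simp add: inj_on_eq_iff)
  have sm: "c \<odot>\<^bsub>B\<^esub> x \<in> carrier B" if "x \<in> carrier B" for c x using B.vs.smult_closed that by simp
  have sm': "c \<odot>\<^bsub>C\<^esub> x \<in> carrier C" if "x \<in> carrier C" for c x using C.vs.smult_closed that by simp
  show ?thesis
    unfolding cstar_unital_hom_def cstar_hom_def
    using f j j' sm sm'
    by (intro conjI ballI allI) (auto intro!: eq simp: cstar_unital_hom_def cstar_hom_def)
qed

lemma toeplitz_algebra_universal:
  fixes D :: "'d cstar"
  assumes A: "unital_cstar_algebra A" and \<alpha>: "cstar_endomorphism A \<alpha>" and L: "L \<in> carrier A \<rightarrow> carrier A"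
    and T: "toeplitz_algebra A \<alpha> L T \<iota> S" and D: "toeplitz_rep A \<alpha> L D j s"
  shows "\<exists>\<phi>. cstar_unital_hom T D \<phi> \<and> (\<forall>a\<in>carrier A. \<phi> (\<iota> a) = j a) \<and> \<phi> S = s"
proof -
  interpret A: unital_cstar_algebra A by fact
  have D': "unital_cstar_algebra D" "cstar_unital_hom A D j" "s \<in> carrier D"
    using D by (auto simp: toeplitz_rep_def)
  obtain C :: "'a competitor" and j' s' f
    where C: "unital_cstar_algebra C" and f: "cstar_unital_hom C D f" "inj_on f (carrier C)"
      and j': "\<And>b. b \<in> carrier A \<Longrightarrow> j' b \<in> carrier C" "\<And>b. b \<in> carrier A \<Longrightarrow> f (j' b) = j b"
      and s': "s' \<in> carrier C" "f s' = s"
    using competitor_exists[OF D'(1,2) A.alg.one_closed D'(3)] by metis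
  interpret C: unital_cstar_algebra C by fact
  have eq: "x = y" if "f x = f y" "x \<in> carrier C" "y \<in> carrier C" for x y
    using f(2) that by (simp add: inj_on_eq_iff)
  have cl: "\<alpha> a \<in> carrier A" "L a \<in> carrier A" if "a \<in> carrier A" for a
    using that \<alpha> L by (auto simp: cstar_endomorphism_def cstar_hom_def)
  have "toeplitz_rep A \<alpha> L C j' s'"
    unfolding toeplitz_rep_def
  proof (intro conjI ballI)
    show "cstar_unital_hom A C j'"
      by (rule cstar_unital_hom_factor[OF C f A D'(2)]) (use j' in auto)
    fix a assume a: "a \<in> carrier A"
    show "s' \<otimes>\<^bsub>C\<^esub> j' a = j' (\<alpha> a) \<otimes>\<^bsub>C\<^esub> s'"
      using a f(1) D j' s' cl
      by (intro eq) (auto simp: cstar_unital_hom_def cstar_hom_def toeplitz_rep_def)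
    show "s'\<^sup>\<star>\<^bsub>C\<^esub> \<otimes>\<^bsub>C\<^esub> j' a \<otimes>\<^bsub>C\<^esub> s' = j' (L a)"
      using a f(1) D j' s' cl
      by (intro eq) (auto simp: cstar_unital_hom_def cstar_hom_def toeplitz_rep_def)
  qed (use C s' in auto)
  then obtain \<phi> where \<phi>: "cstar_unital_hom T C \<phi>" "\<forall>a\<in>carrier A. \<phi> (\<iota> a) = j' a" "\<phi> S = s'"
    using T unfolding toeplitz_algebra_def by blast
  then show ?thesis
    using cstar_unital_hom_comp[OF \<phi>(1) f(1)] \<phi>(2,3) j'(2) s'(2)
    by (intro exI[of _ "\<lambda>x. f (\<phi> x)"]) simp
qed

lemma crossed_product_universal:
  fixes D :: "'d cstar"
  assumes B: "unital_cstar_algebra B" and \<beta>: "cstar_endomorphism B \<beta>"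
    and F: "crossed_product B \<beta> L F i U" and D: "covariant_rep B \<beta> L D j u"
  shows "\<exists>\<phi>. cstar_unital_hom F D \<phi> \<and> (\<forall>b\<in>carrier B. \<phi> (i b) = j b) \<and> \<phi> U = u"
proof -
  interpret B: unital_cstar_algebra B by fact
  have D': "unital_cstar_algebra D" "cstar_unital_hom B D j" "u \<in> carrier D"
    using D by (auto simp: covariant_rep_def)
  obtain C :: "'a competitor" and j' u' f
    where C: "unital_cstar_algebra C" and f: "cstar_unital_hom C D f" "inj_on f (carrier C)"
      and j': "\<And>b. b \<in> carrier B \<Longrightarrow> j' b \<in> carrier C" "\<And>b. b \<in> carrier B \<Longrightarrow> f (j' b) = j b"
      and u': "u' \<in> carrier C" "f u' = u"
    using competitor_exists[OF D'(1,2) B.alg.one_closed D'(3)] by metis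
  interpret C: unital_cstar_algebra C by fact
  have eq: "x = y" if "f x = f y" "x \<in> carrier C" "y \<in> carrier C" for x y
    using f(2) that by (simp add: inj_on_eq_iff)
  have cl: "\<beta> a \<in> carrier B" "L a \<in> carrier B" if "a \<in> carrier B" for a
    using that \<beta> F
    by (auto simp: cstar_endomorphism_def cstar_hom_def crossed_product_def
        complete_transfer_operator_def transfer_operator_def)
  have "covariant_rep B \<beta> L C j' u'"
    unfolding covariant_rep_def
  proof (intro conjI ballI)
    show "cstar_unital_hom B C j'"
      by (rule cstar_unital_hom_factor[OF C f B D'(2)]) (use j' in auto)
    show "u' \<otimes>\<^bsub>C\<^esub> u'\<^sup>\<star>\<^bsub>C\<^esub> \<otimes>\<^bsub>C\<^esub> u' = u'"
      using f(1) D u' by (intro eq) (auto simp: cstar_unital_hom_def cstar_hom_def covariant_rep_def)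
    fix b assume b: "b \<in> carrier B"
    show "j' (\<beta> b) = u' \<otimes>\<^bsub>C\<^esub> j' b \<otimes>\<^bsub>C\<^esub> u'\<^sup>\<star>\<^bsub>C\<^esub>"
      using b f(1) D j' u' cl
      by (intro eq) (auto simp: cstar_unital_hom_def cstar_hom_def covariant_rep_def)
    show "j' (L b) = u'\<^sup>\<star>\<^bsub>C\<^esub> \<otimes>\<^bsub>C\<^esub> j' b \<otimes>\<^bsub>C\<^esub> u'"
      using b f(1) D j' u' cl
      by (intro eq) (auto simp: cstar_unital_hom_def cstar_hom_def covariant_rep_def)
  qed (use C u' in auto)
  then obtain \<phi> where \<phi>: "cstar_unital_hom F C \<phi>" "\<forall>b\<in>carrier B. \<phi> (i b) = j' b" "\<phi> U = u'"
    using F unfolding crossed_product_def by blast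
  then show ?thesis
    using cstar_unital_hom_comp[OF \<phi>(1) f(1)] \<phi>(2,3) j'(2) u'(2)
    by (intro exI[of _ "\<lambda>x. f (\<phi> x)"]) simp
qed

end

theory Submission
  imports Defs
begin

text \<open>
  Write \<open>d a\<close> for the image of \<open>a\<close> in Exel's crossed product \<open>E\<close>, \<open>s\<close> for the image of the
  Toeplitz generator and \<open>e\<^sub>k = s\<^sup>k s*\<^sup>k\<close>. The theorem rests on a normal form: since
  \<open>s*\<^sup>k d(a) s\<^sup>k = d(L\<^sup>k a)\<close> and \<open>s\<^sup>k d(a) = d(\<alpha>\<^sup>k a) s\<^sup>k\<close>, a product \<open>e\<^sub>k d(a) e\<^sub>l\<close> with
  \<open>k \<le> l\<close> equals \<open>d(\<alpha>\<^sup>k (L\<^sup>k a)) e\<^sub>l\<close>. So the monomials \<open>d(a) e\<^sub>k d(b)\<close> are closed under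
  products and adjoints, and the algebra \<open>core\<close> generated by \<open>d(A)\<close> and the \<open>e\<^sub>k\<close> is their closed
  span (\<open>core_eq_closed_span\<close>). Conjugation by \<open>s\<close> and by \<open>s*\<close> sends monomials to
  monomials, hence maps the core to itself.

  The hypothesis on \<open>L\<^sup>n(1)\<close> says that every \<open>s*\<^sup>n s\<^sup>n\<close> is a projection, that is, every power of
  \<open>s\<close> is a partial isometry. This forces \<open>s*s\<close> to commute with each \<open>e\<^sub>k\<close>; it commutes with
  \<open>d(A)\<close> anyway, because \<open>L(1)\<close> is central. So \<open>s*s\<close> is central in the core
  (\<open>init_proj_core\<close>), which makes \<open>x \<mapsto> s x s*\<close> multiplicative and
  gives the transfer identity for \<open>x \<mapsto> s* x s\<close>. Completeness of this transfer operator is immediate.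

  Positivity of \<open>x \<mapsto> s* x s\<close> is a statement about spectra in the core: a positive \<open>x\<close> with \<open>\<parallel>x\<parallel> \<le> t\<close> satisfies \<open>\<parallel>t - x\<parallel> \<le> t\<close>, therefore
  \<open>\<parallel>t s*s - s* x s\<parallel> \<le> t\<close>, and this estimate in the corner of \<open>s*s\<close> confines the spectrum of
  \<open>s* x s\<close> to the nonnegative reals (\<open>positive_element_cornerI\<close>). The first step, and the
  continuity of *-homomorphisms used below, need that the norm of a self-adjoint element is attained
  on its spectrum (\<open>norm_one_selfadjoint_not_Units\<close>); this is derived from the behaviour
  of the resolvent on a circle under squaring.

  For the isomorphism, the inclusion of the core together with \<open>s\<close> is a covariant representation on
  \<open>E\<close>, so \<open>\<gamma>\<close> exists by universality of the crossed product \<open>F\<close>. Conversely \<open>a \<mapsto> j(d a)\<close> and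
  \<open>U\<close> form a Toeplitz representation on \<open>F\<close> (\<open>covariant_toeplitz_rep\<close>). The induced map
  \<open>\<phi>\<close> satisfies \<open>\<phi> k = j (q k)\<close> on the closed span of \<open>A S S* A\<close>; for a redundancy \<open>(a, k)\<close> the
  images of \<open>a\<close> and \<open>k\<close> in \<open>E\<close> coincide, so \<open>\<phi>\<close> kills \<open>a - k\<close> and descends to a map
  \<open>\<psi> : E \<rightarrow> F\<close> (\<open>covariant_rep_factors\<close>). Comparing both compositions with the identity on
  generators shows that \<open>\<psi>\<close> inverts \<open>\<gamma>\<close>.
\<close>

section \<open>Norms and invertible elements\<close>

context unital_cstar_algebra
begin

lemma smult_in_carrier [simp]: "x \<in> carrier B \<Longrightarrow> c \<odot> x \<in> carrier B"
  using vs.smult_closed by simp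

lemma smult_simps:
  "\<lbrakk>x \<in> carrier B; y \<in> carrier B\<rbrakk> \<Longrightarrow> c \<odot> (x \<oplus> y) = c \<odot> x \<oplus> c \<odot> y"
  "x \<in> carrier B \<Longrightarrow> (c + d) \<odot> x = c \<odot> x \<oplus> d \<odot> x"
  "x \<in> carrier B \<Longrightarrow> c \<odot> (d \<odot> x) = (c * d) \<odot> x"
  "x \<in> carrier B \<Longrightarrow> 1 \<odot> x = x"
  "x \<in> carrier B \<Longrightarrow> 0 \<odot> x = \<zero>"
  "x \<in> carrier B \<Longrightarrow> c \<odot> (\<ominus> x) = \<ominus> (c \<odot> x)"
  "x \<in> carrier B \<Longrightarrow> (- c) \<odot> x = \<ominus> (c \<odot> x)"
  using vs.smult_r_distr[of c x y] vs.smult_l_distr[of c d x] vs.smult_assoc1[of c d x]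
    vs.smult_one[of x] vs.smult_l_null[of x] vs.smult_r_minus[of c x]
    smult_minus_one[of "c \<odot> x"] vs.smult_assoc1[of "-1" c x]
  by simp_all

text \<open>Sorting a sum can place other summands between \<open>x\<close> and \<open>-x\<close>; these rules cancel across up to
  two of them, which suffices for the ring identities below.\<close>

lemma add_cancel:
  assumes "x \<in> carrier B" "y \<in> carrier B" "z \<in> carrier B" "w \<in> carrier B"
  shows "x \<oplus> (y \<oplus> \<ominus> x) = y" "\<ominus> x \<oplus> (y \<oplus> x) = y"
    "x \<oplus> (y \<oplus> (\<ominus> x \<oplus> z)) = y \<oplus> z" "\<ominus> x \<oplus> (y \<oplus> (x \<oplus> z)) = y \<oplus> z"
    "x \<oplus> (y \<oplus> (z \<oplus> \<ominus> x)) = y \<oplus> z" "\<ominus> x \<oplus> (y \<oplus> (z \<oplus> x)) = y \<oplus> z"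
    "x \<oplus> (y \<oplus> (z \<oplus> (\<ominus> x \<oplus> w))) = y \<oplus> (z \<oplus> w)"
    "\<ominus> x \<oplus> (y \<oplus> (z \<oplus> (x \<oplus> w))) = y \<oplus> (z \<oplus> w)"
proof -
  have c: "u \<oplus> (v \<oplus> \<ominus> u) = v" "\<ominus> u \<oplus> (v \<oplus> u) = v"
    if "u \<in> carrier B" "v \<in> carrier B" for u v
    using that alg.a_lcomm[of u v "\<ominus> u"] alg.a_lcomm[of "\<ominus> u" v u]
    by (simp_all add: alg.r_neg alg.l_neg)
  show "x \<oplus> (y \<oplus> \<ominus> x) = y" "\<ominus> x \<oplus> (y \<oplus> x) = y"
    "x \<oplus> (y \<oplus> (\<ominus> x \<oplus> z)) = y \<oplus> z" "\<ominus> x \<oplus> (y \<oplus> (x \<oplus> z)) = y \<oplus> z"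
    "x \<oplus> (y \<oplus> (z \<oplus> \<ominus> x)) = y \<oplus> z" "\<ominus> x \<oplus> (y \<oplus> (z \<oplus> x)) = y \<oplus> z"
    "x \<oplus> (y \<oplus> (z \<oplus> (\<ominus> x \<oplus> w))) = y \<oplus> (z \<oplus> w)"
    "\<ominus> x \<oplus> (y \<oplus> (z \<oplus> (x \<oplus> w))) = y \<oplus> (z \<oplus> w)"
    using assms c[of x "y \<oplus> z"] c[of x y] c[of x "y \<oplus> (z \<oplus> w)"]
    by (simp_all add: alg.a_assoc[symmetric])
qed

lemmas cstar_simps = alg.ring_simprules alg.r_one smult_mult_left smult_mult_right
  smult_simps(1,3-7) add_cancel

lemma cdist_eq: "\<lbrakk>x \<in> carrier B; y \<in> carrier B\<rbrakk> \<Longrightarrow> cdist B x y = cnorm B (x \<ominus> y)"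
  by (simp add: cdist_def)

lemma cnorm_zero [simp]: "cnorm B \<zero> = 0"
  using cnorm_eq_0[of \<zero>] by simp

lemma adj_minus: "x \<in> carrier B \<Longrightarrow> (\<ominus> x)\<^sup>\<star> = \<ominus> (x\<^sup>\<star>)"
  using adj_smult[of x "-1"] by (simp add: smult_minus_one)

lemma adj_diff: "\<lbrakk>x \<in> carrier B; y \<in> carrier B\<rbrakk> \<Longrightarrow> (x \<ominus> y)\<^sup>\<star> = x\<^sup>\<star> \<ominus> y\<^sup>\<star>"
  by (simp add: alg.minus_eq adj_add adj_minus)

lemma diff_eq_zero_iff: "\<lbrakk>x \<in> carrier B; y \<in> carrier B\<rbrakk> \<Longrightarrow> x \<ominus> y = \<zero> \<longleftrightarrow> x = y"
  using alg.minus_equality[of x "\<ominus> y"] by (auto simp: alg.minus_eq alg.r_neg)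

lemma cnorm_diff: "\<lbrakk>x \<in> carrier B; y \<in> carrier B\<rbrakk> \<Longrightarrow> cnorm B (x \<ominus> y) \<le> cnorm B x + cnorm B y"
  using cnorm_add[of x "\<ominus> y"] by (simp add: alg.minus_eq cnorm_minus)

lemma cnorm_diff_commute: "\<lbrakk>x \<in> carrier B; y \<in> carrier B\<rbrakk> \<Longrightarrow> cnorm B (x \<ominus> y) = cnorm B (y \<ominus> x)"
  using cnorm_minus[of "x \<ominus> y"] by (simp add: cstar_simps)

lemma cnorm_triangle:
  "\<lbrakk>x \<in> carrier B; y \<in> carrier B; z \<in> carrier B\<rbrakk>
    \<Longrightarrow> cnorm B (x \<ominus> z) \<le> cnorm B (x \<ominus> y) + cnorm B (y \<ominus> z)"
  using cnorm_add[of "x \<ominus> y" "y \<ominus> z"] by (simp add: cstar_simps)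

lemma cnorm_mult_le:
  "\<lbrakk>x \<in> carrier B; y \<in> carrier B; cnorm B x \<le> a; cnorm B y \<le> b\<rbrakk> \<Longrightarrow> cnorm B (x \<otimes> y) \<le> a * b"
  using cnorm_mult[of x y] mult_mono[of "cnorm B x" a "cnorm B y" b] cnorm_nonneg[of x] cnorm_nonneg[of y]
  by linarith

lemma cnorm_selfadjoint_square:
  "x \<in> carrier B \<Longrightarrow> x\<^sup>\<star> = x \<Longrightarrow> cnorm B (x \<otimes> x) = (cnorm B x)\<^sup>2"
  using cnorm_cstar[of x] by simp

lemma cnorm_projection_le:
  assumes "e \<in> carrier B" "e\<^sup>\<star> = e" "e \<otimes> e = e"
  shows "cnorm B e \<le> 1"
proof -
  have "cnorm B e = cnorm B e * cnorm B e"
    using cnorm_selfadjoint_square[of e] assms by (simp add: power2_eq_square)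
  then show ?thesis by auto
qed

lemma cnorm_one_le: "cnorm B \<one> \<le> 1"
  by (rule cnorm_projection_le) (simp_all add: adj_one)

text \<open>The two one-sided inverses are the fixed points of the contractions \<open>y \<mapsto> 1 + x y\<close> and
  \<open>y \<mapsto> 1 + y x\<close>; they agree because a left and a right inverse always do.\<close>

lemma neumann:
  assumes x: "x \<in> carrier B" "cnorm B x < 1"
  shows "\<one> \<ominus> x \<in> Units B"
proof -
  have r: "\<exists>y\<in>carrier B. y = \<one> \<oplus> x \<otimes> y"
  proof (rule Metric_space.Banach_fixedpoint_thm[OF metric complete])
    show "carrier B \<noteq> {}" using alg.one_closed by blast
    show "(\<lambda>y. \<one> \<oplus> x \<otimes> y) \<in> carrier B \<rightarrow> carrier B" using x by auto
    show "cnorm B x < 1" by (rule x)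
    fix y z assume yz: "y \<in> carrier B" "z \<in> carrier B"
    have "(\<one> \<oplus> x \<otimes> y) \<ominus> (\<one> \<oplus> x \<otimes> z) = x \<otimes> (y \<ominus> z)"
      using x yz by (simp add: cstar_simps)
    then show "cdist B (\<one> \<oplus> x \<otimes> y) (\<one> \<oplus> x \<otimes> z) \<le> cnorm B x * cdist B y z"
      using x yz cnorm_mult[of x "y \<ominus> z"] by (simp add: cdist_eq)
  qed metis
  have l: "\<exists>y\<in>carrier B. y = \<one> \<oplus> y \<otimes> x"
  proof (rule Metric_space.Banach_fixedpoint_thm[OF metric complete])
    show "carrier B \<noteq> {}" using alg.one_closed by blast
    show "(\<lambda>y. \<one> \<oplus> y \<otimes> x) \<in> carrier B \<rightarrow> carrier B" using x by auto
    show "cnorm B x < 1" by (rule x)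
    fix y z assume yz: "y \<in> carrier B" "z \<in> carrier B"
    have "(\<one> \<oplus> y \<otimes> x) \<ominus> (\<one> \<oplus> z \<otimes> x) = (y \<ominus> z) \<otimes> x"
      using x yz by (simp add: cstar_simps)
    then show "cdist B (\<one> \<oplus> y \<otimes> x) (\<one> \<oplus> z \<otimes> x) \<le> cnorm B x * cdist B y z"
      using x yz cnorm_mult[of "y \<ominus> z" x] by (simp add: cdist_eq mult.commute)
  qed metis
  obtain y where y: "y \<in> carrier B" "y = \<one> \<oplus> x \<otimes> y" using r by blast
  obtain z where z: "z \<in> carrier B" "z = \<one> \<oplus> z \<otimes> x" using l by blast
  have y1: "(\<one> \<ominus> x) \<otimes> y = \<one>"
  proof -
    have "(\<one> \<ominus> x) \<otimes> y = y \<ominus> x \<otimes> y" using x y(1) by (simp add: cstar_simps)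
    also have "\<dots> = (\<one> \<oplus> x \<otimes> y) \<ominus> x \<otimes> y" using y(2) by simp
    also have "\<dots> = \<one>" using x y(1) by (simp add: cstar_simps)
    finally show ?thesis .
  qed
  have z1: "z \<otimes> (\<one> \<ominus> x) = \<one>"
  proof -
    have "z \<otimes> (\<one> \<ominus> x) = z \<ominus> z \<otimes> x" using x z(1) by (simp add: cstar_simps)
    also have "\<dots> = (\<one> \<oplus> z \<otimes> x) \<ominus> z \<otimes> x" using z(2) by simp
    also have "\<dots> = \<one>" using x z(1) by (simp add: cstar_simps)
    finally show ?thesis .
  qed
  have "z = y" using alg.inv_unique[OF z1 y1] x y(1) z(1) by simp
  then show ?thesis using y1 z1 x y(1) by (auto simp: Units_def)
qed

lemma smult_Units:
  assumes "u \<in> Units B" "c \<noteq> 0"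
  shows "c \<odot> u \<in> Units B"
  unfolding Units_def
proof (intro CollectI conjI bexI)
  have u: "u \<in> carrier B" "inv u \<in> carrier B" using assms by auto
  show "c \<odot> u \<in> carrier B" "inverse c \<odot> inv u \<in> carrier B" using u by auto
  show "inverse c \<odot> inv u \<otimes> (c \<odot> u) = \<one>" "c \<odot> u \<otimes> (inverse c \<odot> inv u) = \<one>"
    using assms u by (simp_all add: cstar_simps)
qed

lemma resolvent_identity:
  assumes "u \<in> Units B" "v \<in> Units B"
  shows "inv u \<ominus> inv v = inv u \<otimes> (v \<ominus> u) \<otimes> inv v"
proof -
  have c: "u \<in> carrier B" "v \<in> carrier B" "inv u \<in> carrier B" "inv v \<in> carrier B"
    using assms by auto
  have "inv u \<otimes> (v \<ominus> u) \<otimes> inv v = inv u \<otimes> (v \<otimes> inv v) \<ominus> (inv u \<otimes> u) \<otimes> inv v"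
    using c by (simp add: cstar_simps del: alg.Units_l_inv alg.Units_r_inv)
  then show ?thesis using assms c by simp
qed

text \<open>Invertibility of \<open>v\<close> follows from \<open>v = u (1 - u\<^sup>-\<^sup>1 (u - v))\<close>; the explicit bound on the
  inverse is what makes local estimates of the resolvent uniform on the circle.\<close>

lemma Units_perturbation:
  assumes u: "u \<in> Units B" and v: "v \<in> carrier B"
    and small: "cnorm B (inv u) * cnorm B (u \<ominus> v) \<le> 1/2"
  shows "v \<in> Units B" and "cnorm B (inv v) \<le> 2 * cnorm B (inv u)"
proof -
  have c: "u \<in> carrier B" "inv u \<in> carrier B" using u by auto
  define w where "w = inv u \<otimes> (u \<ominus> v)"
  have w: "w \<in> carrier B" "cnorm B w < 1"
    using c v small cnorm_mult[of "inv u" "u \<ominus> v"] by (auto simp: w_def)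
  have "u \<otimes> (\<one> \<ominus> w) = u \<ominus> (u \<otimes> inv u) \<otimes> (u \<ominus> v)"
    using c v by (simp add: w_def cstar_simps del: alg.Units_l_inv alg.Units_r_inv)
  also have "\<dots> = v" using c v u by (simp add: cstar_simps)
  finally show V: "v \<in> Units B"
    using alg.Units_m_closed[OF u neumann[OF w]] by simp
  have iv: "inv v \<in> carrier B" using V by auto
  have eq: "inv u \<ominus> inv v = inv u \<otimes> (v \<ominus> u) \<otimes> inv v"
    by (rule resolvent_identity[OF u V])
  have "cnorm B (inv u \<otimes> (v \<ominus> u) \<otimes> inv v) \<le> 1/2 * cnorm B (inv v)"
  proof (rule cnorm_mult_le)
    show "cnorm B (inv u \<otimes> (v \<ominus> u)) \<le> 1/2"
      using small cnorm_mult[of "inv u" "v \<ominus> u"] c v cnorm_diff_commute[of u v] by simp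
  qed (use c v iv in auto)
  moreover have "cnorm B (inv v) \<le> cnorm B (inv v \<ominus> inv u) + cnorm B (inv u)"
    using cnorm_triangle[of "inv v" "inv u" \<zero>] c iv by (simp add: alg.minus_eq)
  ultimately show "cnorm B (inv v) \<le> 2 * cnorm B (inv u)"
    using eq cnorm_diff_commute[of "inv v" "inv u"] c iv by simp
qed

end

section \<open>Real spectra and resolvents on the circle\<close>

context unital_cstar_algebra
begin

text \<open>Since \<open>w\<close> lives in the corner of \<open>e\<close>, where \<open>l - c e\<close> acts as the scalar \<open>l - c\<close>, the element
  factors as \<open>(l - c e) (1 + w / (l - c))\<close>: the first factor has the inverse
  \<open>l\<^sup>-\<^sup>1 (1 - e) + (l - c)\<^sup>-\<^sup>1 e\<close>, and the second is a Neumann perturbation of the unit.\<close>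

lemma corner_resolvent:
  assumes e: "e \<in> carrier B" "e \<otimes> e = e" and w: "w \<in> carrier B" "e \<otimes> w = w"
    and l: "l \<noteq> 0" and small: "cnorm B w < cmod (l - c)"
  shows "l \<odot> \<one> \<ominus> (c \<odot> e \<ominus> w) \<in> Units B"
proof -
  have lc: "l - c \<noteq> 0" using small cnorm_nonneg[OF w(1)] by auto
  \<comment> \<open>\<open>d'\<close> is \<open>l\<^sup>-\<^sup>1 (1 - e) + (l - c)\<^sup>-\<^sup>1 e\<close>, with the multiples of \<open>e\<close> collected in \<open>k\<close>\<close>
  define k where "k = inverse (l - c) - inverse l"
  define d where "d = l \<odot> \<one> \<ominus> c \<odot> e"
  define d' where "d' = inverse l \<odot> \<one> \<oplus> k \<odot> e"
  have z: "l * k + (- c * inverse l + - c * k) = 0"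
    using l lc by (simp add: k_def field_simps)
  have zz: "(l * k) \<odot> e \<oplus> ((- c * inverse l) \<odot> e \<oplus> (- c * k) \<odot> e) = \<zero>"
    using e z by (simp flip: smult_simps(2) add: smult_simps(5))
  have d: "d \<in> carrier B" "d' \<in> carrier B" using e by (simp_all add: d_def d'_def)
  have "d \<otimes> d' = \<one> \<oplus> ((l * k) \<odot> e \<oplus> ((- c * inverse l) \<odot> e \<oplus> (- c * k) \<odot> e))"
    using e l by (simp add: d_def d'_def cstar_simps mult.commute)
  then have dd: "d \<otimes> d' = \<one>" using e unfolding zz by simp
  have "d' \<otimes> d = \<one> \<oplus> ((l * k) \<odot> e \<oplus> ((- c * inverse l) \<odot> e \<oplus> (- c * k) \<odot> e))"
    using e l by (simp add: d_def d'_def cstar_simps mult.commute)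
  then have dd': "d' \<otimes> d = \<one>" using e unfolding zz by simp
  have dU: "d \<in> Units B" using d dd dd' by (auto simp: Units_def)
  define v where "v = (- inverse (l - c)) \<odot> w"
  have v: "v \<in> carrier B" using w by (simp add: v_def)
  have "cnorm B v < 1"
    using w small lc by (simp add: v_def cnorm_smult norm_inverse norm_divide field_simps)
  then have vU: "\<one> \<ominus> v \<in> Units B" by (rule neumann[OF v])
  have "d \<otimes> (\<one> \<ominus> v) = d \<oplus> (inverse (l - c) * l \<odot> w \<ominus> inverse (l - c) * c \<odot> (e \<otimes> w))"
    using e w(1) by (simp add: d_def v_def cstar_simps)
  also have "inverse (l - c) * l \<odot> w \<ominus> inverse (l - c) * c \<odot> (e \<otimes> w)
      = (inverse (l - c) * l - inverse (l - c) * c) \<odot> w"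
    using w(1) smult_simps(2)[OF w(1), of "inverse (l - c) * l" "- (inverse (l - c) * c)"]
    unfolding w(2) by (simp add: smult_simps alg.minus_eq)
  also have "inverse (l - c) * l - inverse (l - c) * c = 1"
    using lc by (simp flip: right_diff_distrib)
  finally have "d \<otimes> (\<one> \<ominus> v) = l \<odot> \<one> \<ominus> (c \<odot> e \<ominus> w)"
    using e w(1) by (simp add: d_def cstar_simps)
  then show ?thesis using alg.Units_m_closed[OF dU vU] by simp
qed

text \<open>The C*-identity turns a shift by the imaginary multiple \<open>i s e\<close> into \<open>g\<^sup>2 + s\<^sup>2 e\<close>, so the square of
  the norm grows only by \<open>s\<^sup>2\<close>. Large imaginary shifts thus separate nonreal points from the spectrum.\<close>

lemma cnorm_corner_shift:
  assumes e: "e \<in> carrier B" "e\<^sup>\<star> = e" "e \<otimes> e = e"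
    and g: "g \<in> carrier B" "g\<^sup>\<star> = g" "e \<otimes> g = g"
  shows "(cnorm B (g \<oplus> (\<i> * of_real s) \<odot> e))\<^sup>2 \<le> (cnorm B g)\<^sup>2 + s\<^sup>2"
proof -
  let ?c = "\<i> * complex_of_real s"
  have ge: "g \<otimes> e = g" using adj_mult[of e g] e g by simp
  have "(g \<oplus> ?c \<odot> e)\<^sup>\<star> = g \<ominus> ?c \<odot> e"
    using e g by (simp add: adj_add adj_smult smult_simps alg.minus_eq)
  moreover have "?c * ?c = - (of_real s * of_real s)" by (simp add: algebra_simps)
  ultimately have "(g \<oplus> ?c \<odot> e)\<^sup>\<star> \<otimes> (g \<oplus> ?c \<odot> e) = g \<otimes> g \<oplus> (of_real (s\<^sup>2) \<odot> e)"
    using e g(1,3) ge by (simp add: cstar_simps power2_eq_square)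
  then have "(cnorm B (g \<oplus> ?c \<odot> e))\<^sup>2 = cnorm B (g \<otimes> g \<oplus> (of_real (s\<^sup>2) \<odot> e))"
    using cnorm_cstar[of "g \<oplus> ?c \<odot> e"] e g by simp
  also have "\<dots> \<le> cnorm B (g \<otimes> g) + s\<^sup>2 * cnorm B e"
    using cnorm_add[of "g \<otimes> g" "of_real (s\<^sup>2) \<odot> e"] e g by (simp add: cnorm_smult norm_power)
  also have "\<dots> \<le> (cnorm B g)\<^sup>2 + s\<^sup>2 * 1"
    using cnorm_projection_le[OF e] cnorm_selfadjoint_square[OF g(1,2)]
    by (intro add_mono mult_left_mono) auto
  finally show ?thesis by simp
qed

text \<open>Arens' argument in a corner: compare \<open>y\<close> with the centres \<open>t + i s\<close> for all real \<open>s\<close>. The squared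
  distance from \<open>z\<close> to the centre must not exceed \<open>r\<^sup>2 + s\<^sup>2\<close>; it is linear in \<open>s\<close> after cancelling \<open>s\<^sup>2\<close>,
  with slope a multiple of \<open>Im z\<close>.\<close>

lemma spectrum_corner_subset:
  assumes e: "e \<in> carrier B" "e\<^sup>\<star> = e" "e \<otimes> e = e"
    and y: "y \<in> carrier B" "y\<^sup>\<star> = y" "e \<otimes> y = y"
    and r: "cnorm B (of_real t \<odot> e \<ominus> y) \<le> r"
    and z: "z \<in> spectrum B y" "z \<noteq> 0"
  shows "Im z = 0 \<and> \<bar>Re z - t\<bar> \<le> r"
proof -
  define g where "g = of_real t \<odot> e \<ominus> y"
  have g: "g \<in> carrier B" "g\<^sup>\<star> = g" "e \<otimes> g = g"
    using e y by (simp_all add: g_def adj_diff adj_smult) (simp add: cstar_simps)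
  have y_eq: "(of_real t + \<i> * of_real s) \<odot> e \<ominus> (g \<oplus> (\<i> * of_real s) \<odot> e) = y" for s :: real
    using e y by (simp add: g_def cstar_simps smult_simps(2))
  have main: "(Re z - t)\<^sup>2 + (Im z)\<^sup>2 - 2 * s * Im z \<le> r\<^sup>2" for s
  proof (rule ccontr)
    let ?w = "g \<oplus> (\<i> * of_real s) \<odot> e" and ?c = "of_real t + \<i> * of_real s"
    assume "\<not> ?thesis"
    then have *: "r\<^sup>2 + s\<^sup>2 < (Re z - t)\<^sup>2 + (Im z - s)\<^sup>2"
      by (simp add: power2_eq_square algebra_simps)
    have "(cnorm B ?w)\<^sup>2 \<le> (cnorm B g)\<^sup>2 + s\<^sup>2" by (rule cnorm_corner_shift[OF e g])
    also have "(cnorm B g)\<^sup>2 \<le> r\<^sup>2"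
      using r cnorm_nonneg[OF g(1)] by (intro power_mono) (auto simp: g_def)
    also note *
    also have "(Re z - t)\<^sup>2 + (Im z - s)\<^sup>2 = (cmod (z - ?c))\<^sup>2" by (simp add: cmod_power2)
    finally have "cnorm B ?w < cmod (z - ?c)"
      by (rule power2_less_imp_less) simp_all
    then have "z \<odot> \<one> \<ominus> (?c \<odot> e \<ominus> ?w) \<in> Units B"
      using e g z(2) by (intro corner_resolvent) (simp_all add: cstar_simps)
    then show False using z(1) by (simp add: y_eq spectrum_def)
  qed
  have "Im z = 0"
  proof (rule ccontr)
    assume "Im z \<noteq> 0"
    \<comment> \<open>the value of \<open>s\<close> at which the linear term exceeds \<open>r\<^sup>2\<close>\<close>
    then have "2 * (- (r\<^sup>2 + 1) / (2 * Im z)) * Im z = - (r\<^sup>2 + 1)" by simp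
    then show False
      using main[of "- (r\<^sup>2 + 1) / (2 * Im z)"] zero_le_power2[of "Re z - t"] zero_le_power2[of "Im z"]
      by linarith
  qed
  then have "(Re z - t)\<^sup>2 \<le> r\<^sup>2" using main[of 0] by simp
  moreover have "r \<ge> 0" using r cnorm_nonneg[OF g(1)] by (simp add: g_def)
  ultimately show ?thesis using \<open>Im z = 0\<close> by (simp add: abs_le_square_iff[symmetric])
qed

lemma nonreal_Units:
  assumes h: "h \<in> carrier B" "h\<^sup>\<star> = h" and z: "Im z \<noteq> 0"
  shows "z \<odot> \<one> \<ominus> h \<in> Units B"
proof (rule ccontr)
  assume "\<not> ?thesis"
  then have "z \<in> spectrum B h" by (simp add: spectrum_def)
  moreover have "cnorm B (of_real 0 \<odot> \<one> \<ominus> h) \<le> cnorm B h"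
    using h by (simp add: smult_simps alg.minus_eq cnorm_minus)
  moreover have "z \<noteq> 0" using z by auto
  ultimately show False
    using spectrum_corner_subset[of \<one> h 0 "cnorm B h" z] h z by (auto simp: adj_one)
qed

text \<open>The points of the circle other than 1 and -1 are nonreal, and the spectrum of a self-adjoint
  element is real.\<close>

lemma unit_circle_Units:
  assumes h: "h \<in> carrier B" "h\<^sup>\<star> = h" and pm: "\<one> \<ominus> h \<in> Units B" "\<one> \<oplus> h \<in> Units B"
    and l: "cmod l = 1"
  shows "\<one> \<ominus> l \<odot> h \<in> Units B"
proof (cases "Im l = 0")
  case True
  then have "l = 1 \<or> l = -1" using l by (auto simp: complex_eq_iff cmod_def)
  then show ?thesis using pm h by (auto simp: cstar_simps)
next
  case False
  have "Im (inverse l) \<noteq> 0" "l \<noteq> 0" using False l by (auto simp: Im_complex_div_eq_0 field_simps)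
  then have "l \<odot> (inverse l \<odot> \<one> \<ominus> h) \<in> Units B"
    by (intro smult_Units nonreal_Units h)
  then show ?thesis using h \<open>l \<noteq> 0\<close> by (simp add: cstar_simps)
qed

text \<open>The norm of the resolvent at most doubles on a disc around each point of the circle; finitely
  many discs suffice.\<close>

lemma circle_inverse_bounded:
  assumes h: "h \<in> carrier B" and U: "\<And>l. cmod l = 1 \<Longrightarrow> \<one> \<ominus> l \<odot> h \<in> Units B"
  obtains K where "K > 0" "\<And>l. cmod l = 1 \<Longrightarrow> cnorm B (inv (\<one> \<ominus> l \<odot> h)) \<le> K"
proof -
  define N where "N l = cnorm B (inv (\<one> \<ominus> l \<odot> h))" for l
  define d where "d l = 1 / (2 * (N l + 1) * (cnorm B h + 1))" for l
  have N: "N l \<ge> 0" if "cmod l = 1" for l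
    unfolding N_def by (intro cnorm_nonneg) (use U[OF that] in auto)
  have dp: "d l > 0" if "cmod l = 1" for l
    using N[OF that] cnorm_nonneg[OF h] by (simp add: d_def add_nonneg_pos)
  have near: "N m \<le> 2 * N l" if l: "cmod l = 1" and m: "m \<in> ball l (d l)" for l m
    unfolding N_def
  proof (rule Units_perturbation(2)[OF U[OF l]])
    have "(\<one> \<ominus> l \<odot> h) \<ominus> (\<one> \<ominus> m \<odot> h) = (m - l) \<odot> h"
      using h smult_simps(2)[OF h, of m "-l"] by (simp add: cstar_simps)
    then have "cnorm B ((\<one> \<ominus> l \<odot> h) \<ominus> (\<one> \<ominus> m \<odot> h)) = cmod (l - m) * cnorm B h"
      using h by (simp add: cnorm_smult norm_minus_commute)
    also have "\<dots> \<le> d l * (cnorm B h + 1)"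
      using m cnorm_nonneg[OF h] dp[OF l] by (intro mult_mono) (auto simp: dist_norm)
    also have "\<dots> = 1 / (2 * (N l + 1))"
      using cnorm_nonneg[OF h] N[OF l] by (simp add: d_def)
    finally have "N l * cnorm B ((\<one> \<ominus> l \<odot> h) \<ominus> (\<one> \<ominus> m \<odot> h)) \<le> N l * (1 / (2 * (N l + 1)))"
      using N[OF l] by (intro mult_left_mono)
    also have "\<dots> \<le> 1/2" using N[OF l] by (simp add: field_simps)
    finally show "cnorm B (inv (\<one> \<ominus> l \<odot> h)) * cnorm B ((\<one> \<ominus> l \<odot> h) \<ominus> (\<one> \<ominus> m \<odot> h)) \<le> 1/2"
      by (simp add: N_def)
  qed (use h in simp)
  have "compact (sphere (0::complex) 1)" by simp
  moreover have "sphere (0::complex) 1 \<subseteq> (\<Union>l\<in>sphere 0 1. ball l (d l))"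
    using dp by force
  ultimately obtain C where C: "C \<subseteq> sphere 0 1" "finite C" "sphere 0 1 \<subseteq> (\<Union>l\<in>C. ball l (d l))"
    using compactE_image[of "sphere (0::complex) 1" "sphere 0 1" "\<lambda>l. ball l (d l)"] by blast
  define K where "K = 1 + (\<Sum>l\<in>C. 2 * N l)"
  have s: "2 * N l \<le> (\<Sum>l\<in>C. 2 * N l)" if "l \<in> C" for l
    using that C N by (intro member_le_sum) auto
  have "K > 0" unfolding K_def using C N by (intro add_pos_nonneg sum_nonneg) auto
  moreover have "N m \<le> K" if m: "cmod m = 1" for m
  proof -
    obtain l where l: "l \<in> C" "m \<in> ball l (d l)" using C m by auto
    then show ?thesis using near[of l m] s[of l] C by (auto simp: K_def)
  qed
  ultimately show thesis using that by (simp add: N_def)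
qed

text \<open>The partial fraction \<open>1/(1 - z\<^sup>2) = (1/(1 - z) + 1/(1 + z))/2\<close>. It transports resolvent
  estimates from \<open>z\<close> to \<open>z\<^sup>2\<close> without loss.\<close>

lemma inverse_average:
  assumes z: "z \<in> carrier B" and u: "\<one> \<ominus> z \<in> Units B" "\<one> \<oplus> z \<in> Units B"
  shows "\<one> \<ominus> z \<otimes> z \<in> Units B"
    and "inv (\<one> \<ominus> z \<otimes> z) = (1/2) \<odot> (inv (\<one> \<ominus> z) \<oplus> inv (\<one> \<oplus> z))"
proof -
  have f: "(\<one> \<ominus> z) \<otimes> (\<one> \<oplus> z) = \<one> \<ominus> z \<otimes> z" "(\<one> \<oplus> z) \<otimes> (\<one> \<ominus> z) = \<one> \<ominus> z \<otimes> z"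
    using z by (simp_all add: cstar_simps)
  show U: "\<one> \<ominus> z \<otimes> z \<in> Units B" using alg.Units_m_closed[OF u] f by simp
  have c: "inv (\<one> \<ominus> z) \<in> carrier B" "inv (\<one> \<oplus> z) \<in> carrier B" using u by auto
  let ?w = "inv (\<one> \<ominus> z) \<oplus> inv (\<one> \<oplus> z)"
  have "(\<one> \<ominus> z \<otimes> z) \<otimes> inv (\<one> \<ominus> z) = (\<one> \<oplus> z) \<otimes> ((\<one> \<ominus> z) \<otimes> inv (\<one> \<ominus> z))"
    unfolding f(2)[symmetric] using c z by (intro alg.m_assoc) auto
  moreover have "(\<one> \<ominus> z \<otimes> z) \<otimes> inv (\<one> \<oplus> z) = (\<one> \<ominus> z) \<otimes> ((\<one> \<oplus> z) \<otimes> inv (\<one> \<oplus> z))"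
    unfolding f(1)[symmetric] using c z by (intro alg.m_assoc) auto
  ultimately have "(\<one> \<ominus> z \<otimes> z) \<otimes> ?w = (\<one> \<oplus> z) \<oplus> (\<one> \<ominus> z)"
    using c z u by (simp add: alg.r_distr)
  also have "\<dots> = (1 + 1) \<odot> \<one>" unfolding smult_simps(2)[OF alg.one_closed]
    using z by (simp add: cstar_simps)
  finally have "(\<one> \<ominus> z \<otimes> z) \<otimes> ((1/2) \<odot> ?w) = \<one>"
    using c z by (simp add: smult_mult_right smult_simps(3,4))
  then show "inv (\<one> \<ominus> z \<otimes> z) = (1/2) \<odot> ?w"
    using alg.inv_unique[of "inv (\<one> \<ominus> z \<otimes> z)" "\<one> \<ominus> z \<otimes> z" "(1/2) \<odot> ?w"] U c z by simp
qed

end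

section \<open>Norm and spectrum of self-adjoint elements\<close>

context unital_cstar_algebra
begin

text \<open>Uniform closeness of the two resolvents on the unit circle, including the existence of these
  resolvents. It is stable under squaring both elements, with the same \<open>\<epsilon>\<close>.\<close>

definition circle_close :: "'a \<Rightarrow> 'a \<Rightarrow> real \<Rightarrow> bool"
  where "circle_close x y \<epsilon> \<longleftrightarrow> x \<in> carrier B \<and> y \<in> carrier B \<and>
    (\<forall>l. cmod l = 1 \<longrightarrow> \<one> \<ominus> l \<odot> x \<in> Units B \<and> \<one> \<ominus> l \<odot> y \<in> Units B \<and>
      cnorm B (inv (\<one> \<ominus> l \<odot> x) \<ominus> inv (\<one> \<ominus> l \<odot> y)) \<le> \<epsilon>)"

text \<open>A point \<open>l\<close> of the circle has square roots \<open>m\<close> and \<open>-m\<close> on the circle, and the resolvent of the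
  square at \<open>l\<close> is the average of the resolvents at these two points.\<close>

lemma circle_close_square:
  assumes P: "circle_close x y \<epsilon>"
  shows "circle_close (x \<otimes> x) (y \<otimes> y) \<epsilon>"
  unfolding circle_close_def
proof (intro conjI allI impI)
  have xy: "x \<in> carrier B" "y \<in> carrier B" using P by (auto simp: circle_close_def)
  then show "x \<otimes> x \<in> carrier B" "y \<otimes> y \<in> carrier B" by auto
  fix l :: complex assume "cmod l = 1"
  define m where "m = csqrt l"
  have ml: "m * m = l" by (simp add: m_def flip: power2_eq_square)
  then have "cmod m * cmod m = 1" using \<open>cmod l = 1\<close> by (simp flip: norm_mult)
  then have m: "cmod m = 1" "cmod (- m) = 1"
    using norm_ge_zero[of m] by (auto simp: square_eq_1_iff)
  have sq: "\<one> \<ominus> l \<odot> (z \<otimes> z) = \<one> \<ominus> (m \<odot> z) \<otimes> (m \<odot> z)" if "z \<in> carrier B" for z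
    using that by (simp add: smult_mult_left smult_mult_right smult_simps(3) ml)
  have neg: "\<one> \<ominus> (- m) \<odot> z = \<one> \<oplus> m \<odot> z" if "z \<in> carrier B" for z
    using that by (simp add: cstar_simps)
  have U: "\<one> \<ominus> m \<odot> x \<in> Units B" "\<one> \<oplus> m \<odot> x \<in> Units B"
      "\<one> \<ominus> m \<odot> y \<in> Units B" "\<one> \<oplus> m \<odot> y \<in> Units B"
    and d: "cnorm B (inv (\<one> \<ominus> m \<odot> x) \<ominus> inv (\<one> \<ominus> m \<odot> y)) \<le> \<epsilon>"
      "cnorm B (inv (\<one> \<oplus> m \<odot> x) \<ominus> inv (\<one> \<oplus> m \<odot> y)) \<le> \<epsilon>"
    using P m xy by (auto simp: circle_close_def neg[symmetric])
  have av: "\<one> \<ominus> l \<odot> (z \<otimes> z) \<in> Units B"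
      "inv (\<one> \<ominus> l \<odot> (z \<otimes> z)) = (1/2) \<odot> (inv (\<one> \<ominus> m \<odot> z) \<oplus> inv (\<one> \<oplus> m \<odot> z))"
    if "z \<in> carrier B" "\<one> \<ominus> m \<odot> z \<in> Units B" "\<one> \<oplus> m \<odot> z \<in> Units B" for z
    using inverse_average[of "m \<odot> z"] that by (simp_all add: sq)
  show "\<one> \<ominus> l \<odot> (x \<otimes> x) \<in> Units B" "\<one> \<ominus> l \<odot> (y \<otimes> y) \<in> Units B"
    using av(1) xy U by auto
  define p q r s where "p = inv (\<one> \<ominus> m \<odot> x)" and "q = inv (\<one> \<oplus> m \<odot> x)"
    and "r = inv (\<one> \<ominus> m \<odot> y)" and "s = inv (\<one> \<oplus> m \<odot> y)"
  have c: "p \<in> carrier B" "q \<in> carrier B" "r \<in> carrier B" "s \<in> carrier B"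
    using U by (auto simp: p_def q_def r_def s_def)
  have "(1/2) \<odot> (p \<oplus> q) \<ominus> (1/2) \<odot> (r \<oplus> s) = (1/2) \<odot> ((p \<ominus> r) \<oplus> (q \<ominus> s))"
    using c by (simp add: cstar_simps)
  moreover have "cnorm B ((p \<ominus> r) \<oplus> (q \<ominus> s)) \<le> 2 * \<epsilon>"
    using cnorm_add[of "p \<ominus> r" "q \<ominus> s"] c d by (simp add: p_def q_def r_def s_def)
  ultimately have "cnorm B ((1/2) \<odot> (p \<oplus> q) \<ominus> (1/2) \<odot> (r \<oplus> s)) \<le> \<epsilon>"
    using c by (simp add: cnorm_smult)
  then show "cnorm B (inv (\<one> \<ominus> l \<odot> (x \<otimes> x)) \<ominus> inv (\<one> \<ominus> l \<odot> (y \<otimes> y))) \<le> \<epsilon>"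
    using av(2)[of x] av(2)[of y] xy U by (simp add: p_def q_def r_def s_def)
qed

lemma inverse_minus_one:
  assumes x: "x \<in> carrier B" "\<one> \<ominus> x \<in> Units B"
  shows "inv (\<one> \<ominus> x) \<ominus> \<one> = x \<otimes> inv (\<one> \<ominus> x)"
proof -
  have c: "inv (\<one> \<ominus> x) \<in> carrier B" using x by auto
  have "x \<otimes> inv (\<one> \<ominus> x) = inv (\<one> \<ominus> x) \<ominus> (\<one> \<ominus> x) \<otimes> inv (\<one> \<ominus> x)"
    using c x(1) by (simp add: cstar_simps del: alg.Units_r_inv)
  then show ?thesis using x(2) by simp
qed

text \<open>The norm of a self-adjoint element is attained on its spectrum. This is Rickart's elementary
  proof of the spectral radius formula, along the powers \<open>h\<^sup>N\<close> with \<open>N = 2\<^sup>n\<close>. If the circle avoided the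
  spectrum, the resolvents of \<open>h\<close> and \<open>\<rho> h\<close> would be uniformly close on it for some \<open>\<rho> < 1\<close>, hence also
  those of \<open>h\<^sup>N\<close> and \<open>\<rho>\<^sup>N h\<^sup>N\<close>. As \<open>\<rho>\<^sup>N\<close> tends to 0, the inverse of \<open>1 - h\<^sup>N\<close> is eventually close to
  the unit, so \<open>h\<^sup>N\<close> is small, whereas the C*-identity gives it norm 1.\<close>

lemma norm_one_selfadjoint_not_Units:
  assumes h: "h \<in> carrier B" "h\<^sup>\<star> = h" "cnorm B h = 1"
  shows "\<not> (\<one> \<ominus> h \<in> Units B \<and> \<one> \<oplus> h \<in> Units B)"
proof
  assume "\<one> \<ominus> h \<in> Units B \<and> \<one> \<oplus> h \<in> Units B"
  then have U: "\<one> \<ominus> l \<odot> h \<in> Units B" if "cmod l = 1" for l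
    using unit_circle_Units[OF h(1,2)] that by blast
  obtain K where K: "K > 0" "\<And>l. cmod l = 1 \<Longrightarrow> cnorm B (inv (\<one> \<ominus> l \<odot> h)) \<le> K"
    using circle_inverse_bounded[OF h(1) U] by blast
  \<comment> \<open>small enough that the resolvents of \<open>h\<close> and \<open>(1 - \<eta>) h\<close> differ by at most \<open>2 K\<^sup>2 \<eta> \<le> 1/8\<close>\<close>
  define \<eta> where "\<eta> = min (1/2) (min (1 / (2 * K)) (1 / (16 * K\<^sup>2)))"
  have \<eta>: "0 < \<eta>" "\<eta> \<le> 1/2" "K * \<eta> \<le> 1/2" "2 * K\<^sup>2 * \<eta> \<le> 1/8"
  proof -
    show "0 < \<eta>" "\<eta> \<le> 1/2" using K(1) by (auto simp: \<eta>_def)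
    have "\<eta> \<le> 1 / (2 * K)" "\<eta> \<le> 1 / (16 * K\<^sup>2)" by (auto simp: \<eta>_def)
    then show "K * \<eta> \<le> 1/2" "2 * K\<^sup>2 * \<eta> \<le> 1/8" using K(1) by (simp_all add: field_simps)
  qed
  define \<rho> where "\<rho> = 1 - \<eta>"
  define g where "g = of_real \<rho> \<odot> h"
  have g: "g \<in> carrier B" using h by (simp add: g_def)
  have "circle_close h g (1/8)"
    unfolding circle_close_def
  proof (intro conjI allI impI)
    fix l :: complex assume l: "cmod l = 1"
    show "\<one> \<ominus> l \<odot> h \<in> Units B" by (rule U[OF l])
    have eq: "(\<one> \<ominus> l \<odot> h) \<ominus> (\<one> \<ominus> l \<odot> g) = (l * of_real \<rho> - l) \<odot> h"
      using h(1) smult_simps(2)[OF h(1), of "l * of_real \<rho>" "-l"] by (simp add: cstar_simps g_def)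
    have "cmod (l * of_real \<rho> - l) = cmod (l * of_real (\<rho> - 1))" by (simp add: algebra_simps)
    also have "\<dots> = \<eta>" using l \<eta> by (simp add: norm_mult \<rho>_def)
    finally have n: "cnorm B ((\<one> \<ominus> l \<odot> h) \<ominus> (\<one> \<ominus> l \<odot> g)) = \<eta>"
      using h by (simp add: eq cnorm_smult)
    have K\<eta>: "cnorm B (inv (\<one> \<ominus> l \<odot> h)) * \<eta> \<le> K * \<eta>"
      using K(2)[OF l] \<eta> by (intro mult_right_mono) auto
    then have s: "cnorm B (inv (\<one> \<ominus> l \<odot> h)) * cnorm B ((\<one> \<ominus> l \<odot> h) \<ominus> (\<one> \<ominus> l \<odot> g)) \<le> 1/2"
      unfolding n using K\<eta> \<eta>(3) by linarith
    note pert = Units_perturbation[OF U[OF l] _ s]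
    show V: "\<one> \<ominus> l \<odot> g \<in> Units B" using pert(1) g by simp
    have b: "cnorm B (inv (\<one> \<ominus> l \<odot> g)) \<le> 2 * K" using pert(2) g K(2)[OF l] by simp
    have c: "inv (\<one> \<ominus> l \<odot> h) \<in> carrier B" "inv (\<one> \<ominus> l \<odot> g) \<in> carrier B"
      using U[OF l] V by auto
    have "cnorm B (inv (\<one> \<ominus> l \<odot> h) \<ominus> inv (\<one> \<ominus> l \<odot> g)) \<le> K * \<eta> * (2 * K)"
      unfolding resolvent_identity[OF U[OF l] V]
      using n K(2)[OF l] b c g h cnorm_diff_commute[of "\<one> \<ominus> l \<odot> h" "\<one> \<ominus> l \<odot> g"]
      by (intro cnorm_mult_le) auto
    then show "cnorm B (inv (\<one> \<ominus> l \<odot> h) \<ominus> inv (\<one> \<ominus> l \<odot> g)) \<le> 1/8"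
      using \<eta>(4) by (simp add: power2_eq_square algebra_simps)
  qed (use h g in auto)
  define sq where "sq n = ((\<lambda>x. x \<otimes> x) ^^ n) h" for n
  have sq: "sq n \<in> carrier B \<and> (sq n)\<^sup>\<star> = sq n \<and> cnorm B (sq n) = 1 \<and>
      circle_close (sq n) (of_real (\<rho> ^ (2 ^ n)) \<odot> sq n) (1/8)" for n
  proof (induction n)
    case 0
    then show ?case using h \<open>circle_close h g (1/8)\<close> by (simp add: sq_def g_def)
  next
    case (Suc n)
    let ?r = "complex_of_real (\<rho> ^ (2 ^ n))"
    have "(?r \<odot> sq n) \<otimes> (?r \<odot> sq n) = of_real (\<rho> ^ (2 ^ Suc n)) \<odot> (sq n \<otimes> sq n)"
      using Suc by (simp add: smult_mult_left smult_mult_right smult_simps(3) mult_2 power_add)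
    then show ?case
      using Suc circle_close_square[of "sq n" "?r \<odot> sq n" "1/8"] cnorm_selfadjoint_square[of "sq n"]
      by (simp add: sq_def adj_mult)
  qed
  have "0 \<le> \<rho>" "\<rho> < 1" using \<eta> by (auto simp: \<rho>_def)
  then obtain n where n: "\<rho> ^ n < 1/16" using real_arch_pow_inv[of "1/16" \<rho>] by auto
  \<comment> \<open>with \<open>k = h\<^sup>N\<close>: the inverses of \<open>1 - k\<close> and \<open>1 - \<rho>\<^sup>N k\<close> differ by \<open>1/8\<close>, and the latter
    from the unit by \<open>1/8\<close>, which leaves \<open>\<parallel>k\<parallel> \<le> 2 \<cdot> 1/4\<close>\<close>
  have small: "\<rho> ^ (2 ^ n) < 1/16"
    using power_decreasing[of n "2 ^ n" \<rho>] \<open>0 \<le> \<rho>\<close> \<open>\<rho> < 1\<close> n less_exp[of n] by fastforce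
  define k k' where "k = sq n" and "k' = of_real (\<rho> ^ (2 ^ n)) \<odot> k"
  have k: "k \<in> carrier B" "cnorm B k = 1" "circle_close k k' (1/8)" "k' \<in> carrier B"
    using sq[of n] by (simp_all add: k_def k'_def)
  have nk': "cnorm B k' \<le> 1/16" using k(1,2) small \<open>0 \<le> \<rho>\<close> by (simp add: k'_def cnorm_smult norm_power)
  have W: "\<one> \<ominus> k \<in> Units B" "\<one> \<ominus> k' \<in> Units B" "cnorm B (inv (\<one> \<ominus> k) \<ominus> inv (\<one> \<ominus> k')) \<le> 1/8"
    using k(3) unfolding circle_close_def by (auto dest: spec[of _ 1] simp: smult_simps(4))
  have c: "inv (\<one> \<ominus> k) \<in> carrier B" "inv (\<one> \<ominus> k') \<in> carrier B" using W by auto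
  have "cnorm B (inv (\<one> \<ominus> k') \<ominus> \<one>) \<le> 1/8"
  proof -
    have "cnorm B (inv (\<one> \<ominus> k')) \<le> 2 * cnorm B (inv \<one>)"
    proof (rule Units_perturbation(2))
      have "\<one> \<ominus> (\<one> \<ominus> k') = k'" using k by (simp add: cstar_simps)
      then show "cnorm B (inv \<one>) * cnorm B (\<one> \<ominus> (\<one> \<ominus> k')) \<le> 1/2"
        using nk' cnorm_one_le cnorm_nonneg[OF k(4)] mult_mono[of "cnorm B \<one>" 1 "cnorm B k'" "1/16"]
        by (simp add: alg.inv_one)
    qed (use k in auto)
    then have "cnorm B (inv (\<one> \<ominus> k')) \<le> 2" using cnorm_one_le by (simp add: alg.inv_one)
    then have "cnorm B (k' \<otimes> inv (\<one> \<ominus> k')) \<le> 1/16 * 2"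
      using nk' k c by (intro cnorm_mult_le) auto
    then show ?thesis using inverse_minus_one[OF k(4) W(2)] by simp
  qed
  then have R: "cnorm B (inv (\<one> \<ominus> k) \<ominus> \<one>) \<le> 1/4"
    using cnorm_triangle[of "inv (\<one> \<ominus> k)" "inv (\<one> \<ominus> k')" \<one>] W c by simp
  have "(\<one> \<ominus> k) \<otimes> (inv (\<one> \<ominus> k) \<ominus> \<one>) = (\<one> \<ominus> k) \<otimes> inv (\<one> \<ominus> k) \<ominus> (\<one> \<ominus> k)"
    using c k by (simp add: cstar_simps del: alg.Units_r_inv)
  also have "\<dots> = k" using W(1) k by (simp add: cstar_simps)
  finally have "cnorm B k \<le> 2 * (1/4)"
    using cnorm_mult_le[of "\<one> \<ominus> k" "inv (\<one> \<ominus> k) \<ominus> \<one>" 2 "1/4"] R c k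
      cnorm_diff[of \<one> k] cnorm_one_le by simp
  then show False using k(2) by simp
qed

lemma selfadjoint_cnorm_le:
  assumes h: "h \<in> carrier B" "h\<^sup>\<star> = h" and r: "0 \<le> r"
    and U: "\<And>x. r < x \<Longrightarrow> of_real x \<odot> \<one> \<ominus> h \<in> Units B \<and> of_real x \<odot> \<one> \<oplus> h \<in> Units B"
  shows "cnorm B h \<le> r"
proof (rule ccontr)
  define x where "x = cnorm B h"
  assume "\<not> ?thesis"
  then have x: "r < x" "x > 0" using r by (auto simp: x_def)
  define g where "g = of_real (inverse x) \<odot> h"
  have "cnorm B g = 1" using h x by (simp add: g_def cnorm_smult x_def[symmetric] norm_inverse)
  moreover have "\<one> \<ominus> g = of_real (inverse x) \<odot> (of_real x \<odot> \<one> \<ominus> h)"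
      "\<one> \<oplus> g = of_real (inverse x) \<odot> (of_real x \<odot> \<one> \<oplus> h)"
    using h x by (simp_all add: g_def cstar_simps)
  ultimately show False
    using norm_one_selfadjoint_not_Units[of g] U[OF x(1)] smult_Units x h
    by (simp add: g_def adj_smult)
qed

text \<open>The spectrum of \<open>t - x\<close> lies in the interval from \<open>t - \<parallel>x\<parallel>\<close> to \<open>t\<close>: no real number above \<open>t\<close>
  belongs to it because \<open>x\<close> is positive, and none below \<open>-t\<close> by the Neumann argument.\<close>

lemma positive_element_cnorm:
  assumes x: "positive_element B x" and t: "cnorm B x \<le> t"
  shows "cnorm B (of_real t \<odot> \<one> \<ominus> x) \<le> t"
proof (rule selfadjoint_cnorm_le)
  have xc: "x \<in> carrier B" "x\<^sup>\<star> = x" using x by (auto simp: positive_element_def)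
  then show "of_real t \<odot> \<one> \<ominus> x \<in> carrier B" "(of_real t \<odot> \<one> \<ominus> x)\<^sup>\<star> = of_real t \<odot> \<one> \<ominus> x"
    by (simp_all add: adj_diff adj_smult adj_one)
  show t0: "0 \<le> t" using t cnorm_nonneg[OF xc(1)] by simp
  fix s assume s: "t < s"
  have "complex_of_real (t - s) \<notin> spectrum B x"
    using x s by (auto simp: positive_element_def complex_nonneg_Reals_iff)
  then have "(-1) \<odot> (complex_of_real (t - s) \<odot> \<one> \<ominus> x) \<in> Units B"
    by (intro smult_Units) (auto simp: spectrum_def)
  moreover have "(-1) \<odot> (complex_of_real (t - s) \<odot> \<one> \<ominus> x) = of_real s \<odot> \<one> \<ominus> (of_real t \<odot> \<one> \<ominus> x)"
    using xc(1) smult_simps(2)[OF alg.one_closed, of "of_real s" "- of_real t"] by (simp add: cstar_simps)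
  ultimately have 1: "of_real s \<odot> \<one> \<ominus> (of_real t \<odot> \<one> \<ominus> x) \<in> Units B" by simp
  have "(inverse (of_real (s + t))) \<odot> x \<in> carrier B" using xc by simp
  moreover have "cnorm B (inverse (of_real (s + t)) \<odot> x) < 1"
    using xc t t0 s by (simp add: cnorm_smult norm_inverse norm_divide field_simps flip: of_real_add)
  ultimately have "of_real (s + t) \<odot> (\<one> \<ominus> inverse (of_real (s + t)) \<odot> x) \<in> Units B"
    using s t0 by (intro smult_Units neumann) (simp_all flip: of_real_add)
  moreover have "of_real (s + t) \<odot> (\<one> \<ominus> inverse (of_real (s + t)) \<odot> x) = of_real s \<odot> \<one> \<oplus> (of_real t \<odot> \<one> \<ominus> x)"
  proof -
    have "complex_of_real (s + t) \<noteq> 0" using s t0 by (simp flip: of_real_add)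
    then have "of_real (s + t) \<odot> (\<one> \<ominus> inverse (of_real (s + t)) \<odot> x) = of_real (s + t) \<odot> \<one> \<ominus> x"
      using xc by (simp add: cstar_simps del: of_real_add)
    also have "of_real (s + t) \<odot> \<one> = of_real s \<odot> \<one> \<oplus> of_real t \<odot> \<one>"
      using smult_simps(2)[of \<one>] by simp
    finally show ?thesis using xc by (simp add: cstar_simps)
  qed
  ultimately show "of_real s \<odot> \<one> \<ominus> (of_real t \<odot> \<one> \<ominus> x) \<in> Units B \<and>
      of_real s \<odot> \<one> \<oplus> (of_real t \<odot> \<one> \<ominus> x) \<in> Units B"
    using 1 by simp
qed

text \<open>A converse of the previous estimate, with a projection \<open>e\<close> supporting \<open>y\<close> in the role of the unit.
  The corner version is what lets positivity survive the compression \<open>x \<mapsto> s* x s\<close>.\<close>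

lemma positive_element_cornerI:
  assumes e: "e \<in> carrier B" "e\<^sup>\<star> = e" "e \<otimes> e = e"
    and y: "y \<in> carrier B" "y\<^sup>\<star> = y" "e \<otimes> y = y"
    and t: "cnorm B (of_real t \<odot> e \<ominus> y) \<le> t"
  shows "positive_element B y"
  unfolding positive_element_def
proof (intro conjI y subsetI)
  fix z assume "z \<in> spectrum B y"
  then show "z \<in> \<real>\<^sub>\<ge>\<^sub>0"
    using spectrum_corner_subset[OF e y t, of z] by (cases "z = 0") (auto simp: complex_nonneg_Reals_iff)
qed

end

section \<open>Lipschitz maps between C*-algebras\<close>

text \<open>The common form of continuity for *-homomorphisms, multiplications and the conjugate linear
  adjoint. It asks for no linearity, so equalizers and preimages can be treated uniformly.\<close>

definition lipschitz_map :: "'a cstar \<Rightarrow> 'b cstar \<Rightarrow> ('a \<Rightarrow> 'b) \<Rightarrow> bool"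
  where "lipschitz_map B D f \<longleftrightarrow> f \<in> carrier B \<rightarrow> carrier D \<and>
    (\<exists>C. \<forall>x\<in>carrier B. \<forall>y\<in>carrier B. cdist D (f x) (f y) \<le> C * cdist B x y)"

lemma lipschitz_mapE:
  assumes "lipschitz_map B D f" and B: "unital_cstar_algebra B"
  obtains C where "C > 0" "\<And>x y. \<lbrakk>x \<in> carrier B; y \<in> carrier B\<rbrakk> \<Longrightarrow> cdist D (f x) (f y) \<le> C * cdist B x y"
proof -
  interpret B: unital_cstar_algebra B by fact
  obtain C where C: "\<And>x y. \<lbrakk>x \<in> carrier B; y \<in> carrier B\<rbrakk> \<Longrightarrow> cdist D (f x) (f y) \<le> C * cdist B x y"
    using assms(1) unfolding lipschitz_map_def by blast
  have "cdist D (f x) (f y) \<le> (\<bar>C\<bar> + 1) * cdist B x y" if "x \<in> carrier B" "y \<in> carrier B" for x y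
    using C[OF that] mult_right_mono[of C "\<bar>C\<bar> + 1" "cdist B x y"] Metric_space.nonneg[OF B.metric, of x y]
    by linarith
  then show thesis using that[of "\<bar>C\<bar> + 1"] by simp
qed

lemma lipschitz_map_continuous:
  assumes B: "unital_cstar_algebra B" and D: "unital_cstar_algebra D" and f: "lipschitz_map B D f"
  shows "continuous_map (ctopology B) (ctopology D) f"
proof -
  interpret B: unital_cstar_algebra B by fact
  interpret D: unital_cstar_algebra D by fact
  interpret M: Metric_space "carrier B" "cdist B" by (rule B.metric)
  obtain C where C: "C > 0" "\<And>x y. \<lbrakk>x \<in> carrier B; y \<in> carrier B\<rbrakk> \<Longrightarrow> cdist D (f x) (f y) \<le> C * cdist B x y"
    using lipschitz_mapE[OF f B] by metis
  show ?thesis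
    unfolding ctopology_def M.metric_continuous_map[OF D.metric]
  proof (intro conjI ballI allI impI)
    show "f ` carrier B \<subseteq> carrier D" using f by (auto simp: lipschitz_map_def)
    fix a and e :: real assume a: "a \<in> carrier B" and e: "e > 0"
    show "\<exists>d>0. \<forall>x. x \<in> carrier B \<and> cdist B a x < d \<longrightarrow> cdist D (f a) (f x) < e"
    proof (intro exI[of _ "e / C"] conjI allI impI)
      fix x assume x: "x \<in> carrier B \<and> cdist B a x < e / C"
      then have "C * cdist B a x < e" using C(1) by (simp add: field_simps)
      then show "cdist D (f a) (f x) < e" using C(2)[of a x] a x by simp
    qed (use e C in simp)
  qed
qed

context unital_cstar_algebra
begin

lemma closedin_iff_approx:
  "closedin (ctopology B) H \<longleftrightarrow>
    H \<subseteq> carrier B \<and> (\<forall>x\<in>carrier B. (\<forall>e>0. \<exists>y\<in>H. cdist B x y < e) \<longrightarrow> x \<in> H)"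
proof -
  interpret M: Metric_space "carrier B" "cdist B" by (rule metric)
  show ?thesis
    unfolding ctopology_def M.closedin_metric disjnt_iff M.in_mball by (blast dest: not_less[THEN iffD1])
qed

text \<open>The hypothesis on differences covers linear and conjugate linear maps alike.\<close>

lemma lipschitz_map_bounded:
  assumes f: "f \<in> carrier B \<rightarrow> carrier D"
    and b: "\<And>x y. \<lbrakk>x \<in> carrier B; y \<in> carrier B\<rbrakk> \<Longrightarrow> f x \<ominus>\<^bsub>D\<^esub> f y = f (x \<ominus> y)"
      "\<And>x. x \<in> carrier B \<Longrightarrow> cnorm D (f x) \<le> C * cnorm B x"
  shows "lipschitz_map B D f"
  unfolding lipschitz_map_def using assms by (auto simp: cdist_def intro!: exI[of _ C])

lemma lipschitz_map_mult:
  assumes "a \<in> carrier B" "b \<in> carrier B"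
  shows "lipschitz_map B B (\<lambda>x. a \<otimes> x \<otimes> b)" "lipschitz_map B B (\<lambda>x. a \<otimes> x)" "lipschitz_map B B (\<lambda>x. x \<otimes> b)"
proof -
  have d: "(a \<otimes> x \<otimes> b) \<ominus> (a \<otimes> y \<otimes> b) = a \<otimes> (x \<ominus> y) \<otimes> b" if "x \<in> carrier B" "y \<in> carrier B" for x y
    using that assms by (simp add: cstar_simps)
  have n: "cnorm B (a \<otimes> x \<otimes> b) \<le> cnorm B a * cnorm B b * cnorm B x" if "x \<in> carrier B" for x
    using cnorm_mult_le[of "a \<otimes> x" b "cnorm B a * cnorm B x" "cnorm B b"] cnorm_mult[of a x] that assms
    by (simp add: mult_ac)
  show "lipschitz_map B B (\<lambda>x. a \<otimes> x \<otimes> b)"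
    by (rule lipschitz_map_bounded[OF _ d n]) (use assms in auto)
  show "lipschitz_map B B (\<lambda>x. a \<otimes> x)"
    by (rule lipschitz_map_bounded[where C = "cnorm B a"]) (use assms cnorm_mult in \<open>auto simp: cstar_simps\<close>)
  show "lipschitz_map B B (\<lambda>x. x \<otimes> b)"
    by (rule lipschitz_map_bounded[where C = "cnorm B b"])
      (use assms cnorm_mult in \<open>auto simp: cstar_simps mult.commute\<close>)
qed

lemma lipschitz_map_adj: "lipschitz_map B B (\<lambda>x. x\<^sup>\<star>)"
  by (rule lipschitz_map_bounded[where C = 1]) (auto simp: adj_diff cnorm_adj)

end

lemma closedin_vimage:
  assumes B: "unital_cstar_algebra B" and D: "unital_cstar_algebra D" and f: "lipschitz_map B D f"
    and K: "closedin (ctopology D) K"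
  shows "closedin (ctopology B) {x \<in> carrier B. f x \<in> K}"
proof -
  interpret B: unital_cstar_algebra B by fact
  have "topspace (ctopology B) = carrier B"
    unfolding ctopology_def by (rule Metric_space.topspace_mtopology[OF B.metric])
  then show ?thesis
    using closedin_continuous_map_preimage[OF lipschitz_map_continuous[OF B D f] K] by simp
qed

lemma closedin_equalizer:
  assumes B: "unital_cstar_algebra B" and D: "unital_cstar_algebra D"
    and f: "lipschitz_map B D f" and g: "lipschitz_map B D g"
  shows "closedin (ctopology B) {x \<in> carrier B. f x = g x}"
proof -
  interpret B: unital_cstar_algebra B by fact
  interpret D: unital_cstar_algebra D by fact
  interpret M: Metric_space "carrier D" "cdist D" by (rule D.metric)
  obtain C where C: "C > 0" "\<And>x y. \<lbrakk>x \<in> carrier B; y \<in> carrier B\<rbrakk> \<Longrightarrow> cdist D (f x) (f y) \<le> C * cdist B x y"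
    using lipschitz_mapE[OF f B] by metis
  obtain K where K: "K > 0" "\<And>x y. \<lbrakk>x \<in> carrier B; y \<in> carrier B\<rbrakk> \<Longrightarrow> cdist D (g x) (g y) \<le> K * cdist B x y"
    using lipschitz_mapE[OF g B] by metis
  have fg: "f x \<in> carrier D" "g x \<in> carrier D" if "x \<in> carrier B" for x
    using f g that by (auto simp: lipschitz_map_def)
  show ?thesis
    unfolding B.closedin_iff_approx
  proof (intro conjI ballI impI)
    fix x assume x: "x \<in> carrier B" and ap: "\<forall>e>0. \<exists>y\<in>{x \<in> carrier B. f x = g x}. cdist B x y < e"
    have "cdist D (f x) (g x) \<le> 0"
    proof (rule field_le_epsilon)
      fix e :: real assume e: "e > 0"
      then obtain y where y: "y \<in> carrier B" "f y = g y" "cdist B x y < e / (C + K)"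
        using ap C(1) K(1) by (auto dest: spec[of _ "e / (C + K)"])
      have "cdist D (f x) (g x) \<le> cdist D (f x) (f y) + cdist D (g x) (g y)"
        using M.triangle'[of "f x" "f y" "g x"] fg x y by simp
      also have "\<dots> \<le> (C + K) * cdist B x y"
        using C(2)[OF x y(1)] K(2)[OF x y(1)] by (simp add: algebra_simps)
      also have "\<dots> \<le> e" using y(3) C(1) K(1) by (simp add: field_simps)
      finally show "cdist D (f x) (g x) \<le> 0 + e" by simp
    qed
    then have "f x = g x" using M.zero[of "f x" "g x"] M.nonneg[of "f x" "g x"] fg[OF x] by simp
    then show "x \<in> {x \<in> carrier B. f x = g x}" using x by simp
  qed auto
qed

section \<open>Closed subspaces\<close>

definition closed_subspace :: "'a cstar \<Rightarrow> 'a set \<Rightarrow> bool"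
  where "closed_subspace B H \<longleftrightarrow> submodule H complex_ring B \<and> closedin (ctopology B) H"

lemma (in unital_cstar_algebra) closed_subspaceI:
  assumes "H \<subseteq> carrier B" "\<zero> \<in> H" "\<And>x y. x \<in> H \<Longrightarrow> y \<in> H \<Longrightarrow> x \<oplus> y \<in> H"
    "\<And>c x. x \<in> H \<Longrightarrow> c \<odot> x \<in> H" "closedin (ctopology B) H"
  shows "closed_subspace B H"
proof -
  have "\<ominus> x \<in> H" if "x \<in> H" for x
    using assms(4)[OF that, of "-1"] smult_minus_one[of x] that assms(1) by auto
  then show ?thesis
    unfolding closed_subspace_def using assms by (intro conjI vs.submoduleI) auto
qed

lemma (in unital_cstar_algebra) closed_subspaceD:
  assumes "closed_subspace B H"
  shows "H \<subseteq> carrier B" "\<zero> \<in> H" "x \<in> H \<Longrightarrow> y \<in> H \<Longrightarrow> x \<oplus> y \<in> H" "x \<in> H \<Longrightarrow> c \<odot> x \<in> H"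
    "closedin (ctopology B) H"
  using assms submodule_closed[of H] by (auto simp: closed_subspace_def)

text \<open>The parameter \<open>\<sigma>\<close> is the identity for linear maps and complex conjugation for the adjoint.\<close>

lemma closed_subspace_vimage:
  assumes B: "unital_cstar_algebra B" and D: "unital_cstar_algebra D" and f: "lipschitz_map B D f"
    and add: "\<And>x y. \<lbrakk>x \<in> carrier B; y \<in> carrier B\<rbrakk> \<Longrightarrow> f (x \<oplus>\<^bsub>B\<^esub> y) = f x \<oplus>\<^bsub>D\<^esub> f y"
    and sm: "\<And>c x. x \<in> carrier B \<Longrightarrow> f (c \<odot>\<^bsub>B\<^esub> x) = \<sigma> c \<odot>\<^bsub>D\<^esub> f x"
    and K: "closed_subspace D K"
  shows "closed_subspace B {x \<in> carrier B. f x \<in> K}"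
proof -
  interpret B: unital_cstar_algebra B by fact
  interpret D: unital_cstar_algebra D by fact
  note K' = D.closed_subspaceD[OF K]
  have fc: "f x \<in> carrier D" if "x \<in> carrier B" for x using f that by (auto simp: lipschitz_map_def)
  have "f \<zero>\<^bsub>B\<^esub> \<oplus>\<^bsub>D\<^esub> f \<zero>\<^bsub>B\<^esub> = f \<zero>\<^bsub>B\<^esub>" using add[of "\<zero>\<^bsub>B\<^esub>" "\<zero>\<^bsub>B\<^esub>"] by simp
  then have "f \<zero>\<^bsub>B\<^esub> = \<zero>\<^bsub>D\<^esub>" using fc[of "\<zero>\<^bsub>B\<^esub>"] by simp
  then show ?thesis
    using K' closedin_vimage[OF B D f K'(5)] by (intro B.closed_subspaceI) (auto simp: add sm)
qed

lemma closed_subspace_equalizer: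
  assumes B: "unital_cstar_algebra B" and D: "unital_cstar_algebra D"
    and f: "lipschitz_map B D f" and g: "lipschitz_map B D g"
    and add: "\<And>x y. \<lbrakk>x \<in> carrier B; y \<in> carrier B\<rbrakk> \<Longrightarrow> f (x \<oplus>\<^bsub>B\<^esub> y) = f x \<oplus>\<^bsub>D\<^esub> f y"
      "\<And>x y. \<lbrakk>x \<in> carrier B; y \<in> carrier B\<rbrakk> \<Longrightarrow> g (x \<oplus>\<^bsub>B\<^esub> y) = g x \<oplus>\<^bsub>D\<^esub> g y"
    and sm: "\<And>c x. x \<in> carrier B \<Longrightarrow> f (c \<odot>\<^bsub>B\<^esub> x) = c \<odot>\<^bsub>D\<^esub> f x"
      "\<And>c x. x \<in> carrier B \<Longrightarrow> g (c \<odot>\<^bsub>B\<^esub> x) = c \<odot>\<^bsub>D\<^esub> g x"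
  shows "closed_subspace B {x \<in> carrier B. f x = g x}"
proof -
  interpret B: unital_cstar_algebra B by fact
  interpret D: unital_cstar_algebra D by fact
  have fc: "f x \<in> carrier D" "g x \<in> carrier D" if "x \<in> carrier B" for x
    using f g that by (auto simp: lipschitz_map_def)
  have "f \<zero>\<^bsub>B\<^esub> \<oplus>\<^bsub>D\<^esub> f \<zero>\<^bsub>B\<^esub> = f \<zero>\<^bsub>B\<^esub>" "g \<zero>\<^bsub>B\<^esub> \<oplus>\<^bsub>D\<^esub> g \<zero>\<^bsub>B\<^esub> = g \<zero>\<^bsub>B\<^esub>"
    using add(1)[of "\<zero>\<^bsub>B\<^esub>" "\<zero>\<^bsub>B\<^esub>"] add(2)[of "\<zero>\<^bsub>B\<^esub>" "\<zero>\<^bsub>B\<^esub>"] by simp_all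
  then have "f \<zero>\<^bsub>B\<^esub> = \<zero>\<^bsub>D\<^esub>" "g \<zero>\<^bsub>B\<^esub> = \<zero>\<^bsub>D\<^esub>" using fc[of "\<zero>\<^bsub>B\<^esub>"] by simp_all
  then show ?thesis
    using closedin_equalizer[OF B D f g] by (intro B.closed_subspaceI) (auto simp: add sm)
qed

lemma closed_span_minimal: "X \<subseteq> H \<Longrightarrow> closed_subspace B H \<Longrightarrow> closed_span B X \<subseteq> H"
  by (auto simp: closed_span_def closed_subspace_def)

lemma subset_closed_span: "X \<subseteq> closed_span B X"
  by (auto simp: closed_span_def)

lemma (in unital_cstar_algebra) closed_subspace_closed_span:
  assumes X: "X \<subseteq> carrier B"
  shows "closed_subspace B (closed_span B X)"
proof (rule closed_subspaceI)
  let ?F = "{H. X \<subseteq> H \<and> submodule H complex_ring B \<and> closedin (ctopology B) H}"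
  have ne: "carrier B \<in> ?F"
    using X closed_star_subalgebra_carrier by (auto simp: closed_star_subalgebra_def)
  show "closed_span B X \<subseteq> carrier B" using ne unfolding closed_span_def by blast
  show "closedin (ctopology B) (closed_span B X)"
    unfolding closed_span_def using ne by (intro closedin_Inter) auto
qed (use submodule_closed in \<open>auto simp: closed_span_def\<close>)

lemma closed_star_subalgebra_iff:
  "closed_star_subalgebra B H \<longleftrightarrow> closed_subspace B H \<and>
    (\<forall>x\<in>H. \<forall>y\<in>H. x \<otimes>\<^bsub>B\<^esub> y \<in> H) \<and> (\<forall>x\<in>H. x\<^sup>\<star>\<^bsub>B\<^esub> \<in> H)"
  by (auto simp: closed_star_subalgebra_def closed_subspace_def)

text \<open>Products are treated one factor at a time: for a fixed left factor in \<open>X\<close> the admissible right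
  factors form a closed subspace containing \<open>X\<close>, and then for a fixed right factor in the span the
  admissible left factors do.\<close>

lemma (in unital_cstar_algebra) closed_span_star_subalgebra:
  assumes X: "X \<subseteq> carrier B" and m: "\<And>x y. x \<in> X \<Longrightarrow> y \<in> X \<Longrightarrow> x \<otimes> y \<in> closed_span B X"
    and a: "\<And>x. x \<in> X \<Longrightarrow> x\<^sup>\<star> \<in> closed_span B X"
  shows "closed_star_subalgebra B (closed_span B X)"
proof -
  have B: "unital_cstar_algebra B" by unfold_locales
  let ?K = "closed_span B X"
  have K: "closed_subspace B ?K" by (rule closed_subspace_closed_span[OF X])
  note K' = closed_subspaceD[OF K]
  have m1: "x \<otimes> y \<in> ?K" if x: "x \<in> X" and y: "y \<in> ?K" for x y
  proof -
    have "closed_subspace B {y \<in> carrier B. x \<otimes> y \<in> ?K}"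
      using X x by (intro closed_subspace_vimage[OF B B _ _ _ K, where \<sigma> = id] lipschitz_map_mult)
        (auto simp: alg.r_distr smult_mult_right)
    then have "?K \<subseteq> {y \<in> carrier B. x \<otimes> y \<in> ?K}"
      using X m x by (intro closed_span_minimal) auto
    then show ?thesis using y by blast
  qed
  have m2: "x \<otimes> y \<in> ?K" if x: "x \<in> ?K" and y: "y \<in> ?K" for x y
  proof -
    have "closed_subspace B {x \<in> carrier B. x \<otimes> y \<in> ?K}"
      using K'(1) y by (intro closed_subspace_vimage[OF B B _ _ _ K, where \<sigma> = id] lipschitz_map_mult)
        (auto simp: alg.l_distr smult_mult_left)
    then have "?K \<subseteq> {x \<in> carrier B. x \<otimes> y \<in> ?K}"
      using X m1 y by (intro closed_span_minimal) auto
    then show ?thesis using x by blast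
  qed
  have "closed_subspace B {x \<in> carrier B. x\<^sup>\<star> \<in> ?K}"
    by (intro closed_subspace_vimage[OF B B _ _ _ K, where \<sigma> = cnj] lipschitz_map_adj)
      (auto simp: adj_add adj_smult)
  then have "?K \<subseteq> {x \<in> carrier B. x\<^sup>\<star> \<in> ?K}"
    using X a by (intro closed_span_minimal) auto
  then show ?thesis using K m2 by (auto simp: closed_star_subalgebra_iff)
qed

section \<open>Continuity of *-homomorphisms\<close>

lemma cstar_unital_homD:
  assumes "cstar_unital_hom B D f"
  shows "x \<in> carrier B \<Longrightarrow> f x \<in> carrier D"
    "\<lbrakk>x \<in> carrier B; y \<in> carrier B\<rbrakk> \<Longrightarrow> f (x \<oplus>\<^bsub>B\<^esub> y) = f x \<oplus>\<^bsub>D\<^esub> f y"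
    "\<lbrakk>x \<in> carrier B; y \<in> carrier B\<rbrakk> \<Longrightarrow> f (x \<otimes>\<^bsub>B\<^esub> y) = f x \<otimes>\<^bsub>D\<^esub> f y"
    "x \<in> carrier B \<Longrightarrow> f (c \<odot>\<^bsub>B\<^esub> x) = c \<odot>\<^bsub>D\<^esub> f x"
    "x \<in> carrier B \<Longrightarrow> f (x\<^sup>\<star>\<^bsub>B\<^esub>) = (f x)\<^sup>\<star>\<^bsub>D\<^esub>"
    "f \<one>\<^bsub>B\<^esub> = \<one>\<^bsub>D\<^esub>"
  using assms by (auto simp: cstar_unital_hom_def cstar_hom_def)

lemma cstar_unital_hom_diff:
  assumes B: "unital_cstar_algebra B" and D: "unital_cstar_algebra D" and f: "cstar_unital_hom B D f"
    and x: "x \<in> carrier B" and y: "y \<in> carrier B"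
  shows "f (x \<ominus>\<^bsub>B\<^esub> y) = f x \<ominus>\<^bsub>D\<^esub> f y" and "f \<zero>\<^bsub>B\<^esub> = \<zero>\<^bsub>D\<^esub>"
proof -
  interpret B: unital_cstar_algebra B by fact
  interpret D: unital_cstar_algebra D by fact
  note f' = cstar_unital_homD[OF f]
  have "f (\<ominus>\<^bsub>B\<^esub> y) = \<ominus>\<^bsub>D\<^esub> f y"
    using f'(4)[OF y, of "-1"] f'(1)[OF y] y by (simp add: B.smult_minus_one D.smult_minus_one)
  then show "f (x \<ominus>\<^bsub>B\<^esub> y) = f x \<ominus>\<^bsub>D\<^esub> f y" using x y f' by (simp add: a_minus_def)
  show "f \<zero>\<^bsub>B\<^esub> = \<zero>\<^bsub>D\<^esub>"
    using f'(4)[OF B.alg.zero_closed, of 0] f'(1)[OF B.alg.zero_closed] by (simp add: D.smult_simps)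
qed

text \<open>Homomorphisms preserve invertibility and hence shrink spectra, and the norm of the self-adjoint
  element \<open>x* x\<close> is controlled by its spectrum.\<close>

lemma cstar_unital_hom_contractive:
  assumes B: "unital_cstar_algebra B" and D: "unital_cstar_algebra D" and f: "cstar_unital_hom B D f"
    and x: "x \<in> carrier B"
  shows "cnorm D (f x) \<le> cnorm B x"
proof -
  interpret B: unital_cstar_algebra B by fact
  interpret D: unital_cstar_algebra D by fact
  note f' = cstar_unital_homD[OF f]
  define h where "h = x\<^sup>\<star>\<^bsub>B\<^esub> \<otimes>\<^bsub>B\<^esub> x"
  have h: "h \<in> carrier B" "h\<^sup>\<star>\<^bsub>B\<^esub> = h" using x by (simp_all add: h_def B.adj_mult)
  have units: "f u \<in> Units D" if "u \<in> Units B" for u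
  proof -
    have c: "u \<in> carrier B" "inv\<^bsub>B\<^esub> u \<in> carrier B" using that by auto
    then have "f u \<otimes>\<^bsub>D\<^esub> f (inv\<^bsub>B\<^esub> u) = \<one>\<^bsub>D\<^esub>" "f (inv\<^bsub>B\<^esub> u) \<otimes>\<^bsub>D\<^esub> f u = \<one>\<^bsub>D\<^esub>"
      using that f' by (metis B.alg.Units_r_inv) (metis c that f'(3,6) B.alg.Units_l_inv)
    then show ?thesis using c f'(1) by (auto simp: Units_def)
  qed
  have "cnorm D (f h) \<le> cnorm B h"
  proof (rule D.selfadjoint_cnorm_le)
    show "f h \<in> carrier D" "(f h)\<^sup>\<star>\<^bsub>D\<^esub> = f h" using h f' by (auto simp flip: f'(5))
    show "0 \<le> cnorm B h" using h B.cnorm_nonneg by simp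
    fix r assume r: "cnorm B h < r"
    then have r0: "r > 0" using B.cnorm_nonneg[OF h(1)] by simp
    have u: "of_real r \<odot>\<^bsub>B\<^esub> (\<one>\<^bsub>B\<^esub> \<ominus>\<^bsub>B\<^esub> c \<odot>\<^bsub>B\<^esub> h) \<in> Units B" if "cmod c = inverse r" for c
    proof (intro B.smult_Units B.neumann)
      have "inverse r * cnorm B h < 1" using r r0 by (simp add: field_simps)
      then show "cnorm B (c \<odot>\<^bsub>B\<^esub> h) < 1" using h that by (simp add: B.cnorm_smult)
    qed (use h r0 in auto)
    have "of_real r \<odot>\<^bsub>B\<^esub> \<one>\<^bsub>B\<^esub> \<ominus>\<^bsub>B\<^esub> h \<in> Units B"
      using u[of "of_real (inverse r)"] h r0 by (simp add: B.cstar_simps norm_inverse)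
    moreover have "of_real r \<odot>\<^bsub>B\<^esub> \<one>\<^bsub>B\<^esub> \<oplus>\<^bsub>B\<^esub> h \<in> Units B"
      using u[of "- of_real (inverse r)"] h r0 by (simp add: B.cstar_simps norm_inverse)
    ultimately have "f (of_real r \<odot>\<^bsub>B\<^esub> \<one>\<^bsub>B\<^esub> \<ominus>\<^bsub>B\<^esub> h) \<in> Units D" "f (of_real r \<odot>\<^bsub>B\<^esub> \<one>\<^bsub>B\<^esub> \<oplus>\<^bsub>B\<^esub> h) \<in> Units D"
      using units by auto
    then show "of_real r \<odot>\<^bsub>D\<^esub> \<one>\<^bsub>D\<^esub> \<ominus>\<^bsub>D\<^esub> f h \<in> Units D \<and> of_real r \<odot>\<^bsub>D\<^esub> \<one>\<^bsub>D\<^esub> \<oplus>\<^bsub>D\<^esub> f h \<in> Units D"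
      using h f' by (simp add: cstar_unital_hom_diff[OF B D f])
  qed
  then have "(cnorm D (f x))\<^sup>2 \<le> (cnorm B x)\<^sup>2"
    using x f' by (simp add: h_def B.cnorm_cstar D.cnorm_cstar)
  then show ?thesis using B.cnorm_nonneg[OF x] by (rule power2_le_imp_le)
qed

lemma lipschitz_map_hom:
  assumes B: "unital_cstar_algebra B" and D: "unital_cstar_algebra D" and f: "cstar_unital_hom B D f"
  shows "lipschitz_map B D f"
proof -
  interpret B: unital_cstar_algebra B by fact
  show ?thesis
    using cstar_unital_homD(1)[OF f] cstar_unital_hom_contractive[OF B D f] cstar_unital_hom_diff[OF B D f]
    by (intro B.lipschitz_map_bounded[where C = 1]) auto
qed

lemma closed_star_subalgebra_hom_equalizer:
  assumes B: "unital_cstar_algebra B" and D: "unital_cstar_algebra D"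
    and f: "cstar_unital_hom B D f" and g: "cstar_unital_hom B D g"
  shows "closed_star_subalgebra B {x \<in> carrier B. f x = g x}"
proof -
  interpret B: unital_cstar_algebra B by fact
  note f' = cstar_unital_homD[OF f] and g' = cstar_unital_homD[OF g]
  have "closed_subspace B {x \<in> carrier B. f x = g x}"
    by (rule closed_subspace_equalizer[OF B D lipschitz_map_hom[OF B D f] lipschitz_map_hom[OF B D g]])
      (simp_all add: f' g')
  then show ?thesis by (auto simp: closed_star_subalgebra_iff f' g')
qed

lemma homs_agree_on_generated:
  assumes B: "unital_cstar_algebra B" and D: "unital_cstar_algebra D"
    and f: "cstar_unital_hom B D f" and g: "cstar_unital_hom B D g"
    and X: "\<And>x. x \<in> X \<Longrightarrow> x \<in> carrier B \<and> f x = g x" and x: "x \<in> cstar_generated B X"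
  shows "f x = g x"
proof -
  interpret B: unital_cstar_algebra B by fact
  show ?thesis
    using B.cstar_generated_minimal[OF _ closed_star_subalgebra_hom_equalizer[OF B D f g], of X] X x by auto
qed

lemma closed_ideal_le_kernel:
  assumes B: "unital_cstar_algebra B" and D: "unital_cstar_algebra D" and f: "cstar_unital_hom B D f"
    and X: "\<And>x. x \<in> X \<Longrightarrow> x \<in> carrier B \<and> f x = \<zero>\<^bsub>D\<^esub>"
  shows "closed_ideal B X \<subseteq> {x \<in> carrier B. f x = \<zero>\<^bsub>D\<^esub>}"
proof -
  interpret B: unital_cstar_algebra B by fact
  interpret D: unital_cstar_algebra D by fact
  note f' = cstar_unital_homD[OF f]
  let ?K = "{x \<in> carrier B. f x = \<zero>\<^bsub>D\<^esub>}"
  have "lipschitz_map B D (\<lambda>x. \<zero>\<^bsub>D\<^esub>)"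
    by (rule B.lipschitz_map_bounded[where C = 0]) (auto simp: D.cstar_simps)
  then have "closedin (ctopology B) ?K"
    by (rule closedin_equalizer[OF B D lipschitz_map_hom[OF B D f]])
  moreover have "ideal ?K B"
  proof (rule idealI)
    show "ring B" ..
    show "subgroup ?K (add_monoid B)"
    proof (rule B.alg.add.subgroupI)
      show "?K \<noteq> {}" using cstar_unital_hom_diff(2)[OF B D f B.alg.zero_closed B.alg.zero_closed] by auto
      show "\<ominus>\<^bsub>B\<^esub> a \<in> ?K" if "a \<in> ?K" for a
        using that f'(4)[of a "-1"] B.smult_minus_one[of a] D.smult_simps(7)[of "\<zero>\<^bsub>D\<^esub>" 1]
        by (auto simp: D.cstar_simps)
    qed (auto simp: f')
  qed (auto simp: f')
  moreover have "X \<subseteq> ?K" using X by auto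
  ultimately show ?thesis unfolding closed_ideal_def by blast
qed

section \<open>Subalgebras, projections and partial isometries\<close>

lemma (in unital_cstar_algebra) subalgebra:
  assumes H: "closed_star_subalgebra B H" and one: "\<one> \<in> H"
  shows "unital_cstar_algebra (B\<lparr>carrier := H\<rparr>)"
    and "cstar_unital_hom (B\<lparr>carrier := H\<rparr>) B (\<lambda>x. x)"
    and "\<lbrakk>x \<in> H; y \<in> H\<rbrakk> \<Longrightarrow> x \<ominus>\<^bsub>B\<lparr>carrier := H\<rparr>\<^esub> y = x \<ominus> y"
proof -
  let ?P = "B\<lparr>carrier := H\<rparr>"
  have sm: "submodule H complex_ring B" using H by (simp add: closed_star_subalgebra_def)
  note subm = submodule_closed[OF sm]
  have Hc [simp]: "h \<in> carrier B" if "h \<in> H" for h using that subm(1) by blast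
  have [simp]: "h \<otimes> k \<in> H" if "h \<in> H" "k \<in> H" for h k
    using H that by (auto simp: closed_star_subalgebra_def)
  have [simp]: "h\<^sup>\<star> \<in> H" if "h \<in> H" for h
    using H that by (auto simp: closed_star_subalgebra_def)
  note [simp] = subm(2-5) one
  have ag: "abelian_group ?P"
  proof (rule abelian_groupI)
    fix x assume x: "x \<in> carrier ?P"
    show "\<exists>y\<in>carrier ?P. y \<oplus>\<^bsub>?P\<^esub> x = \<zero>\<^bsub>?P\<^esub>"
      using x alg.l_neg[of x] by (intro bexI[of _ "\<ominus> x"]) simp_all
  qed (simp_all add: alg.add.m_ac)
  have rg: "ring ?P"
    by (rule ringI[OF ag Group.monoidI]) (simp_all add: alg.m_assoc alg.l_distr alg.r_distr)
  have md: "Module.module complex_ring ?P"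
    using vs.R.is_cring smult_simps
    by (intro moduleI[OF _ ag]) simp_all
  interpret P: ring ?P by (rule rg)
  have neg: "\<ominus>\<^bsub>?P\<^esub> y = \<ominus> y" if "y \<in> H" for y
    using that by (intro P.minus_equality) (simp_all add: alg.l_neg)
  show sub: "x \<ominus>\<^bsub>?P\<^esub> y = x \<ominus> y" if "x \<in> H" "y \<in> H" for x y
    using that by (simp add: a_minus_def neg)
  have dist: "cdist ?P x y = cdist B x y" if "x \<in> H" "y \<in> H" for x y
    using that by (simp add: cdist_def sub)
  interpret M: Metric_space "carrier B" "cdist B" by (rule metric)
  have PM: "Metric_space H (cdist ?P)"
  proof
    fix x y z
    show "0 \<le> cdist ?P x y" by (simp add: cdist_def sub cnorm_nonneg)
    show "cdist ?P x y = cdist ?P y x"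
      using dist[of x y] dist[of y x] M.commute[of x y] by (cases "x \<in> H \<and> y \<in> H") (auto simp: cdist_def)
    show "x \<in> H \<Longrightarrow> y \<in> H \<Longrightarrow> cdist ?P x y = 0 \<longleftrightarrow> x = y" by (simp add: dist)
    show "x \<in> H \<Longrightarrow> y \<in> H \<Longrightarrow> z \<in> H \<Longrightarrow> cdist ?P x z \<le> cdist ?P x y + cdist ?P y z"
      by (simp add: dist M.triangle)
  qed
  interpret PM: Metric_space H "cdist ?P" by (rule PM)
  have comp: "PM.mcomplete"
    unfolding PM.mcomplete_def
  proof (intro allI impI)
    fix \<sigma> assume s: "PM.MCauchy \<sigma>"
    then have r: "\<sigma> n \<in> H" for n by (auto simp: PM.MCauchy_def)
    have "M.MCauchy \<sigma>" using s r by (auto simp: PM.MCauchy_def M.MCauchy_def dist)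
    then obtain l where l: "limitin M.mtopology \<sigma> l sequentially"
      using complete M.mcomplete_def by blast
    have "l \<in> H"
      using H l r M.metric_closedin_iff_sequentially_closed[of H]
      unfolding closed_star_subalgebra_def ctopology_def by blast
    then have "limitin PM.mtopology \<sigma> l sequentially"
      using l r by (simp add: M.limit_metric_sequentially PM.limit_metric_sequentially dist)
    then show "\<exists>x. limitin PM.mtopology \<sigma> x sequentially" by blast
  qed
  show "unital_cstar_algebra ?P"
  proof (rule unital_cstar_algebra.intro[OF rg md], unfold_locales)
    show "Metric_space.mcomplete (carrier ?P) (cdist ?P)" using comp by simp
  qed (simp_all add: smult_mult_left smult_mult_right adj_add adj_smult adj_mult
      cnorm_nonneg cnorm_add cnorm_mult cnorm_cstar cnorm_eq_0 cnorm_smult)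
  show "cstar_unital_hom ?P B (\<lambda>x. x)"
    by (simp add: cstar_unital_hom_def cstar_hom_def)
qed

text \<open>If \<open>p q\<close> is idempotent, the C*-identity for \<open>p q - q p q\<close> shows that this difference vanishes, so
  \<open>p q\<close> is self-adjoint.\<close>

lemma (in unital_cstar_algebra) projections_commute:
  assumes p: "p \<in> carrier B" "p\<^sup>\<star> = p" "p \<otimes> p = p" and q: "q \<in> carrier B" "q\<^sup>\<star> = q" "q \<otimes> q = q"
    and pq: "(p \<otimes> q) \<otimes> (p \<otimes> q) = p \<otimes> q"
  shows "p \<otimes> q = q \<otimes> p"
proof -
  define x where "x = p \<otimes> q \<ominus> q \<otimes> p \<otimes> q"
  have c: "x \<in> carrier B" using p q by (simp add: x_def)
  have xs: "x\<^sup>\<star> = q \<otimes> p \<ominus> q \<otimes> p \<otimes> q"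
    using p q by (simp add: x_def adj_diff adj_mult alg.m_assoc)
  have pp: "p \<otimes> (p \<otimes> z) = p \<otimes> z" "q \<otimes> (q \<otimes> z) = q \<otimes> z" if "z \<in> carrier B" for z
    using that p q by (simp_all flip: alg.m_assoc)
  have pqpq: "p \<otimes> (q \<otimes> (p \<otimes> q)) = p \<otimes> q" using pq p q by (simp add: alg.m_assoc)
  have "x\<^sup>\<star> \<otimes> x = \<zero>"
    unfolding xs unfolding x_def using p q by (simp add: cstar_simps pp pqpq)
  then have "cnorm B x = 0" using cnorm_cstar[OF c] by simp
  then have eq: "p \<otimes> q = q \<otimes> p \<otimes> q"
    using cnorm_eq_0[OF c] diff_eq_zero_iff[of "p \<otimes> q" "q \<otimes> p \<otimes> q"] p q by (simp add: x_def)
  have "(q \<otimes> p \<otimes> q)\<^sup>\<star> = q \<otimes> p \<otimes> q" using p q by (simp add: adj_mult alg.m_assoc)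
  then have "(p \<otimes> q)\<^sup>\<star> = p \<otimes> q" by (simp add: eq)
  then show ?thesis using p q by (simp add: adj_mult)
qed

text \<open>With \<open>p = v* v\<close>, the element \<open>v - v p\<close> vanishes by the C*-identity, since
  \<open>(1 - p) p (1 - p) = 0\<close>.\<close>

lemma (in unital_cstar_algebra) partial_isometryI:
  assumes v: "v \<in> carrier B" and idem: "(v\<^sup>\<star> \<otimes> v) \<otimes> (v\<^sup>\<star> \<otimes> v) = v\<^sup>\<star> \<otimes> v"
  shows "v \<otimes> (v\<^sup>\<star> \<otimes> v) = v"
proof -
  define p where "p = v\<^sup>\<star> \<otimes> v"
  have p: "p \<in> carrier B" "p\<^sup>\<star> = p" "p \<otimes> p = p" using v idem by (simp_all add: p_def adj_mult)
  define x where "x = v \<ominus> v \<otimes> p"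
  have x: "x \<in> carrier B" "x\<^sup>\<star> = v\<^sup>\<star> \<ominus> p \<otimes> v\<^sup>\<star>" using v p by (simp_all add: x_def adj_diff adj_mult)
  have "x\<^sup>\<star> \<otimes> x = (p \<ominus> p \<otimes> p) \<ominus> (p \<ominus> p \<otimes> p) \<otimes> p"
    unfolding x(2) unfolding x_def using v p(1) by (simp add: p_def cstar_simps)
  also have "\<dots> = \<zero>" using p by (simp add: cstar_simps)
  finally have "x = \<zero>" using cnorm_cstar[OF x(1)] cnorm_eq_0[OF x(1)] by simp
  then show ?thesis using diff_eq_zero_iff[of v "v \<otimes> p"] v p by (simp add: x_def p_def)
qed

section \<open>The core of a Toeplitz representation\<close>

text \<open>The Toeplitz relations together with the hypothesis on \<open>L\<^sup>n(1)\<close>; the pair \<open>(d, s)\<close> will be the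
  canonical one in Exel's crossed product.\<close>

locale toeplitz_representation = A: unital_cstar_algebra A + E: unital_cstar_algebra E
  for A :: "'a cstar" and E :: "'e cstar" +
  fixes \<alpha> L :: "'a \<Rightarrow> 'a" and d :: "'a \<Rightarrow> 'e" and s :: 'e
  assumes endo: "cstar_endomorphism A \<alpha>"
    and L_closed: "a \<in> carrier A \<Longrightarrow> L a \<in> carrier A"
    and L_transfer: "\<lbrakk>a \<in> carrier A; b \<in> carrier A\<rbrakk> \<Longrightarrow> L (\<alpha> a \<otimes>\<^bsub>A\<^esub> b) = a \<otimes>\<^bsub>A\<^esub> L b"
    and L_proj: "n \<ge> 1 \<Longrightarrow> projection A ((L ^^ n) \<one>\<^bsub>A\<^esub>)"
    and rep: "toeplitz_rep A \<alpha> L E d s"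
begin

abbreviation mul (infixl \<open>\<cdot>\<close> 70) where "x \<cdot> y \<equiv> x \<otimes>\<^bsub>E\<^esub> y"
abbreviation star where "star x \<equiv> x\<^sup>\<star>\<^bsub>E\<^esub>"
abbreviation pw :: "'e \<Rightarrow> nat \<Rightarrow> 'e" where "pw x k \<equiv> x [^]\<^bsub>E\<^esub> k"

definition range_proj :: "nat \<Rightarrow> 'e"
  where "range_proj k = pw s k \<cdot> pw (star s) k"

lemma d_hom: "cstar_unital_hom A E d"
  and s_closed [simp]: "s \<in> carrier E"
  and s_d: "a \<in> carrier A \<Longrightarrow> s \<cdot> d a = d (\<alpha> a) \<cdot> s"
  and d_L: "a \<in> carrier A \<Longrightarrow> star s \<cdot> d a \<cdot> s = d (L a)"
  using rep by (auto simp: toeplitz_rep_def)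

lemmas d_simps = cstar_unital_homD[OF d_hom]

lemma d_closed [simp]: "a \<in> carrier A \<Longrightarrow> d a \<in> carrier E"
  by (rule d_simps)

lemma \<alpha>_closed [simp]: "a \<in> carrier A \<Longrightarrow> \<alpha> a \<in> carrier A"
  and \<alpha>_adj: "a \<in> carrier A \<Longrightarrow> \<alpha> (a\<^sup>\<star>\<^bsub>A\<^esub>) = (\<alpha> a)\<^sup>\<star>\<^bsub>A\<^esub>"
  using endo by (auto simp: cstar_endomorphism_def cstar_hom_def)

lemma d_s_star: "a \<in> carrier A \<Longrightarrow> d a \<cdot> star s = star s \<cdot> d (\<alpha> a)"
  using arg_cong[OF s_d[of "a\<^sup>\<star>\<^bsub>A\<^esub>"], of star] by (simp add: E.adj_mult d_simps \<alpha>_adj)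

lemma pow_closed [simp]: "(\<alpha> ^^ k) a \<in> carrier A" "(L ^^ k) a \<in> carrier A" if "a \<in> carrier A"
  by (induction k) (simp_all add: that L_closed)

lemma pow_Suc_left: "x \<in> carrier E \<Longrightarrow> pw x (Suc k) = x \<cdot> pw x k"
  by (rule E.alg.nat_pow_Suc2)

lemma star_pow: "x \<in> carrier E \<Longrightarrow> star (pw x k) = pw (star x) k"
proof (induction k)
  case (Suc k)
  then show ?case using pow_Suc_left[of "star x" k] by (simp add: E.adj_mult)
qed (simp add: E.adj_one)

lemma spow_d: "a \<in> carrier A \<Longrightarrow> pw s k \<cdot> d a = d ((\<alpha> ^^ k) a) \<cdot> pw s k"
proof (induction k arbitrary: a)
  case (Suc k)
  have "pw s (Suc k) \<cdot> d a = pw s k \<cdot> d (\<alpha> a) \<cdot> s"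
    using Suc.prems by (simp add: E.alg.m_assoc s_d)
  also have "\<dots> = d ((\<alpha> ^^ k) (\<alpha> a)) \<cdot> pw s (Suc k)"
    using Suc.prems Suc.IH[of "\<alpha> a"] by (simp add: E.alg.m_assoc)
  finally show ?case by (simp add: funpow_swap1)
qed simp

lemma spow_star_d_spow: "a \<in> carrier A \<Longrightarrow> pw (star s) k \<cdot> d a \<cdot> pw s k = d ((L ^^ k) a)"
proof (induction k)
  case (Suc k)
  have "pw (star s) (Suc k) \<cdot> d a \<cdot> pw s (Suc k) = star s \<cdot> (pw (star s) k \<cdot> d a \<cdot> pw s k) \<cdot> s"
    unfolding pow_Suc_left[of "star s", OF E.adj_closed[OF s_closed]]
    using Suc.prems by (simp add: E.alg.m_assoc)
  then show ?case using Suc by (simp add: d_L)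
qed simp

lemma spow_star_spow: "pw (star s) k \<cdot> pw s k = d ((L ^^ k) \<one>\<^bsub>A\<^esub>)"
  using spow_star_d_spow[of "\<one>\<^bsub>A\<^esub>" k] by (simp add: d_simps)

lemma spow_star_spow_idem:
  "(pw (star s) k \<cdot> pw s k) \<cdot> (pw (star s) k \<cdot> pw s k) = pw (star s) k \<cdot> pw s k"
proof (cases "k = 0")
  case False
  then have "(L ^^ k) \<one>\<^bsub>A\<^esub> \<otimes>\<^bsub>A\<^esub> (L ^^ k) \<one>\<^bsub>A\<^esub> = (L ^^ k) \<one>\<^bsub>A\<^esub>"
    using L_proj[of k] by (simp add: projection_def)
  then show ?thesis unfolding spow_star_spow by (simp flip: d_simps(3))
qed simp

lemma spow_partial_isometry: "pw s k \<cdot> (pw (star s) k \<cdot> pw s k) = pw s k"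
  using E.partial_isometryI[of "pw s k"] spow_star_spow_idem by (simp add: star_pow)

lemma range_proj_closed [simp]: "range_proj k \<in> carrier E"
  by (simp add: range_proj_def)

lemma range_proj_adj: "star (range_proj k) = range_proj k"
  by (simp add: range_proj_def E.adj_mult star_pow)

lemma range_proj_idem: "range_proj k \<cdot> range_proj k = range_proj k"
proof -
  have "range_proj k \<cdot> range_proj k = (pw s k \<cdot> (pw (star s) k \<cdot> pw s k)) \<cdot> pw (star s) k"
    by (simp add: range_proj_def E.alg.m_assoc)
  then show ?thesis unfolding spow_partial_isometry range_proj_def .
qed

definition init_proj :: 'e where "init_proj = star s \<cdot> s"

lemma init_proj_eq: "init_proj = d (L \<one>\<^bsub>A\<^esub>)"
  using d_L[of "\<one>\<^bsub>A\<^esub>"] by (simp add: d_simps init_proj_def)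

lemma init_proj: "init_proj \<in> carrier E" "star init_proj = init_proj" "init_proj \<cdot> init_proj = init_proj"
  using spow_star_spow_idem[of 1] by (simp_all add: init_proj_def E.adj_mult)

lemma s_init_proj: "s \<cdot> init_proj = s" "init_proj \<cdot> star s = star s"
proof -
  show 1: "s \<cdot> init_proj = s" using spow_partial_isometry[of 1] by (simp add: init_proj_def)
  show "init_proj \<cdot> star s = star s"
    using arg_cong[OF 1, of star] init_proj by (simp add: E.adj_mult)
qed

text \<open>Both sides equal \<open>d (a L(1))\<close>: the left one because \<open>s d(a) = d(\<alpha> a) s\<close> and
  \<open>L(\<alpha>(a) 1) = a L(1)\<close>, the right one because \<open>s*s = d (L(1))\<close>.\<close>

lemma init_proj_d: "a \<in> carrier A \<Longrightarrow> init_proj \<cdot> d a = d a \<cdot> init_proj"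
proof -
  assume a: "a \<in> carrier A"
  have "init_proj \<cdot> d a = star s \<cdot> d (\<alpha> a) \<cdot> s"
    using a by (simp add: init_proj_def E.alg.m_assoc s_d)
  also have "\<dots> = d (a \<otimes>\<^bsub>A\<^esub> L \<one>\<^bsub>A\<^esub>)"
    using a d_L[of "\<alpha> a"] L_transfer[of a "\<one>\<^bsub>A\<^esub>"] by simp
  finally show ?thesis using a by (simp add: d_simps init_proj_eq L_closed)
qed

text \<open>Because \<open>s\<^sup>k\<^sup>+\<^sup>1 = s s\<^sup>k\<close> is a partial isometry, \<open>(s*s) e\<^sub>k\<close> is idempotent, and
  projections with an idempotent product commute. This is the place where all powers of \<open>s\<close> matter.\<close>

lemma init_proj_range_proj: "init_proj \<cdot> range_proj k = range_proj k \<cdot> init_proj"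
proof (rule E.projections_commute[OF init_proj range_proj_closed range_proj_adj range_proj_idem])
  have "pw s (Suc k) \<cdot> (pw (star s) (Suc k) \<cdot> pw s (Suc k)) = pw s (Suc k)"
    by (rule spow_partial_isometry)
  then have "s \<cdot> (pw s k \<cdot> (pw (star s) k \<cdot> (star s \<cdot> (s \<cdot> pw s k)))) = s \<cdot> pw s k"
    unfolding pow_Suc_left[OF s_closed] by (simp add: E.alg.m_assoc)
  then have "star s \<cdot> (s \<cdot> (pw s k \<cdot> (pw (star s) k \<cdot> (star s \<cdot> (s \<cdot> pw s k))))) \<cdot> pw (star s) k
      = star s \<cdot> (s \<cdot> pw s k) \<cdot> pw (star s) k"
    by simp
  then show "(init_proj \<cdot> range_proj k) \<cdot> (init_proj \<cdot> range_proj k) = init_proj \<cdot> range_proj k"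
    by (simp add: init_proj_def range_proj_def E.alg.m_assoc)
qed

text \<open>The larger power absorbs the smaller one, because \<open>s\<^sup>k\<close> is a left factor of \<open>s\<^sup>l\<close>. This rewriting
  rule yields the normal form of the elements of the core.\<close>

lemma range_proj_d_range_proj:
  assumes a: "a \<in> carrier A" and kl: "k \<le> l"
  shows "range_proj k \<cdot> d a \<cdot> range_proj l = d ((\<alpha> ^^ k) ((L ^^ k) a)) \<cdot> range_proj l"
proof -
  have l: "pw s l = pw s k \<cdot> pw s (l - k)" using kl by (simp add: E.alg.nat_pow_mult)
  have "range_proj k \<cdot> d a \<cdot> range_proj l
      = pw s k \<cdot> (pw (star s) k \<cdot> d a \<cdot> pw s k) \<cdot> (pw s (l - k) \<cdot> pw (star s) l)"
    using a by (simp add: range_proj_def l E.alg.m_assoc)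
  also have "\<dots> = d ((\<alpha> ^^ k) ((L ^^ k) a)) \<cdot> pw s k \<cdot> (pw s (l - k) \<cdot> pw (star s) l)"
    using a by (simp add: spow_star_d_spow spow_d)
  also have "\<dots> = d ((\<alpha> ^^ k) ((L ^^ k) a)) \<cdot> range_proj l"
    using a by (simp add: range_proj_def l E.alg.m_assoc)
  finally show ?thesis .
qed

text \<open>The adjoint of the previous rule, applied to \<open>a*\<close> and with \<open>k\<close> and \<open>l\<close> exchanged.\<close>

lemma range_proj_d_range_proj':
  assumes a: "a \<in> carrier A" and lk: "l \<le> k"
  obtains b where "b \<in> carrier A" "range_proj k \<cdot> d a \<cdot> range_proj l = range_proj k \<cdot> d b"
proof
  let ?b = "(\<alpha> ^^ l) ((L ^^ l) (a\<^sup>\<star>\<^bsub>A\<^esub>))"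
  show "?b\<^sup>\<star>\<^bsub>A\<^esub> \<in> carrier A" using a by simp
  show "range_proj k \<cdot> d a \<cdot> range_proj l = range_proj k \<cdot> d (?b\<^sup>\<star>\<^bsub>A\<^esub>)"
    using arg_cong[OF range_proj_d_range_proj[of "a\<^sup>\<star>\<^bsub>A\<^esub>" l k], of star] a lk
    by (simp add: E.adj_mult d_simps range_proj_adj E.alg.m_assoc)
qed

definition monomials :: "'e set"
  where "monomials = {d a \<cdot> range_proj k \<cdot> d b | a b k. a \<in> carrier A \<and> b \<in> carrier A}"

lemma monomials_closed: "monomials \<subseteq> carrier E"
  by (auto simp: monomials_def)

lemma monomialsI: "a \<in> carrier A \<Longrightarrow> b \<in> carrier A \<Longrightarrow> d a \<cdot> range_proj k \<cdot> d b \<in> monomials"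
  by (auto simp: monomials_def)

lemma monomials_mult:
  assumes "x \<in> monomials" "y \<in> monomials"
  shows "x \<cdot> y \<in> monomials"
proof -
  obtain a b k where x: "x = d a \<cdot> range_proj k \<cdot> d b" "a \<in> carrier A" "b \<in> carrier A"
    using assms by (auto simp: monomials_def)
  obtain a' b' l where y: "y = d a' \<cdot> range_proj l \<cdot> d b'" "a' \<in> carrier A" "b' \<in> carrier A"
    using assms by (auto simp: monomials_def)
  let ?c = "b \<otimes>\<^bsub>A\<^esub> a'"
  have xy: "x \<cdot> y = d a \<cdot> (range_proj k \<cdot> d ?c \<cdot> range_proj l) \<cdot> d b'"
    using x y by (simp add: E.alg.m_assoc d_simps)
  show ?thesis
  proof (cases "k \<le> l")
    case True
    then have r: "range_proj k \<cdot> d ?c \<cdot> range_proj l = d ((\<alpha> ^^ k) ((L ^^ k) ?c)) \<cdot> range_proj l"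
      using x y by (intro range_proj_d_range_proj) auto
    have "x \<cdot> y = d (a \<otimes>\<^bsub>A\<^esub> (\<alpha> ^^ k) ((L ^^ k) ?c)) \<cdot> range_proj l \<cdot> d b'"
      unfolding xy r using x y by (simp add: d_simps(3) E.alg.m_assoc)
    then show ?thesis using x y by (simp add: monomialsI)
  next
    case False
    then obtain f where f: "f \<in> carrier A" "range_proj k \<cdot> d ?c \<cdot> range_proj l = range_proj k \<cdot> d f"
      using range_proj_d_range_proj'[of ?c l k] x y by auto
    then have "x \<cdot> y = d a \<cdot> range_proj k \<cdot> d (f \<otimes>\<^bsub>A\<^esub> b')"
      unfolding xy f(2) using x y by (simp add: d_simps E.alg.m_assoc)
    then show ?thesis using x y f by (simp add: monomialsI)
  qed
qed

lemma monomials_adj: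
  assumes "x \<in> monomials"
  shows "star x \<in> monomials"
proof -
  obtain a b k where x: "x = d a \<cdot> range_proj k \<cdot> d b" "a \<in> carrier A" "b \<in> carrier A"
    using assms by (auto simp: monomials_def)
  then have "star x = d (b\<^sup>\<star>\<^bsub>A\<^esub>) \<cdot> range_proj k \<cdot> d (a\<^sup>\<star>\<^bsub>A\<^esub>)"
    by (simp add: E.adj_mult d_simps range_proj_adj E.alg.m_assoc)
  then show ?thesis using x by (simp add: monomialsI)
qed

definition core :: "'e set"
  where "core = cstar_generated E (d ` carrier A \<union> {pw s k \<cdot> pw (star s) k | k :: nat. k \<ge> 1})"

lemma core_generators:
  "d ` carrier A \<union> {pw s k \<cdot> pw (star s) k | k :: nat. k \<ge> 1} \<subseteq> carrier E"
  by auto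

lemma core_subalgebra: "closed_star_subalgebra E core"
  unfolding core_def by (rule E.closed_star_subalgebra_generated[OF core_generators])

lemma core_closed: "x \<in> core \<Longrightarrow> x \<in> carrier E"
  using core_subalgebra E.submodule_closed(1) unfolding closed_star_subalgebra_def by blast

lemma core_d: "a \<in> carrier A \<Longrightarrow> d a \<in> core"
  by (auto simp: core_def cstar_generated_def)

lemma core_one: "\<one>\<^bsub>E\<^esub> \<in> core"
  using core_d[of "\<one>\<^bsub>A\<^esub>"] by (simp add: d_simps)

lemma core_range_proj: "range_proj k \<in> core"
proof (cases "k = 0")
  case True
  then show ?thesis using core_one by (simp add: range_proj_def)
next
  case False
  then have "range_proj k \<in> {pw s k \<cdot> pw (star s) k | k :: nat. k \<ge> 1}"
    unfolding range_proj_def by force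
  then show ?thesis unfolding core_def cstar_generated_def by blast
qed

lemma core_eq_closed_span: "core = closed_span E monomials"
proof
  have K: "closed_star_subalgebra E (closed_span E monomials)"
  proof (rule E.closed_span_star_subalgebra[OF monomials_closed])
    show "x \<cdot> y \<in> closed_span E monomials" if "x \<in> monomials" "y \<in> monomials" for x y
      using monomials_mult[OF that] subset_closed_span[of monomials E] by blast
    show "star x \<in> closed_span E monomials" if "x \<in> monomials" for x
      using monomials_adj[OF that] subset_closed_span[of monomials E] by blast
  qed
  have 1: "d a \<in> monomials" if "a \<in> carrier A" for a
    using monomialsI[OF that A.alg.one_closed, of 0] that by (simp add: d_simps range_proj_def)
  have 2: "pw s k \<cdot> pw (star s) k \<in> monomials" for k
    using monomialsI[OF A.alg.one_closed A.alg.one_closed, of k] by (simp add: d_simps range_proj_def)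
  have "d ` carrier A \<union> {pw s k \<cdot> pw (star s) k | k :: nat. k \<ge> 1} \<subseteq> monomials"
    using 1 2 by blast
  then show "core \<subseteq> closed_span E monomials"
    unfolding core_def using subset_closed_span[of monomials E]
    by (intro E.cstar_generated_minimal[OF _ K]) blast
  have "monomials \<subseteq> core"
    using core_d core_range_proj core_subalgebra by (auto simp: monomials_def closed_star_subalgebra_def)
  then show "closed_span E monomials \<subseteq> core"
    using core_subalgebra by (intro closed_span_minimal) (auto simp: closed_star_subalgebra_iff)
qed

lemma core_induct:
  assumes "closed_subspace E H" and "\<And>a b k. \<lbrakk>a \<in> carrier A; b \<in> carrier A\<rbrakk> \<Longrightarrow> d a \<cdot> range_proj k \<cdot> d b \<in> H"
    and "x \<in> core"
  shows "x \<in> H"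
proof -
  have "monomials \<subseteq> H" using assms(2) by (auto simp: monomials_def)
  then show ?thesis using closed_span_minimal[of monomials H E] assms(1,3) by (auto simp: core_eq_closed_span)
qed

lemma E_cstar: "unital_cstar_algebra E"
  by unfold_locales

lemma core_subspace: "closed_subspace E core"
  using core_subalgebra by (simp add: closed_star_subalgebra_iff)

lemma core_monomial: "a \<in> carrier A \<Longrightarrow> b \<in> carrier A \<Longrightarrow> d a \<cdot> range_proj k \<cdot> d b \<in> core"
  using monomialsI subset_closed_span[of monomials E] by (auto simp: core_eq_closed_span)

text \<open>Both sides are linear and continuous in \<open>x\<close>, so it suffices to compare them on monomials.\<close>

lemma init_proj_core:
  assumes "x \<in> core"
  shows "init_proj \<cdot> x = x \<cdot> init_proj"
proof -
  have "closed_subspace E {x \<in> carrier E. init_proj \<cdot> x = x \<cdot> init_proj}"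
    by (rule closed_subspace_equalizer[OF E_cstar E_cstar
          E.lipschitz_map_mult(2)[OF init_proj(1) init_proj(1)]
          E.lipschitz_map_mult(3)[OF init_proj(1) init_proj(1)]])
      (simp_all add: init_proj(1) E.alg.l_distr E.alg.r_distr E.smult_mult_left E.smult_mult_right)
  then have "x \<in> {x \<in> carrier E. init_proj \<cdot> x = x \<cdot> init_proj}"
  proof (rule core_induct[OF _ _ assms])
    fix a b k assume ab: "a \<in> carrier A" "b \<in> carrier A"
    have "init_proj \<cdot> (d a \<cdot> range_proj k \<cdot> d b) = (init_proj \<cdot> d a) \<cdot> range_proj k \<cdot> d b"
      using ab init_proj(1) by (simp add: E.alg.m_assoc)
    also have "\<dots> = d a \<cdot> (init_proj \<cdot> range_proj k) \<cdot> d b"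
      using ab init_proj(1) by (simp add: E.alg.m_assoc init_proj_d)
    also have "\<dots> = d a \<cdot> range_proj k \<cdot> (init_proj \<cdot> d b)"
      using ab init_proj(1) by (simp add: E.alg.m_assoc init_proj_range_proj)
    also have "\<dots> = d a \<cdot> range_proj k \<cdot> d b \<cdot> init_proj"
      using ab init_proj(1) by (simp add: E.alg.m_assoc init_proj_d)
    finally show "d a \<cdot> range_proj k \<cdot> d b \<in> {x \<in> carrier E. init_proj \<cdot> x = x \<cdot> init_proj}"
      using ab by simp
  qed
  then show ?thesis by simp
qed

text \<open>Checked on monomials, where \<open>d(a) e\<^sub>k d(b)\<close> goes to \<open>d(\<alpha> a) e\<^sub>k\<^sub>+\<^sub>1 d(\<alpha> b)\<close>; generators would not
  do, since multiplicativity of the conjugation is not yet available.\<close>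

lemma core_conj:
  assumes x: "x \<in> core"
  shows "s \<cdot> x \<cdot> star s \<in> core"
proof -
  have "closed_subspace E {x \<in> carrier E. s \<cdot> x \<cdot> star s \<in> core}"
    by (rule closed_subspace_vimage[OF E_cstar E_cstar E.lipschitz_map_mult(1) _ _ core_subspace, where \<sigma> = id])
      (simp_all add: E.alg.l_distr E.alg.r_distr E.smult_mult_left E.smult_mult_right)
  then have "x \<in> {x \<in> carrier E. s \<cdot> x \<cdot> star s \<in> core}"
  proof (rule core_induct[OF _ _ x])
    fix a b k assume ab: "a \<in> carrier A" "b \<in> carrier A"
    have "s \<cdot> (d a \<cdot> range_proj k \<cdot> d b) \<cdot> star s = (s \<cdot> d a) \<cdot> range_proj k \<cdot> (d b \<cdot> star s)"
      using ab by (simp add: E.alg.m_assoc)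
    also have "\<dots> = d (\<alpha> a) \<cdot> ((s \<cdot> pw s k) \<cdot> (pw (star s) k \<cdot> star s)) \<cdot> d (\<alpha> b)"
      using ab by (simp add: E.alg.m_assoc s_d d_s_star range_proj_def)
    also have "\<dots> = d (\<alpha> a) \<cdot> range_proj (Suc k) \<cdot> d (\<alpha> b)"
      unfolding range_proj_def pow_Suc_left[OF s_closed] by simp
    finally show "d a \<cdot> range_proj k \<cdot> d b \<in> {x \<in> carrier E. s \<cdot> x \<cdot> star s \<in> core}"
      using ab core_monomial[of "\<alpha> a" "\<alpha> b"] by simp
  qed
  then show ?thesis by simp
qed

text \<open>On monomials, \<open>d(a) e\<^sub>k\<^sub>+\<^sub>1 d(b)\<close> goes to \<open>d(L a) e\<^sub>k d(L b)\<close> and \<open>d(a) d(b)\<close> to \<open>d(L(a b))\<close>. The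
  conjugation is not multiplicative, so the argument really needs the closed span.\<close>

lemma core_conj_star:
  assumes x: "x \<in> core"
  shows "star s \<cdot> x \<cdot> s \<in> core"
proof -
  have "closed_subspace E {x \<in> carrier E. star s \<cdot> x \<cdot> s \<in> core}"
    by (rule closed_subspace_vimage[OF E_cstar E_cstar E.lipschitz_map_mult(1) _ _ core_subspace, where \<sigma> = id])
      (simp_all add: E.alg.l_distr E.alg.r_distr E.smult_mult_left E.smult_mult_right)
  then have "x \<in> {x \<in> carrier E. star s \<cdot> x \<cdot> s \<in> core}"
  proof (rule core_induct[OF _ _ x])
    fix a b k assume ab: "a \<in> carrier A" "b \<in> carrier A"
    have "star s \<cdot> (d a \<cdot> range_proj k \<cdot> d b) \<cdot> s \<in> core"
    proof (cases k)
      case 0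
      have "star s \<cdot> (d a \<cdot> range_proj k \<cdot> d b) \<cdot> s = d (L (a \<otimes>\<^bsub>A\<^esub> b))"
        using ab d_L[of "a \<otimes>\<^bsub>A\<^esub> b"] 0 by (simp add: range_proj_def d_simps)
      then show ?thesis using ab core_d L_closed by simp
    next
      case (Suc m)
      have "star s \<cdot> (d a \<cdot> range_proj k \<cdot> d b) \<cdot> s
          = star s \<cdot> (d a \<cdot> ((s \<cdot> pw s m) \<cdot> (pw (star s) m \<cdot> star s)) \<cdot> d b) \<cdot> s"
        unfolding Suc range_proj_def pow_Suc_left[OF s_closed] by simp
      also have "\<dots> = (star s \<cdot> d a \<cdot> s) \<cdot> range_proj m \<cdot> (star s \<cdot> d b \<cdot> s)"
        using ab by (simp add: range_proj_def E.alg.m_assoc)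
      also have "\<dots> = d (L a) \<cdot> range_proj m \<cdot> d (L b)" using ab by (simp add: d_L)
      finally show ?thesis using ab core_monomial[of "L a" "L b"] L_closed by simp
    qed
    then show "d a \<cdot> range_proj k \<cdot> d b \<in> {x \<in> carrier E. star s \<cdot> x \<cdot> s \<in> core}"
      using ab by simp
  qed
  then show ?thesis by simp
qed

section \<open>The shift endomorphism and its transfer operator\<close>

abbreviation Core :: "'e cstar" where "Core \<equiv> E\<lparr>carrier := core\<rparr>"

lemma Core_cstar: "unital_cstar_algebra Core"
  and Core_incl: "cstar_unital_hom Core E (\<lambda>x. x)"
  using E.subalgebra(1,2)[OF core_subalgebra core_one] by auto

abbreviation shift where "shift x \<equiv> s \<cdot> x \<cdot> star s"
abbreviation unshift where "unshift x \<equiv> star s \<cdot> x \<cdot> s"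

text \<open>Insert \<open>s = s (s*s)\<close> and move the central projection \<open>s*s\<close> between the factors.\<close>

lemma shift_mult:
  assumes "x \<in> core" "y \<in> core"
  shows "shift (x \<cdot> y) = shift x \<cdot> shift y"
proof -
  note c = core_closed[OF assms(1)] core_closed[OF assms(2)]
  have "shift (x \<cdot> y) = (s \<cdot> init_proj) \<cdot> (x \<cdot> y) \<cdot> star s" by (simp add: s_init_proj)
  also have "\<dots> = s \<cdot> (init_proj \<cdot> x) \<cdot> y \<cdot> star s" using c init_proj(1) by (simp add: E.alg.m_assoc)
  also have "\<dots> = s \<cdot> (x \<cdot> (star s \<cdot> s)) \<cdot> y \<cdot> star s"
    unfolding init_proj_core[OF assms(1)] by (simp add: init_proj_def)
  finally show ?thesis using c by (simp add: E.alg.m_assoc)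
qed

lemma shift_endomorphism: "cstar_endomorphism Core shift"
  unfolding cstar_endomorphism_def cstar_hom_def
  using core_closed core_conj shift_mult
  by (simp add: E.alg.l_distr E.alg.r_distr E.smult_mult_left E.smult_mult_right E.adj_mult E.alg.m_assoc)

lemma s_contractive: "cnorm E s \<le> 1"
proof -
  have "(cnorm E s)\<^sup>2 \<le> 1\<^sup>2"
    using E.cnorm_cstar[of s] E.cnorm_projection_le[OF init_proj] by (simp add: init_proj_def)
  then show ?thesis by (rule power2_le_imp_le) simp
qed

lemma cnorm_unshift: "x \<in> carrier E \<Longrightarrow> cnorm E (unshift x) \<le> cnorm E x"
  using E.cnorm_mult_le[of "star s \<cdot> x" s "1 * cnorm E x" 1] E.cnorm_mult_le[of "star s" x 1 "cnorm E x"]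
    s_contractive E.cnorm_adj[of s] by simp

lemma unshift_diff: "\<lbrakk>x \<in> carrier E; y \<in> carrier E\<rbrakk> \<Longrightarrow> unshift x \<ominus>\<^bsub>E\<^esub> unshift y = unshift (x \<ominus>\<^bsub>E\<^esub> y)"
  by (simp add: E.cstar_simps)

text \<open>Compressing \<open>\<parallel>t - x\<parallel> \<le> t\<close> by the contraction \<open>s\<close> gives \<open>\<parallel>t s*s - s* x s\<parallel> \<le> t\<close>, and \<open>s*s\<close>
  supports \<open>s* x s\<close>. All spectra are taken in the core, so the estimates are stated there.\<close>

lemma unshift_positive:
  assumes "positive_element Core x"
  shows "positive_element Core (unshift x)"
proof -
  interpret C: unital_cstar_algebra Core by (rule Core_cstar)
  have x: "x \<in> core" "star x = x" using assms by (auto simp: positive_element_def)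
  have xc: "x \<in> carrier E" using core_closed x by simp
  define t where "t = cnorm E x"
  have ipc: "init_proj \<in> core" using core_d L_closed by (simp add: init_proj_eq)
  have sm: "c \<odot>\<^bsub>E\<^esub> y \<in> core" if "y \<in> core" for c y using C.smult_in_carrier that by simp
  have "cnorm Core (of_real t \<odot>\<^bsub>Core\<^esub> \<one>\<^bsub>Core\<^esub> \<ominus>\<^bsub>Core\<^esub> x) \<le> t"
    using assms by (intro C.positive_element_cnorm) (simp_all add: t_def)
  then have "cnorm E (of_real t \<odot>\<^bsub>E\<^esub> \<one>\<^bsub>E\<^esub> \<ominus>\<^bsub>E\<^esub> x) \<le> t"
    using x sm core_one by (simp add: E.subalgebra(3)[OF core_subalgebra core_one])
  moreover have "of_real t \<odot>\<^bsub>E\<^esub> init_proj \<ominus>\<^bsub>E\<^esub> unshift x = unshift (of_real t \<odot>\<^bsub>E\<^esub> \<one>\<^bsub>E\<^esub> \<ominus>\<^bsub>E\<^esub> x)"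
    using xc by (simp add: init_proj_def E.cstar_simps)
  ultimately have "cnorm E (of_real t \<odot>\<^bsub>E\<^esub> init_proj \<ominus>\<^bsub>E\<^esub> unshift x) \<le> t"
    using cnorm_unshift[of "of_real t \<odot>\<^bsub>E\<^esub> \<one>\<^bsub>E\<^esub> \<ominus>\<^bsub>E\<^esub> x"] xc by simp
  then have t: "cnorm Core (of_real t \<odot>\<^bsub>Core\<^esub> init_proj \<ominus>\<^bsub>Core\<^esub> unshift x) \<le> t"
    using sm ipc core_conj_star[OF x(1)] by (simp add: E.subalgebra(3)[OF core_subalgebra core_one])
  have "init_proj \<cdot> unshift x = (init_proj \<cdot> star s) \<cdot> x \<cdot> s"
    using xc init_proj(1) by (simp add: E.alg.m_assoc)
  then have ux: "init_proj \<cdot> unshift x = unshift x" by (simp add: s_init_proj)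
  have us: "star (unshift x) = unshift x" using x xc by (simp add: E.adj_mult E.alg.m_assoc)
  show ?thesis
    using ipc init_proj core_conj_star[OF x(1)] t ux us
    by (intro C.positive_element_cornerI[of init_proj _ t]) simp_all
qed

lemma unshift_complete_transfer: "complete_transfer_operator Core shift unshift"
  unfolding complete_transfer_operator_def transfer_operator_def
proof (intro conjI ballI allI impI)
  interpret C: unital_cstar_algebra Core by (rule Core_cstar)
  show "unshift \<in> carrier Core \<rightarrow> carrier Core" using core_conj_star by simp
  have "lipschitz_map Core Core unshift"
  proof (rule C.lipschitz_map_bounded[where C = 1])
    show "unshift \<in> carrier Core \<rightarrow> carrier Core" using core_conj_star by simp
    fix x y assume x: "x \<in> carrier Core"
    then show "cnorm Core (unshift x) \<le> 1 * cnorm Core x" using core_closed cnorm_unshift by simp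
    assume "y \<in> carrier Core"
    then show "unshift x \<ominus>\<^bsub>Core\<^esub> unshift y = unshift (x \<ominus>\<^bsub>Core\<^esub> y)"
      using x core_closed core_conj_star unshift_diff
      by (simp add: E.subalgebra(3)[OF core_subalgebra core_one])
  qed
  then show "continuous_map (ctopology Core) (ctopology Core) unshift"
    by (rule lipschitz_map_continuous[OF Core_cstar Core_cstar])
  show "positive_element Core x \<Longrightarrow> positive_element Core (unshift x)" for x
    by (rule unshift_positive)
  fix a b assume ab: "a \<in> carrier Core" "b \<in> carrier Core"
  then have c: "a \<in> core" "a \<in> carrier E" "b \<in> carrier E" using core_closed by auto
  show "unshift (a \<oplus>\<^bsub>Core\<^esub> b) = unshift a \<oplus>\<^bsub>Core\<^esub> unshift b"
    using c by (simp add: E.alg.l_distr E.alg.r_distr)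
  have "unshift (shift a \<cdot> b) = (init_proj \<cdot> a) \<cdot> star s \<cdot> b \<cdot> s"
    using c by (simp add: E.alg.m_assoc init_proj_def)
  also have "\<dots> = a \<cdot> (init_proj \<cdot> star s) \<cdot> b \<cdot> s"
    using c init_proj(1) by (simp add: init_proj_core E.alg.m_assoc)
  also have "\<dots> = a \<cdot> unshift b" using c by (simp add: s_init_proj E.alg.m_assoc)
  finally show "unshift (shift a \<otimes>\<^bsub>Core\<^esub> b) = a \<otimes>\<^bsub>Core\<^esub> unshift b" by simp
next
  fix c x assume "x \<in> carrier Core"
  then show "unshift (c \<odot>\<^bsub>Core\<^esub> x) = c \<odot>\<^bsub>Core\<^esub> unshift x"
    using core_closed by (simp add: E.smult_mult_left E.smult_mult_right)
next
  fix a assume "a \<in> carrier Core"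
  then show "shift (unshift a) = shift \<one>\<^bsub>Core\<^esub> \<otimes>\<^bsub>Core\<^esub> a \<otimes>\<^bsub>Core\<^esub> shift \<one>\<^bsub>Core\<^esub>"
    using core_closed by (simp add: E.alg.m_assoc)
qed

lemma Core_covariant: "covariant_rep Core shift unshift E (\<lambda>x. x) s"
  using Core_incl spow_partial_isometry[of 1] E_cstar
  by (simp add: covariant_rep_def E.alg.m_assoc)

end

section \<open>Subalgebras of subalgebras and preimages\<close>

text \<open>Lets an equalizer of homomorphisms that are defined on a subalgebra only be compared with
  subalgebras generated in the ambient algebra.\<close>

lemma closed_star_subalgebra_trans:
  assumes B: "unital_cstar_algebra B" and H: "closed_star_subalgebra B H" and one: "\<one>\<^bsub>B\<^esub> \<in> H"
    and K: "closed_star_subalgebra (B\<lparr>carrier := H\<rparr>) K"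
  shows "closed_star_subalgebra B K"
proof -
  interpret B: unital_cstar_algebra B by fact
  interpret P: unital_cstar_algebra "B\<lparr>carrier := H\<rparr>" by (rule B.subalgebra(1)[OF H one])
  have Hs: "closed_subspace B H" using H by (simp add: closed_star_subalgebra_iff)
  have Ks: "closed_subspace (B\<lparr>carrier := H\<rparr>) K" using K by (simp add: closed_star_subalgebra_iff)
  note H' = B.closed_subspaceD[OF Hs] and K' = P.closed_subspaceD[OF Ks, simplified]
  have "closedin (ctopology B) K"
    unfolding B.closedin_iff_approx
  proof (intro conjI ballI impI)
    show "K \<subseteq> carrier B" using H'(1) K'(1) by blast
    fix x assume x: "x \<in> carrier B" and ap: "\<forall>e>0. \<exists>y\<in>K. cdist B x y < e"
    then have "x \<in> H" using H'(5) K'(1) unfolding B.closedin_iff_approx by blast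
    moreover have "\<forall>e>0. \<exists>y\<in>K. cdist (B\<lparr>carrier := H\<rparr>) x y < e"
      using ap \<open>x \<in> H\<close> K'(1) H'(1) B.subalgebra(3)[OF H one] x
      by (fastforce simp: cdist_def subset_iff)
    ultimately show "x \<in> K" using K'(5) unfolding P.closedin_iff_approx by simp
  qed
  then have "closed_subspace B K"
    using H'(1) K' by (intro B.closed_subspaceI) auto
  then show ?thesis using K by (simp add: closed_star_subalgebra_iff)
qed

lemma closed_star_subalgebra_vimage:
  assumes B: "unital_cstar_algebra B" and D: "unital_cstar_algebra D" and f: "cstar_unital_hom B D f"
    and K: "closed_star_subalgebra D K"
  shows "closed_star_subalgebra B {x \<in> carrier B. f x \<in> K}"
proof -
  interpret B: unital_cstar_algebra B by fact
  note f' = cstar_unital_homD[OF f]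
  have "closed_subspace B {x \<in> carrier B. f x \<in> K}"
    using K by (intro closed_subspace_vimage[OF B D lipschitz_map_hom[OF B D f], where \<sigma> = id])
      (simp_all add: f' closed_star_subalgebra_iff)
  then show ?thesis using K by (auto simp: closed_star_subalgebra_iff f')
qed

section \<open>Quotient maps\<close>

lemma quotient_hom_unital:
  assumes T: "unital_cstar_algebra T" and Q: "cstar_quotient T I E q"
  shows "cstar_unital_hom T E q"
proof -
  interpret T: unital_cstar_algebra T by fact
  have q: "cstar_hom T E q" "q ` carrier T = carrier E" "unital_cstar_algebra E"
    using Q by (auto simp: cstar_quotient_def)
  interpret E: unital_cstar_algebra E by (rule q(3))
  have "\<one>\<^bsub>E\<^esub> \<in> q ` carrier T" unfolding q(2) by simp
  then obtain x where x: "x \<in> carrier T" "q x = \<one>\<^bsub>E\<^esub>" by auto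
  have c: "q \<one>\<^bsub>T\<^esub> \<in> carrier E" using q(2) by auto
  have "q (\<one>\<^bsub>T\<^esub> \<otimes>\<^bsub>T\<^esub> x) = q \<one>\<^bsub>T\<^esub> \<otimes>\<^bsub>E\<^esub> q x" using q(1) x(1) T.alg.one_closed unfolding cstar_hom_def by blast
  then have "q \<one>\<^bsub>T\<^esub> = \<one>\<^bsub>E\<^esub>" using x c by simp
  then show ?thesis using q(1) by (simp add: cstar_unital_hom_def)
qed

lemma quotient_hom_factor:
  assumes T: "unital_cstar_algebra T" and E: "unital_cstar_algebra E" and F: "unital_cstar_algebra F"
    and q: "cstar_unital_hom T E q" "q ` carrier T = carrier E" and f: "cstar_unital_hom T F f"
    and ker: "\<And>x. x \<in> carrier T \<Longrightarrow> q x = \<zero>\<^bsub>E\<^esub> \<Longrightarrow> f x = \<zero>\<^bsub>F\<^esub>"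
  obtains g where "cstar_unital_hom E F g" "\<And>x. x \<in> carrier T \<Longrightarrow> g (q x) = f x"
proof -
  interpret T: unital_cstar_algebra T by fact
  interpret E: unital_cstar_algebra E by fact
  interpret F: unital_cstar_algebra F by fact
  note q' = cstar_unital_homD[OF q(1)] and f' = cstar_unital_homD[OF f]
  define g where "g y = f (inv_into (carrier T) q y)" for y
  have gq: "g (q x) = f x" if x: "x \<in> carrier T" for x
  proof -
    define y where "y = inv_into (carrier T) q (q x)"
    have y: "y \<in> carrier T" "q y = q x"
      using x by (auto simp: y_def inv_into_into f_inv_into_f)
    then have "q (y \<ominus>\<^bsub>T\<^esub> x) = \<zero>\<^bsub>E\<^esub>"
      using x q'(1) E.diff_eq_zero_iff[of "q x" "q x"] by (simp add: cstar_unital_hom_diff[OF T E q(1)])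
    then have "f y \<ominus>\<^bsub>F\<^esub> f x = \<zero>\<^bsub>F\<^esub>"
      using ker[of "y \<ominus>\<^bsub>T\<^esub> x"] x y by (simp add: cstar_unital_hom_diff[OF T F f])
    then show ?thesis using F.diff_eq_zero_iff[of "f y" "f x"] f'(1) x y by (simp add: g_def y_def)
  qed
  have surj: "\<exists>x\<in>carrier T. y = q x" if "y \<in> carrier E" for y using q(2) that by auto
  have "cstar_unital_hom E F g"
    unfolding cstar_unital_hom_def cstar_hom_def
  proof (intro conjI ballI allI funcsetI)
    show "g \<one>\<^bsub>E\<^esub> = \<one>\<^bsub>F\<^esub>" using gq[of "\<one>\<^bsub>T\<^esub>"] q' f' by simp
    fix x y c assume "x \<in> carrier E"
    then obtain a where a: "a \<in> carrier T" "x = q a" using surj by blast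
    show "g x \<in> carrier F" using a gq f' by simp
    show "g (c \<odot>\<^bsub>E\<^esub> x) = c \<odot>\<^bsub>F\<^esub> g x" using a gq[of "c \<odot>\<^bsub>T\<^esub> a"] gq[of a] q' f' by simp
    show "g (x\<^sup>\<star>\<^bsub>E\<^esub>) = (g x)\<^sup>\<star>\<^bsub>F\<^esub>" using a gq[of "a\<^sup>\<star>\<^bsub>T\<^esub>"] gq[of a] q' f' by simp
    assume "y \<in> carrier E"
    then obtain b where b: "b \<in> carrier T" "y = q b" using surj by blast
    show "g (x \<oplus>\<^bsub>E\<^esub> y) = g x \<oplus>\<^bsub>F\<^esub> g y" using a b gq[of "a \<oplus>\<^bsub>T\<^esub> b"] gq[of a] gq[of b] q' f' by simp
    show "g (x \<otimes>\<^bsub>E\<^esub> y) = g x \<otimes>\<^bsub>F\<^esub> g y" using a b gq[of "a \<otimes>\<^bsub>T\<^esub> b"] gq[of a] gq[of b] q' f' by simp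
  qed
  then show thesis using that gq by blast
qed

section \<open>Covariant and Toeplitz representations\<close>

context toeplitz_representation
begin

lemma range_proj_Suc: "range_proj (Suc k) = shift (range_proj k)"
  unfolding range_proj_def pow_Suc_left[OF s_closed] by (simp add: E.alg.m_assoc)

text \<open>The projections \<open>e\<^sub>k\<close> arise from the unit by iterating the shift, so homomorphisms that turn the
  shift into conjugation by the same \<open>u\<close> agree on them by induction on \<open>k\<close>.\<close>

lemma core_homs_agree:
  assumes D: "unital_cstar_algebra D" and f: "cstar_unital_hom Core D f" and g: "cstar_unital_hom Core D g"
    and d: "\<And>a. a \<in> carrier A \<Longrightarrow> f (d a) = g (d a)"
    and sf: "\<And>x. x \<in> core \<Longrightarrow> f (shift x) = u \<otimes>\<^bsub>D\<^esub> f x \<otimes>\<^bsub>D\<^esub> u\<^sup>\<star>\<^bsub>D\<^esub>"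
    and sg: "\<And>x. x \<in> core \<Longrightarrow> g (shift x) = u \<otimes>\<^bsub>D\<^esub> g x \<otimes>\<^bsub>D\<^esub> u\<^sup>\<star>\<^bsub>D\<^esub>"
    and x: "x \<in> core"
  shows "f x = g x"
proof -
  have r: "f (range_proj k) = g (range_proj k)" for k
  proof (induction k)
    case 0
    then show ?case using d[of "\<one>\<^bsub>A\<^esub>"] by (simp add: range_proj_def d_simps)
  next
    case (Suc k)
    then show ?case by (simp add: range_proj_Suc sf sg core_range_proj)
  qed
  let ?K = "{x \<in> core. f x = g x}"
  have "closed_star_subalgebra Core ?K"
    using closed_star_subalgebra_hom_equalizer[OF Core_cstar D f g] by simp
  then have "closed_star_subalgebra E ?K"
    by (rule closed_star_subalgebra_trans[OF E_cstar core_subalgebra core_one])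
  moreover have "d ` carrier A \<union> {pw s k \<cdot> pw (star s) k | k :: nat. k \<ge> 1} \<subseteq> ?K"
    using d core_d r core_range_proj unfolding range_proj_def by blast
  ultimately have "core \<subseteq> ?K" unfolding core_def by (intro E.cstar_generated_minimal)
  then show ?thesis using x by blast
qed

text \<open>The commutation relation follows from \<open>U = U (U*U)\<close>, where \<open>U*U\<close> is the image of the central
  projection \<open>s*s\<close> and can be moved past \<open>j (d a)\<close>.\<close>

lemma covariant_toeplitz_rep:
  assumes "covariant_rep Core shift unshift F j U"
  shows "toeplitz_rep A \<alpha> L F (\<lambda>a. j (d a)) U"
proof -
  have F: "unital_cstar_algebra F" and j: "cstar_unital_hom Core F j" and U: "U \<in> carrier F"
    and pi: "U \<otimes>\<^bsub>F\<^esub> U\<^sup>\<star>\<^bsub>F\<^esub> \<otimes>\<^bsub>F\<^esub> U = U"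
    and sh: "\<And>x. x \<in> core \<Longrightarrow> j (shift x) = U \<otimes>\<^bsub>F\<^esub> j x \<otimes>\<^bsub>F\<^esub> U\<^sup>\<star>\<^bsub>F\<^esub>"
    and un: "\<And>x. x \<in> core \<Longrightarrow> j (unshift x) = U\<^sup>\<star>\<^bsub>F\<^esub> \<otimes>\<^bsub>F\<^esub> j x \<otimes>\<^bsub>F\<^esub> U"
    using assms by (auto simp: covariant_rep_def)
  interpret F: unital_cstar_algebra F by (rule F)
  note j' = cstar_unital_homD[OF j, simplified]
  have jd: "j (d a) \<in> carrier F" if "a \<in> carrier A" for a using j'(1) core_d that by simp
  have hom: "cstar_unital_hom A F (\<lambda>a. j (d a))"
    using j' d_simps core_d by (simp add: cstar_unital_hom_def cstar_hom_def)
  have ip: "init_proj \<in> core" using core_d L_closed by (simp add: init_proj_eq)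
  have jip: "j init_proj = U\<^sup>\<star>\<^bsub>F\<^esub> \<otimes>\<^bsub>F\<^esub> U"
    using un[OF core_one] U j'(6) by (simp add: init_proj_def)
  show ?thesis
    unfolding toeplitz_rep_def
  proof (intro conjI ballI F hom U)
    fix a assume a: "a \<in> carrier A"
    show "U\<^sup>\<star>\<^bsub>F\<^esub> \<otimes>\<^bsub>F\<^esub> j (d a) \<otimes>\<^bsub>F\<^esub> U = j (d (L a))"
      using un[OF core_d[OF a]] a by (simp add: d_L)
    have "U \<otimes>\<^bsub>F\<^esub> j (d a) = U \<otimes>\<^bsub>F\<^esub> U\<^sup>\<star>\<^bsub>F\<^esub> \<otimes>\<^bsub>F\<^esub> U \<otimes>\<^bsub>F\<^esub> j (d a)" by (simp only: pi)
    also have "\<dots> = U \<otimes>\<^bsub>F\<^esub> j (init_proj \<cdot> d a)"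
      using U jd[OF a] ip core_d[OF a] by (simp add: j' jip F.alg.m_assoc)
    also have "\<dots> = U \<otimes>\<^bsub>F\<^esub> (j (d a) \<otimes>\<^bsub>F\<^esub> (U\<^sup>\<star>\<^bsub>F\<^esub> \<otimes>\<^bsub>F\<^esub> U))"
      using ip core_d[OF a] a by (simp add: j' jip init_proj_d)
    also have "\<dots> = j (shift (d a)) \<otimes>\<^bsub>F\<^esub> U"
      using U jd[OF a] core_d[OF a] by (simp add: sh F.alg.m_assoc)
    also have "shift (d a) = d (\<alpha> a) \<cdot> shift \<one>\<^bsub>E\<^esub>"
      using a by (simp add: s_d E.alg.m_assoc)
    also have "j (d (\<alpha> a) \<cdot> shift \<one>\<^bsub>E\<^esub>) = j (d (\<alpha> a)) \<otimes>\<^bsub>F\<^esub> (U \<otimes>\<^bsub>F\<^esub> U\<^sup>\<star>\<^bsub>F\<^esub>)"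
      using a core_d[of "\<alpha> a"] core_conj[OF core_one] sh[OF core_one] U by (simp add: j'(3,6))
    also have "\<dots> \<otimes>\<^bsub>F\<^esub> U = j (d (\<alpha> a)) \<otimes>\<^bsub>F\<^esub> (U \<otimes>\<^bsub>F\<^esub> U\<^sup>\<star>\<^bsub>F\<^esub> \<otimes>\<^bsub>F\<^esub> U)"
      using U jd[of "\<alpha> a"] a by (simp add: F.alg.m_assoc)
    finally show "U \<otimes>\<^bsub>F\<^esub> j (d a) = j (d (\<alpha> a)) \<otimes>\<^bsub>F\<^esub> U" by (simp only: pi)
  qed
qed

end

lemma toeplitz_rep_hom:
  assumes T: "toeplitz_rep A \<alpha> L T \<iota> S" and L: "L \<in> carrier A \<rightarrow> carrier A" and \<alpha>: "cstar_endomorphism A \<alpha>"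
    and E: "unital_cstar_algebra E" and q: "cstar_unital_hom T E q"
  shows "toeplitz_rep A \<alpha> L E (\<lambda>a. q (\<iota> a)) (q S)"
proof -
  note q' = cstar_unital_homD[OF q]
  have T': "unital_cstar_algebra T" "cstar_unital_hom A T \<iota>" "S \<in> carrier T"
    "\<And>a. a \<in> carrier A \<Longrightarrow> S \<otimes>\<^bsub>T\<^esub> \<iota> a = \<iota> (\<alpha> a) \<otimes>\<^bsub>T\<^esub> S"
    "\<And>a. a \<in> carrier A \<Longrightarrow> S\<^sup>\<star>\<^bsub>T\<^esub> \<otimes>\<^bsub>T\<^esub> \<iota> a \<otimes>\<^bsub>T\<^esub> S = \<iota> (L a)"
    using T by (auto simp: toeplitz_rep_def)
  interpret T: unital_cstar_algebra T by (rule T')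
  have i: "\<iota> a \<in> carrier T" if "a \<in> carrier A" for a using cstar_unital_homD(1)[OF T'(2) that] .
  have \<alpha>c: "\<alpha> a \<in> carrier A" if "a \<in> carrier A" for a
    using \<alpha> that by (auto simp: cstar_endomorphism_def cstar_hom_def)
  show ?thesis
    unfolding toeplitz_rep_def
  proof (intro conjI ballI E cstar_unital_hom_comp[OF T'(2) q])
    show "q S \<in> carrier E" using q' T' by simp
    fix a assume a: "a \<in> carrier A"
    show "q S \<otimes>\<^bsub>E\<^esub> q (\<iota> a) = q (\<iota> (\<alpha> a)) \<otimes>\<^bsub>E\<^esub> q S"
      using a T'(3,4) i \<alpha>c by (simp flip: q'(3))
    show "(q S)\<^sup>\<star>\<^bsub>E\<^esub> \<otimes>\<^bsub>E\<^esub> q (\<iota> a) \<otimes>\<^bsub>E\<^esub> q S = q (\<iota> (L a))"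
      using a T'(3,5) i by (simp flip: q'(3,5))
  qed
qed

section \<open>Exel's crossed product as a crossed product of the core\<close>

locale exel_quotient = A: unital_cstar_algebra A for A :: "'a cstar" +
  fixes \<alpha> L :: "'a \<Rightarrow> 'a" and T :: "'t cstar" and \<iota> :: "'a \<Rightarrow> 't" and S :: 't
    and E :: "'e cstar" and q :: "'t \<Rightarrow> 'e"
  assumes endo: "cstar_endomorphism A \<alpha>" and transfer: "transfer_operator A \<alpha> L"
    and L_proj: "n \<ge> 1 \<Longrightarrow> projection A ((L ^^ n) \<one>\<^bsub>A\<^esub>)"
    and exel: "exel_crossed_product A \<alpha> L T \<iota> S E q"
begin

lemma A_cstar: "unital_cstar_algebra A"
  by unfold_locales

lemma L_funcset: "L \<in> carrier A \<rightarrow> carrier A"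
  using transfer by (simp add: transfer_operator_def)

lemma toeplitz: "toeplitz_algebra A \<alpha> L T \<iota> S" "toeplitz_rep A \<alpha> L T \<iota> S"
  and T_cstar: "unital_cstar_algebra T" and E_cstar: "unital_cstar_algebra E"
  and S_closed: "S \<in> carrier T" and \<iota>_hom: "cstar_unital_hom A T \<iota>"
  and q_surj: "q ` carrier T = carrier E"
  and q_ker: "{x \<in> carrier T. q x = \<zero>\<^bsub>E\<^esub>} = closed_ideal T {\<iota> a \<ominus>\<^bsub>T\<^esub> k | a k. redundancy A \<alpha> T \<iota> S a k}"
  and T_generated: "cstar_generated T (insert S (\<iota> ` carrier A)) = carrier T"
  using exel by (auto simp: exel_crossed_product_def toeplitz_algebra_def toeplitz_rep_def cstar_quotient_def)

lemma q_hom: "cstar_unital_hom T E q"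
  using exel T_cstar by (intro quotient_hom_unital) (auto simp: exel_crossed_product_def)

sublocale R: toeplitz_representation A E \<alpha> L "\<lambda>a. q (\<iota> a)" "q S"
proof (intro toeplitz_representation.intro toeplitz_representation_axioms.intro A_cstar E_cstar endo)
  show "a \<in> carrier A \<Longrightarrow> L a \<in> carrier A" for a using L_funcset by auto
  show "a \<in> carrier A \<Longrightarrow> b \<in> carrier A \<Longrightarrow> L (\<alpha> a \<otimes>\<^bsub>A\<^esub> b) = a \<otimes>\<^bsub>A\<^esub> L b" for a b
    using transfer by (simp add: transfer_operator_def)
  show "n \<ge> 1 \<Longrightarrow> projection A ((L ^^ n) \<one>\<^bsub>A\<^esub>)" for n by (rule L_proj)
  show "toeplitz_rep A \<alpha> L E (\<lambda>a. q (\<iota> a)) (q S)"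
    by (rule toeplitz_rep_hom[OF toeplitz(2) L_funcset endo E_cstar q_hom])
qed

text \<open>This is where the redundancies enter. The maps \<open>j \<circ> q\<close> and the Toeplitz map \<open>\<phi>\<close> are compared on
  the preimage \<open>P\<close> of the core, a C*-algebra on which both are unital homomorphisms; they agree at \<open>\<iota> a\<close>
  and \<open>S S*\<close>, hence on the closed span that contains the second entries of redundancies.\<close>

lemma covariant_rep_factors:
  assumes cov: "covariant_rep R.Core R.shift R.unshift F j U"
  obtains \<psi> where "cstar_unital_hom E F \<psi>" "\<And>a. a \<in> carrier A \<Longrightarrow> \<psi> (q (\<iota> a)) = j (q (\<iota> a))" "\<psi> (q S) = U"
proof -
  have F: "unital_cstar_algebra F" and j: "cstar_unital_hom R.Core F j" and U: "U \<in> carrier F"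
    and sh: "\<And>x. x \<in> R.core \<Longrightarrow> j (R.shift x) = U \<otimes>\<^bsub>F\<^esub> j x \<otimes>\<^bsub>F\<^esub> U\<^sup>\<star>\<^bsub>F\<^esub>"
    using cov by (auto simp: covariant_rep_def)
  interpret T: unital_cstar_algebra T by (rule T_cstar)
  interpret F: unital_cstar_algebra F by (rule F)
  note q' = cstar_unital_homD[OF q_hom] and i' = cstar_unital_homD[OF \<iota>_hom]
  obtain \<phi> where \<phi>: "cstar_unital_hom T F \<phi>" "\<And>a. a \<in> carrier A \<Longrightarrow> \<phi> (\<iota> a) = j (q (\<iota> a))" "\<phi> S = U"
    using toeplitz_algebra_universal[OF A_cstar endo L_funcset toeplitz(1) R.covariant_toeplitz_rep[OF cov]]
    by blast
  note \<phi>' = cstar_unital_homD[OF \<phi>(1)]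
  define P where "P = {x \<in> carrier T. q x \<in> R.core}"
  have P: "closed_star_subalgebra T P" "\<one>\<^bsub>T\<^esub> \<in> P"
    using closed_star_subalgebra_vimage[OF T_cstar E_cstar q_hom R.core_subalgebra] q'(6) R.core_one
    by (auto simp: P_def)
  have P_hom: "cstar_unital_hom (T\<lparr>carrier := P\<rparr>) F (\<lambda>x. j (q x))" "cstar_unital_hom (T\<lparr>carrier := P\<rparr>) F \<phi>"
    using cstar_unital_homD[OF j] q' \<phi>' by (auto simp: cstar_unital_hom_def cstar_hom_def P_def)
  define K where "K = {x \<in> P. \<phi> x = j (q x)}"
  have "closed_star_subalgebra (T\<lparr>carrier := P\<rparr>) K"
    using closed_star_subalgebra_hom_equalizer[OF T.subalgebra(1)[OF P] F P_hom(2,1)] by (simp add: K_def)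
  then have K: "closed_star_subalgebra T K"
    by (rule closed_star_subalgebra_trans[OF T_cstar P])
  have "\<iota> a \<in> K" if "a \<in> carrier A" for a
    using that i'(1) R.core_d \<phi>(2) by (simp add: K_def P_def)
  moreover have "S \<otimes>\<^bsub>T\<^esub> S\<^sup>\<star>\<^bsub>T\<^esub> \<in> K"
  proof -
    have "q (S \<otimes>\<^bsub>T\<^esub> S\<^sup>\<star>\<^bsub>T\<^esub>) = R.shift \<one>\<^bsub>E\<^esub>" using S_closed q' by simp
    then show ?thesis
      using S_closed R.core_conj[OF R.core_one] sh[OF R.core_one] U \<phi>(3) cstar_unital_homD(6)[OF j]
      by (simp add: K_def P_def \<phi>')
  qed
  ultimately have "\<iota> x \<otimes>\<^bsub>T\<^esub> (S \<otimes>\<^bsub>T\<^esub> S\<^sup>\<star>\<^bsub>T\<^esub>) \<otimes>\<^bsub>T\<^esub> \<iota> y \<in> K"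
    if "x \<in> carrier A" "y \<in> carrier A" for x y
    using K that by (simp add: closed_star_subalgebra_iff)
  then have "{\<iota> x \<otimes>\<^bsub>T\<^esub> S \<otimes>\<^bsub>T\<^esub> S\<^sup>\<star>\<^bsub>T\<^esub> \<otimes>\<^bsub>T\<^esub> \<iota> y | x y. x \<in> carrier A \<and> y \<in> carrier A} \<subseteq> K"
    using S_closed i'(1) by (auto simp: T.alg.m_assoc)
  then have span: "closed_span T {\<iota> x \<otimes>\<^bsub>T\<^esub> S \<otimes>\<^bsub>T\<^esub> S\<^sup>\<star>\<^bsub>T\<^esub> \<otimes>\<^bsub>T\<^esub> \<iota> y | x y. x \<in> carrier A \<and> y \<in> carrier A} \<subseteq> K"
    using K by (intro closed_span_minimal) (auto simp: closed_star_subalgebra_iff)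
  have "\<iota> a \<ominus>\<^bsub>T\<^esub> k \<in> carrier T \<and> \<phi> (\<iota> a \<ominus>\<^bsub>T\<^esub> k) = \<zero>\<^bsub>F\<^esub>" if red: "redundancy A \<alpha> T \<iota> S a k" for a k
  proof -
    have aA: "closed_span A {x \<otimes>\<^bsub>A\<^esub> \<alpha> y \<otimes>\<^bsub>A\<^esub> z | x y z. x \<in> carrier A \<and> y \<in> carrier A \<and> z \<in> carrier A} \<subseteq> carrier A"
      by (rule A.closed_subspaceD(1)[OF A.closed_subspace_closed_span]) (auto simp: R.\<alpha>_closed)
    have a: "a \<in> carrier A" using red aA by (auto simp: redundancy_def)
    have k: "k \<in> K" using red span by (auto simp: redundancy_def)
    then have kT: "k \<in> carrier T" "\<phi> k = j (q k)" by (auto simp: K_def P_def)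
    have "\<iota> a \<ominus>\<^bsub>T\<^esub> k \<in> closed_ideal T {\<iota> a \<ominus>\<^bsub>T\<^esub> k | a k. redundancy A \<alpha> T \<iota> S a k}"
      using red by (auto simp: closed_ideal_def)
    then have "q (\<iota> a \<ominus>\<^bsub>T\<^esub> k) = \<zero>\<^bsub>E\<^esub>" using q_ker by blast
    then have "q (\<iota> a) = q k"
      using R.E.diff_eq_zero_iff[of "q (\<iota> a)" "q k"] a kT i' q' by (simp add: cstar_unital_hom_diff[OF T_cstar E_cstar q_hom])
    then have "\<phi> (\<iota> a) = \<phi> k" using kT \<phi>(2)[OF a] by simp
    then show ?thesis
      using F.diff_eq_zero_iff[of "\<phi> k" "\<phi> k"] a kT(1) i'(1) \<phi>'(1)
      by (simp add: cstar_unital_hom_diff[OF T_cstar F \<phi>(1)])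
  qed
  then have "closed_ideal T {\<iota> a \<ominus>\<^bsub>T\<^esub> k | a k. redundancy A \<alpha> T \<iota> S a k} \<subseteq> {x \<in> carrier T. \<phi> x = \<zero>\<^bsub>F\<^esub>}"
    by (intro closed_ideal_le_kernel[OF T_cstar F \<phi>(1)]) auto
  then have ker: "\<phi> x = \<zero>\<^bsub>F\<^esub>" if "x \<in> carrier T" "q x = \<zero>\<^bsub>E\<^esub>" for x
    using that q_ker by blast
  obtain \<psi> where \<psi>: "cstar_unital_hom E F \<psi>" "\<And>x. x \<in> carrier T \<Longrightarrow> \<psi> (q x) = \<phi> x"
    using quotient_hom_factor[OF T_cstar E_cstar F q_hom q_surj \<phi>(1) ker] by blast
  show thesis
    by (rule that[OF \<psi>(1)]) (use \<psi>(2) \<phi> S_closed i'(1) in simp_all)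
qed

text \<open>A possibly nonunital \<open>f\<close> is unital because the unit of \<open>F\<close> is the image of the unit of \<open>A\<close>. Then
  \<open>f \<circ> j\<close> and the inclusion of the core both turn the shift into conjugation by \<open>s\<close>.\<close>

lemma hom_determined_on_core:
  assumes F: "crossed_product R.Core R.shift R.unshift F j U"
    and f: "cstar_hom F E f" "f U = q S" "\<And>a. a \<in> carrier A \<Longrightarrow> f (j (q (\<iota> a))) = q (\<iota> a)"
  shows "cstar_unital_hom F E f" and "b \<in> R.core \<Longrightarrow> f (j b) = b"
proof -
  have cov: "unital_cstar_algebra F" "cstar_unital_hom R.Core F j" "U \<in> carrier F"
    and sh: "\<And>x. x \<in> R.core \<Longrightarrow> j (R.shift x) = U \<otimes>\<^bsub>F\<^esub> j x \<otimes>\<^bsub>F\<^esub> U\<^sup>\<star>\<^bsub>F\<^esub>"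
    using F by (auto simp: crossed_product_def covariant_rep_def)
  interpret F: unital_cstar_algebra F by (rule cov)
  note j' = cstar_unital_homD[OF cov(2), simplified]
  have "f \<one>\<^bsub>F\<^esub> = \<one>\<^bsub>E\<^esub>"
    using f(3)[of "\<one>\<^bsub>A\<^esub>"] j'(6) R.d_simps(6) by simp
  then show f_hom: "cstar_unital_hom F E f" using f(1) by (simp add: cstar_unital_hom_def)
  note f' = cstar_unital_homD[OF f_hom]
  show "f (j b) = b" if b: "b \<in> R.core"
  proof (rule R.core_homs_agree[OF E_cstar cstar_unital_hom_comp[OF cov(2) f_hom] R.Core_incl _ _ _ b, where u = "q S"])
    fix x assume "x \<in> R.core"
    then show "f (j (R.shift x)) = R.shift (f (j x))"
      using j'(1) cov(3) by (simp add: sh f' f(2))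
  qed (simp_all add: f(3))
qed

text \<open>The map \<open>\<psi> : E \<rightarrow> F\<close> of \<open>covariant_rep_factors\<close> is a two-sided inverse of \<open>\<gamma>\<close>: both
  compositions fix generators, where the core part of \<open>F\<close> is handled by \<open>core_homs_agree\<close>.\<close>

theorem crossed_product_iso:
  assumes F: "crossed_product R.Core R.shift R.unshift F j U"
  shows "\<exists>\<gamma>. cstar_iso F E \<gamma> \<and> \<gamma> U = q S \<and> (\<forall>a\<in>carrier A. \<gamma> (j (q (\<iota> a))) = q (\<iota> a)) \<and>
        (\<forall>\<gamma>'. cstar_hom F E \<gamma>' \<and> \<gamma>' U = q S \<and> (\<forall>a\<in>carrier A. \<gamma>' (j (q (\<iota> a))) = q (\<iota> a)) \<longrightarrow>
          (\<forall>x\<in>carrier F. \<gamma>' x = \<gamma> x))"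
proof -
  have cov: "covariant_rep R.Core R.shift R.unshift F j U"
    and gen: "cstar_generated F (insert U (j ` R.core)) = carrier F"
    using F by (auto simp: crossed_product_def)
  have Fc: "unital_cstar_algebra F" "cstar_unital_hom R.Core F j" "U \<in> carrier F"
    and sh: "\<And>x. x \<in> R.core \<Longrightarrow> j (R.shift x) = U \<otimes>\<^bsub>F\<^esub> j x \<otimes>\<^bsub>F\<^esub> U\<^sup>\<star>\<^bsub>F\<^esub>"
    using cov by (auto simp: covariant_rep_def)
  interpret F: unital_cstar_algebra F by (rule Fc)
  interpret T: unital_cstar_algebra T by (rule T_cstar)
  have jF: "b \<in> R.core \<Longrightarrow> j b \<in> carrier F" for b using cstar_unital_homD(1)[OF Fc(2)] by simp
  obtain \<gamma> where \<gamma>: "cstar_unital_hom F E \<gamma>" "\<And>b. b \<in> R.core \<Longrightarrow> \<gamma> (j b) = b" "\<gamma> U = q S"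
    using crossed_product_universal[OF R.Core_cstar R.shift_endomorphism F R.Core_covariant] by auto
  obtain \<psi> where \<psi>: "cstar_unital_hom E F \<psi>" "\<And>a. a \<in> carrier A \<Longrightarrow> \<psi> (q (\<iota> a)) = j (q (\<iota> a))" "\<psi> (q S) = U"
    using covariant_rep_factors[OF cov] by blast
  note \<psi>' = cstar_unital_homD[OF \<psi>(1)]
  have qS: "q S \<in> carrier E" by simp
  have \<psi>core: "\<psi> b = j b" if b: "b \<in> R.core" for b
  proof (rule R.core_homs_agree[OF Fc(1) cstar_unital_hom_comp[OF R.Core_incl \<psi>(1)] Fc(2) _ _ sh b])
    show "\<psi> (R.shift x) = U \<otimes>\<^bsub>F\<^esub> \<psi> x \<otimes>\<^bsub>F\<^esub> U\<^sup>\<star>\<^bsub>F\<^esub>" if "x \<in> R.core" for x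
      using R.core_closed[OF that] qS by (simp add: \<psi>' \<psi>(3))
  qed (use \<psi>(2) in simp_all)
  have id_hom: "cstar_unital_hom C C (\<lambda>x. x)" for C :: "'x cstar"
    by (simp add: cstar_unital_hom_def cstar_hom_def)
  have \<psi>\<gamma>: "\<psi> (\<gamma> x) = x" if x: "x \<in> carrier F" for x
  proof (rule homs_agree_on_generated[OF Fc(1) Fc(1) cstar_unital_hom_comp[OF \<gamma>(1) \<psi>(1)] id_hom])
    show "x \<in> cstar_generated F (insert U (j ` R.core))" using gen x by simp
    show "y \<in> carrier F \<and> \<psi> (\<gamma> y) = y" if "y \<in> insert U (j ` R.core)" for y
      using that \<gamma> \<psi>(3) \<psi>core Fc(3) jF by auto
  qed
  have \<gamma>\<psi>: "\<gamma> (\<psi> (q x)) = q x" if x: "x \<in> carrier T" for x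
  proof (rule homs_agree_on_generated[OF T_cstar E_cstar
        cstar_unital_hom_comp[OF q_hom cstar_unital_hom_comp[OF \<psi>(1) \<gamma>(1)]] q_hom])
    show "x \<in> cstar_generated T (insert S (\<iota> ` carrier A))" using T_generated x by simp
    show "y \<in> carrier T \<and> \<gamma> (\<psi> (q y)) = q y" if "y \<in> insert S (\<iota> ` carrier A)" for y
      using that \<gamma> \<psi>(2,3) S_closed cstar_unital_homD(1)[OF \<iota>_hom] R.core_d by auto
  qed
  have "bij_betw \<gamma> (carrier F) (carrier E)"
  proof (rule bij_betw_byWitness[where f' = \<psi>])
    show "\<forall>y\<in>carrier E. \<gamma> (\<psi> y) = y" using \<gamma>\<psi> unfolding q_surj[symmetric] by blast
  qed (use \<psi>\<gamma> \<psi>'(1) cstar_unital_homD(1)[OF \<gamma>(1)] in auto)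
  then have iso: "cstar_iso F E \<gamma>" using \<gamma>(1) by (simp add: cstar_iso_def cstar_unital_hom_def)
  have uniq: "\<gamma>' x = \<gamma> x"
    if g: "cstar_hom F E \<gamma>'" "\<gamma>' U = q S" "\<forall>a\<in>carrier A. \<gamma>' (j (q (\<iota> a))) = q (\<iota> a)" and x: "x \<in> carrier F" for \<gamma>' x
  proof -
    note u = hom_determined_on_core[OF F g(1,2) g(3)[rule_format]]
    show ?thesis
    proof (rule homs_agree_on_generated[OF Fc(1) E_cstar u(1) \<gamma>(1)])
      show "x \<in> cstar_generated F (insert U (j ` R.core))" using gen x by simp
      show "y \<in> carrier F \<and> \<gamma>' y = \<gamma> y" if "y \<in> insert U (j ` R.core)" for y
        using that \<gamma> u(2) g(2) Fc(3) jF by auto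
    qed
  qed
  show ?thesis
    using iso \<gamma>(2,3) R.core_d uniq by (intro exI[of _ \<gamma>]) auto
qed

end

theorem theorem4p17:
  fixes A :: "'a cstar" and \<alpha> L :: "'a \<Rightarrow> 'a"
    and T :: "'t cstar" and \<iota> :: "'a \<Rightarrow> 't" and S :: 't
    and E :: "'e cstar" and q :: "'t \<Rightarrow> 'e"
    and dotA :: "'a \<Rightarrow> 'e" and dotS :: 'e
    and \<A> :: "'e cstar" and \<delta> \<delta>s :: "'e \<Rightarrow> 'e"
    and F :: "'f cstar" and j :: "'e \<Rightarrow> 'f" and U :: 'f
  assumes A: "unital_cstar_algebra A"
    and \<alpha>: "cstar_endomorphism A \<alpha>"
    and L: "transfer_operator A \<alpha> L"
    and proj: "\<And>n. n \<ge> 1 \<Longrightarrow> projection A ((L ^^ n) \<one>\<^bsub>A\<^esub>)"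
    and E: "exel_crossed_product A \<alpha> L T \<iota> S E q"
    and dotA: "dotA = (\<lambda>a. q (\<iota> a))"
    and dotS: "dotS = q S"
    and \<A>: "\<A> = E\<lparr>carrier := cstar_generated E (dotA ` carrier A \<union>
               {dotS [^]\<^bsub>E\<^esub> k \<otimes>\<^bsub>E\<^esub> (dotS\<^sup>\<star>\<^bsub>E\<^esub>) [^]\<^bsub>E\<^esub> k | k :: nat. k \<ge> 1})\<rparr>"
    and \<delta>: "\<delta> = (\<lambda>x. dotS \<otimes>\<^bsub>E\<^esub> x \<otimes>\<^bsub>E\<^esub> dotS\<^sup>\<star>\<^bsub>E\<^esub>)"
    and \<delta>s: "\<delta>s = (\<lambda>x. dotS\<^sup>\<star>\<^bsub>E\<^esub> \<otimes>\<^bsub>E\<^esub> x \<otimes>\<^bsub>E\<^esub> dotS)"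
  shows "unital_cstar_algebra \<A> \<and> cstar_endomorphism \<A> \<delta> \<and>
    complete_transfer_operator \<A> \<delta> \<delta>s \<and>
    (crossed_product \<A> \<delta> \<delta>s F j U \<longrightarrow>
      (\<exists>\<gamma>. cstar_iso F E \<gamma> \<and> \<gamma> U = dotS \<and> (\<forall>a\<in>carrier A. \<gamma> (j (dotA a)) = dotA a) \<and>
        (\<forall>\<gamma>'. cstar_hom F E \<gamma>' \<and> \<gamma>' U = dotS \<and> (\<forall>a\<in>carrier A. \<gamma>' (j (dotA a)) = dotA a) \<longrightarrow>
          (\<forall>x\<in>carrier F. \<gamma>' x = \<gamma> x))))"
proof -
  interpret exel_quotient A \<alpha> L T \<iota> S E q
    by (intro exel_quotient.intro exel_quotient_axioms.intro A \<alpha> L proj E)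
  have [simp]: "\<A> = R.Core" by (simp add: \<A> dotA dotS R.core_def)
  show ?thesis
    using R.Core_cstar R.shift_endomorphism R.unshift_complete_transfer crossed_product_iso[of F j U]
    by (simp add: \<delta> \<delta>s dotA dotS)
qed

end
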